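(* Let $N\in\mathbb{Z}_{\ge1}$, $r_n\in\mathbb{Z}$ for $n\mid N$, $\mathbf r=(r_n)_{n\mid N}$, $k'=\frac12\sum_{n\mid N}r_n$, $x_N=\sum_{n\mid N}nr_n$, $\varpi=\prod_{n\mid N}(N/n)^{|r_n|}$, and let $\chi_{\mathbf r}$ be the character of $\prod_{n\mid N}\eta(n\tau)^{r_n}$ on $\widetilde{\Gamma_0(N)}$. Let $f$ be a meromorphic modular form on $\Gamma_0(N)$ of weight $k\in k'+2\mathbb{Z}$ with character $\chi_{\mathbf r}$, and let $l\in L_{\mathbf r}$. Then: (a) there are $Y_0\ge0$ and uniquely determined $c_f(n),c_{T_lf}(n)\in\mathbb{C}$ such that on $\operatorname{Im}\tau>Y_0$ $$f(\tau)=\sum_{n\in\frac{x_N}{24}+\mathbb{Z}}c_f(n)q^n,\qquad T_lf(\tau)=\sum_{n\in\frac{x_N}{24}+\mathbb{Z}}c_{T_lf}(n)q^n,$$ where $T_l=T_{l;\chi_{\mathbf r},\chi_{\mathbf r}}$; (b) for $n\in\frac{x_N}{24}+\mathbb{Z}$, $$c_{T_lf}(n)=l^{-\frac k2}\sum_{\substack{a\mid l,\ d=l/a\\(a,N)=1}}\Big(\frac a\varpi\Big)a^k\,c_f\Big(\frac{ln}{a^2}\Big)\sum_{\substack{0\le b<d\\(a,b,d)=1}}\Big(\frac{-Nb}{(a,d)}\Big)^{2k}e\Big(bd\Big(\frac nl-\frac{x_N}{24}\Big)\Big)\psi_{l,\mathbf r}(a,b),$$ with the convention $c_f(\frac{ln}{a^2})=0$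 if $\frac{ln}{a^2}\notin\frac{x_N}{24}+\mathbb{Z}$, where $\psi_{l,\mathbf r}(a,b)=e\big(-\frac{k+\delta}4(d-1)+\frac{(k+\delta)(l-1)(N-1)}4\big)$ if $2\nmid l$; $=e\big(-\frac{k+\delta}4(a-1)-\frac{N(k+\delta)(1+\delta_1)}4b\big)$ if $2\mid l$, $2\mid N$; $=1$ if $2\mid l$, $2\nmid N$; here $\delta=0$ (resp. $1$) if $\varpi=2^\alpha(4m+1)$ (resp. $2^\alpha(4m+3)$) with $\alpha,m\in\mathbb{Z}_{\ge0}$, and $\delta_1=1$ if $2\mid l$, $4\mid N$, $k\in\frac12+\mathbb{Z}$ and $v_2(\varpi)$ is odd, $\delta_1=0$ otherwise.
   Context: $e(x)=\exp(2\pi ix)$, $q=e(\tau)$, $\eta(\tau)=q^{1/24}\prod(1-q^n)$. $\widetilde{\Gamma_0(N)}$: pairs $(\gamma,\varepsilon(c\tau+d)^{1/2})$, $\gamma=\begin{pmatrix}a&b\\c&d\end{pmatrix}\in\Gamma_0(N)$, $\varepsilon=\pm1$ (principal square root), product $(\gamma_1,\phi_1)(\gamma_2,\phi_2)=(\gamma_1\gamma_2,\phi_1(\gamma_2\tau)\phi_2(\tau))$; $\widetilde\gamma=(\gamma,(c\tau+d)^{1/2})$; $(g|_k(\gamma,\phi))(\tau)=\phi(\tau)^{-2k}g(\gamma\tau)$. $\chi_{\mathbf r}(\gamma,\varepsilon(c\tau+d)^{1/2})=\varepsilon^{-2k'}e\big(\frac1{24}\sum_{n\mid N}r_n\Psi\begin{pmatrix}a&bn\\c/n&d\end{pmatrix}\big)$,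 $\Psi\begin{pmatrix}a&b\\c&d\end{pmatrix}=\frac{a+d}c+12s(-d,c)-3$ ($c>0$), $\frac{a+d}c+12s(d,-c)+3$ ($c<0$), $b$ ($c=0,a>0$), $-b-6$ ($c=0,a<0$), $s(h,c)=\sum_{r\bmod c}((r/c))((hr/c))$, $((x))=x-\lfloor x\rfloor-\frac12$ ($x\notin\mathbb{Z}$), else $0$. Meromorphic modular form of weight $k$ with character $\chi$: meromorphic $g$ on $\mathbb{H}$ with $g|_k\gamma=\chi(\gamma)g$ for $\gamma\in\widetilde{\Gamma_0(N)}$ and, for all $\gamma\in\mathrm{SL}_2(\mathbb{Z})$, $g|_k\widetilde\gamma=\sum_{n\in\frac1h\mathbb{Z}}c_nq^n$ for $\operatorname{Im}\tau$ large with finitely many $n<0$ having $c_n\ne0$. $m_{\mathbf r}=24/\gcd(24,\sum_n(N/n)r_n,\sum_n nr_n)$; $L_{\mathbf r}=\{l\ge1:l\equiv1\bmod m_{\mathbf r}\}$ if $k'\in\mathbb{Z}$, and additionally $l$ a perfect square if $k'\in\frac12+\mathbb{Z}$. $T_{l;\chi,\chi}g(\tau)=l^{-k/2}\sum_{a\mid l,(N,a)=1}a^k\sum_{0\le b<d,(a,b,d)=1}\chi(\widetilde{\begin{pmatrix}-Nb+ax&z\\-Nd&y\end{pmatrix}})^{-1}\chi(\widetilde{\begin{pmatrix}ay&by-dz\\N&x\end{pmatrix}})^{-1}g(\frac{a\tau+b}d)$, $d=l/a$, with integers $x,y,z$ satisfying $(-Nb+ax)y+Ndz=1$ (independent of the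 choice for such $l$). $(\frac mn)$ is the Kronecker–Jacobi symbol, with $(\frac m0)=0$ for $m\ne\pm1$ and $(\frac{\pm1}0)=1$; $(a,d)=\gcd(a,d)$; $v_2$ is the 2-adic valuation. *)

theory Defs
  imports "HOL-Complex_Analysis.Complex_Analysis" "HOL-Number_Theory.Number_Theory"
begin

definition upper_half :: "complex set" where
  "upper_half = {z. Im z > 0}"

definition e :: "complex \<Rightarrow> complex" where
  "e x = exp (2 * of_real pi * \<i> * x)"

text \<open>2x2 integer matrices (a, b, c, d) = [[a,b],[c,d]]\<close>
type_synonym mat2 = "int \<times> int \<times> int \<times> int"

definition mobius :: "mat2 \<Rightarrow> complex \<Rightarrow> complex" where
  "mobius M \<tau> = (case M of (a, b, c, d) \<Rightarrow>
      (of_int a * \<tau> + of_int b) / (of_int c * \<tau> + of_int d))"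

definition in_SL2Z :: "mat2 \<Rightarrow> bool" where
  "in_SL2Z M \<longleftrightarrow> (case M of (a, b, c, d) \<Rightarrow> a * d - b * c = 1)"

definition in_Gamma0 :: "nat \<Rightarrow> mat2 \<Rightarrow> bool" where
  "in_Gamma0 N M \<longleftrightarrow> in_SL2Z M \<and> (case M of (a, b, c, d) \<Rightarrow> int N dvd c)"

text \<open>Slash action of the metaplectic element (gamma, eps * (c tau + d)^(1/2))
  (principal square root, eps = +1 or -1):
  (g |_k (gamma, phi))(tau) = phi(tau)^(-2k) g(gamma tau).  The element
  with eps = 1 is the canonical lift (tilde gamma).\<close>
definition slash :: "real \<Rightarrow> (complex \<Rightarrow> complex) \<Rightarrow> mat2 \<Rightarrow> int \<Rightarrow> complex \<Rightarrow> complex" where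
  "slash k g M \<epsilon> \<tau> = (case M of (a, b, c, d) \<Rightarrow>
      (of_int \<epsilon> * csqrt (of_int c * \<tau> + of_int d)) powr (of_real (- 2 * k)) * g (mobius M \<tau>))"

definition sawtooth :: "real \<Rightarrow> real" where
  "sawtooth x = (if x \<in> \<int> then 0 else x - of_int \<lfloor>x\<rfloor> - 1/2)"

definition dedekind_sum :: "int \<Rightarrow> int \<Rightarrow> real" where
  "dedekind_sum h c = (\<Sum>r\<in>{0..<c}. sawtooth (of_int r / of_int c) * sawtooth (of_int (h * r) / of_int c))"

definition Psi :: "mat2 \<Rightarrow> real" where
  "Psi M = (case M of (a, b, c, d) \<Rightarrow>
     if c > 0 then of_int (a + d) / of_int c + 12 * dedekind_sum (- d) c - 3
     else if c < 0 then of_int (a + d) / of_int c + 12 * dedekind_sum d (- c) + 3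
     else if a > 0 then of_int b
     else of_int (- b - 6))"

definition divs :: "nat \<Rightarrow> nat set" where
  "divs N = {n. n dvd N}"

definition kprime :: "nat \<Rightarrow> (nat \<Rightarrow> int) \<Rightarrow> real" where
  "kprime N r = (\<Sum>n\<in>divs N. of_int (r n)) / 2"

text \<open>chi_r(gamma, eps (c tau + d)^(1/2))\<close>
definition chi_r :: "nat \<Rightarrow> (nat \<Rightarrow> int) \<Rightarrow> mat2 \<Rightarrow> int \<Rightarrow> complex" where
  "chi_r N r M \<epsilon> = (case M of (a, b, c, d) \<Rightarrow>
      (of_int \<epsilon>) powr (of_real (- 2 * kprime N r)) *
      e (of_real ((1/24) * (\<Sum>n\<in>divs N. of_int (r n) * Psi (a, b * int n, c div int n, d)))))"

text \<open>Meromorphic functions are normalised (nicely meromorphic: value 0 at poles,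
  removable singularities filled in).\<close>
definition meromorphic_modular_form ::
  "nat \<Rightarrow> real \<Rightarrow> (mat2 \<Rightarrow> int \<Rightarrow> complex) \<Rightarrow> (complex \<Rightarrow> complex) \<Rightarrow> bool" where
  "meromorphic_modular_form N k chi g \<longleftrightarrow>
     g nicely_meromorphic_on upper_half \<and>
     (\<forall>M \<epsilon> \<tau>. in_Gamma0 N M \<and> \<epsilon> \<in> {1, -1} \<and> \<tau> \<in> upper_half \<longrightarrow>
         slash k g M \<epsilon> \<tau> = chi M \<epsilon> * g \<tau>) \<and>
     (\<forall>M. in_SL2Z M \<longrightarrow>
        (\<exists>h::nat. h > 0 \<and> (\<exists>Y::real. \<exists>c::int \<Rightarrow> complex.
           finite {m. m < 0 \<and> c m \<noteq> 0} \<and>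
           (\<forall>\<tau>. Im \<tau> > Y \<longrightarrow>
              ((\<lambda>m. c m * e (of_int m / of_nat h * \<tau>)) has_sum slash k g M 1 \<tau>) UNIV))))"

definition m_r :: "nat \<Rightarrow> (nat \<Rightarrow> int) \<Rightarrow> int" where
  "m_r N r = 24 div gcd (gcd 24 (\<Sum>n\<in>divs N. int (N div n) * r n)) (\<Sum>n\<in>divs N. int n * r n)"

definition L_r :: "nat \<Rightarrow> (nat \<Rightarrow> int) \<Rightarrow> nat set" where
  "L_r N r = {l. l \<ge> 1 \<and> [int l = 1] (mod m_r N r) \<and>
     (kprime N r \<in> {x + 1/2 | x. x \<in> \<int>} \<longrightarrow> (\<exists>t::nat. l = t ^ 2))}"

definition hecke :: "nat \<Rightarrow> real \<Rightarrow> (mat2 \<Rightarrow> int \<Rightarrow> complex) \<Rightarrow> nat \<Rightarrow>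
    (complex \<Rightarrow> complex) \<Rightarrow> complex \<Rightarrow> complex" where
  "hecke N k chi l g \<tau> =
     of_real (real l powr (- k / 2)) *
     (\<Sum>a\<in>{a. a dvd l \<and> coprime N a}.
        let d = l div a in
        of_real (real a powr k) *
        (\<Sum>b\<in>{b. b < d \<and> gcd (gcd a b) d = 1}.
           let (x, y, z) = (SOME (x, y, z). (- int N * int b + int a * x) * y + int N * int d * z = (1::int))
           in inverse (chi (- int N * int b + int a * x, z, - int N * int d, y) 1) *
              inverse (chi (int a * y, int b * y - int d * z, int N, x) 1) *
              g ((of_nat a * \<tau> + of_nat b) / of_nat d)))"

definition kron_prime :: "int \<Rightarrow> nat \<Rightarrow> int" where
  "kron_prime m p = (if p = 2 then (if even m then 0 else if m mod 8 \<in> {1, 7} then 1 else -1)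
                     else Legendre m (int p))"

definition kronecker :: "int \<Rightarrow> int \<Rightarrow> int" where
  "kronecker m n =
    (if n = 0 then (if m = 1 \<or> m = -1 then 1 else 0)
     else (if n < 0 \<and> m < 0 then -1 else 1) *
          (\<Prod>p\<in>prime_factors (nat \<bar>n\<bar>). kron_prime m p ^ multiplicity p (nat \<bar>n\<bar>)))"

definition x_N :: "nat \<Rightarrow> (nat \<Rightarrow> int) \<Rightarrow> int" where
  "x_N N r = (\<Sum>n\<in>divs N. int n * r n)"

definition varpi :: "nat \<Rightarrow> (nat \<Rightarrow> int) \<Rightarrow> nat" where
  "varpi N r = (\<Prod>n\<in>divs N. (N div n) ^ nat \<bar>r n\<bar>)"

definition exps :: "nat \<Rightarrow> (nat \<Rightarrow> int) \<Rightarrow> rat set" where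
  "exps N r = {of_int (x_N N r) / 24 + of_int m | m. m \<in> (UNIV :: int set)}"

definition delta0 :: "nat \<Rightarrow> (nat \<Rightarrow> int) \<Rightarrow> real" where
  "delta0 N r = (if \<exists>\<alpha> m::nat. varpi N r = 2 ^ \<alpha> * (4 * m + 1) then 0 else 1)"

definition delta1 :: "nat \<Rightarrow> (nat \<Rightarrow> int) \<Rightarrow> real \<Rightarrow> nat \<Rightarrow> real" where
  "delta1 N r k l = (if even l \<and> 4 dvd N \<and> k \<in> {x + 1/2 | x. x \<in> \<int>}
                        \<and> odd (multiplicity (2::nat) (varpi N r)) then 1 else 0)"

definition psi_lr :: "nat \<Rightarrow> (nat \<Rightarrow> int) \<Rightarrow> real \<Rightarrow> nat \<Rightarrow> nat \<Rightarrow> nat \<Rightarrow> complex" where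
  "psi_lr N r k l a b =
     (let d = l div a; \<delta> = delta0 N r; \<delta>\<^sub>1 = delta1 N r k l in
      if odd l then
        e (of_real (- (k + \<delta>) / 4 * (real d - 1) + (k + \<delta>) * (real l - 1) * (real N - 1) / 4))
      else if even N then
        e (of_real (- (k + \<delta>) / 4 * (real a - 1) - real N * (k + \<delta>) * (1 + \<delta>\<^sub>1) / 4 * real b))
      else 1)"

end

theory Submission
  imports Defs "HOL-Computational_Algebra.Nth_Powers"
begin

text \<open>
  Inserting the expansion of \<open>f\<close> into the Hecke sum gives an expansion of \<open>T\<^sub>l f\<close>, so the theorem
  amounts to evaluating the product of the two character values attached to \<open>(a, b)\<close>. It equals
  \<open>e(T / 24)\<close> with \<open>T\<close> a sum over \<open>n | N\<close> of differences of two values of \<open>\<Psi>\<close>. Dedekind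
  reciprocity turns into \<open>\<Psi>(\<gamma>) = \<Psi>(\<gamma> S) + 3\<close> for \<open>c, d > 0\<close>, and the Euclidean algorithm then
  determines \<open>\<Psi>\<close> modulo 3 by a polynomial and modulo 8 by a polynomial and a Jacobi symbol.

  Modulo 24 the sum \<open>T\<close> depends on \<open>r\<close> only through a few linear forms in \<open>r\<close>, such as \<open>\<Sum> n r\<^sub>n\<close>,
  \<open>\<Sum> (N/n) r\<^sub>n\<close> and \<open>\<Sum> r\<^sub>n\<close>; the condition \<open>l \<in> L\<^sub>r\<close> enters only through \<open>24 | (l - 1) \<Sum> n r\<^sub>n\<close>,
  \<open>24 | (l - 1) \<Sum> (N/n) r\<^sub>n\<close>, and \<open>l\<close> being a square if \<open>\<Sum> r\<^sub>n\<close> is odd.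

  The product formula holds for every integer \<open>b\<close> and every choice of \<open>x, y, z\<close>. The choices
  \<open>(x + N, y, z)\<close> and \<open>(x, y, z + y)\<close> therefore show that replacing \<open>b\<close> by \<open>b + a\<close> or \<open>b + d\<close>
  multiplies it by \<open>e(- x\<^sub>N / 24)\<close>, and so the exponents outside \<open>x\<^sub>N / 24 + \<int>\<close> cancel in the sum over \<open>b\<close>.
\<close>

subsection \<open>Kronecker symbols\<close>

text \<open>The obstacle is that one formula for \<Psi> modulo 8 must serve all divisors n at once,
  although N/n and n take both parities when N is even and Jacobi symbols need odd denominators. The
  symbols belonging to one n are arranged so that those in x and y over N/n combine into (a /
  (N/n)), because the determinant gives axy = 1 modulo N/n. Weighted by r_n they multiply up to the
  symbol of a over \<open>varpi\<close>, while the odd part of \<open>varpi\<close> modulo 4 and its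
  2-adic valuation account for \<delta> and for the extra factor in \<psi>. What remains is
  polynomial. For even l the number l - 1 is odd, so 8 divides both \<Sum> n r_n and \<Sum> (N/n)
  r_n; for odd l the leftover terms carry the even factor l - 1, which is divisible by 8 if l is a
  square. This is the origin of the cases of \<psi>. The factor 3 seen in many terms modulo 8 comes
  from writing quarters over 24: (k + \<delta>) / 4 is 3 (2k + 2 \<delta>) / 24, and 2k + 2 \<delta>
  agrees modulo 4 with a linear form in r.\<close>

lemma kronecker_eq_prod_mset:
  assumes "n > 0"
  shows "kronecker m (int n) = (\<Prod>p\<in>#prime_factorization n. kron_prime m p)"
proof -
  have "(\<Prod>p\<in>#prime_factorization n. kron_prime m p)
      = (\<Prod>p\<in>prime_factors n. kron_prime m p ^ count (prime_factorization n) p)"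
    by (rule image_prod_mset_multiplicity)
  also have "\<dots> = (\<Prod>p\<in>prime_factors n. kron_prime m p ^ multiplicity p n)"
    by (intro prod.cong refl) (simp add: count_prime_factorization_prime in_prime_factors_iff)
  finally show ?thesis using assms by (simp add: kronecker_def)
qed

lemma kronecker_one_right [simp]: "kronecker m 1 = 1"
  using kronecker_eq_prod_mset[of 1 m] by simp

lemma kronecker_mult_right:
  assumes "n1 > 0" "n2 > 0"
  shows "kronecker m (int (n1 * n2)) = kronecker m (int n1) * kronecker m (int n2)"
  using assms by (simp only: kronecker_eq_prod_mset nat_0_less_mult_iff)
    (simp add: prime_factorization_mult)

lemma kronecker_prime: "prime p \<Longrightarrow> kronecker m (int p) = kron_prime m p"
  by (simp add: kronecker_eq_prod_mset prime_gt_0_nat prime_factorization_prime)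

text \<open>Euler's criterion makes the symbol congruent to a power modulo p, and powers are
  multiplicative. Both sides lie in {-1, 0, 1}, so a difference divisible by p > 2 is zero.\<close>

lemma Legendre_mult:
  assumes "prime p" "2 < p"
  shows "Legendre (a * b) (int p) = Legendre a (int p) * Legendre b (int p)"
proof -
  let ?k = "(p - 1) div 2"
  have E: "[Legendre c (int p) = c ^ ?k] (mod int p)" for c
    using euler_criterion[OF assms] by simp
  have "[Legendre a (int p) * Legendre b (int p) = a ^ ?k * b ^ ?k] (mod int p)"
    by (intro cong_mult E)
  then have "[Legendre (a * b) (int p) = Legendre a (int p) * Legendre b (int p)] (mod int p)"
    using E[of "a * b"] by (metis cong_sym cong_trans power_mult_distrib)
  moreover have "Legendre c (int p) \<in> {-1, 0, 1}" for c
    by (auto simp: Legendre_def)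
  ultimately have "int p dvd Legendre (a * b) (int p) - Legendre a (int p) * Legendre b (int p)"
    and "\<bar>Legendre (a * b) (int p) - Legendre a (int p) * Legendre b (int p)\<bar> \<le> 2"
    subgoal by (simp add: cong_iff_dvd_diff)
    subgoal by (smt (verit, best) Legendre_def mult_cancel_left1 mult_minus_right mult_zero_left mult_zero_right)
    done
  then show ?thesis
    using assms(2) zdvd_not_zless[of "\<bar>Legendre (a * b) (int p) - Legendre a (int p) * Legendre b (int p)\<bar>" "int p"]
    by fastforce
qed

lemma Legendre_cong:
  assumes "[a = b] (mod p)"
  shows "Legendre a p = Legendre b p"
proof -
  have "[a = 0] (mod p) \<longleftrightarrow> [b = 0] (mod p)"
    using assms cong_sym cong_trans by blast
  moreover have "[y^2 = a] (mod p) \<longleftrightarrow> [y^2 = b] (mod p)" for y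
    using assms cong_sym cong_trans by blast
  ultimately show ?thesis by (simp add: Legendre_def QuadRes_def)
qed

lemma odd_mod_8_cases:
  fixes x :: int assumes "odd x"
  shows "x mod 8 = 1 \<or> x mod 8 = 3 \<or> x mod 8 = 5 \<or> x mod 8 = 7"
  using assms by presburger

lemma kron_prime_mult:
  assumes "prime p"
  shows "kron_prime (a * b) p = kron_prime a p * kron_prime b p"
proof (cases "p = 2")
  case True
  show ?thesis
  proof (cases "even a \<or> even b")
    case False
    then have odd: "odd a" "odd b" by auto
    obtain i where i: "a mod 8 = i" "i \<in> {1, 3, 5, 7}" using odd_mod_8_cases[OF odd(1)] by auto
    obtain j where j: "b mod 8 = j" "j \<in> {1, 3, 5, 7}" using odd_mod_8_cases[OF odd(2)] by auto
    have ij: "(a * b) mod 8 = (i * j) mod 8" unfolding i(1)[symmetric] j(1)[symmetric] by (rule mod_mult_eq[symmetric])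
    have "kron_prime a p = (if i \<in> {1, 7} then 1 else -1)" "kron_prime b p = (if j \<in> {1, 7} then 1 else -1)"
      "kron_prime (a * b) p = (if (i * j) mod 8 \<in> {1, 7} then 1 else -1)"
      unfolding kron_prime_def i(1) j(1) ij using odd True by simp_all
    then show ?thesis using i(2) j(2) by auto
  qed (use True in \<open>auto simp: kron_prime_def\<close>)
next
  case False
  then have "2 < p" using assms prime_ge_2_nat[of p] by linarith
  then show ?thesis using Legendre_mult[OF assms] False by (simp add: kron_prime_def)
qed

lemma kron_prime_unit:
  assumes "prime p" "coprime m (int p)"
  shows "kron_prime m p = 1 \<or> kron_prime m p = -1"
proof (cases "p = 2")
  case False
  have "\<not> [m = 0] (mod int p)"
  proof
    assume "[m = 0] (mod int p)"
    then have "int p dvd m" by (simp add: cong_0_iff)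
    then have "is_unit (int p)" using coprime_common_divisor[OF assms(2), of "int p"] by simp
    then show False using assms(1) by auto
  qed
  then show ?thesis using False by (auto simp: kron_prime_def Legendre_def)
qed (use assms in \<open>auto simp: kron_prime_def\<close>)

lemma kronecker_mult_left:
  assumes "n > 0"
  shows "kronecker (a * b) (int n) = kronecker a (int n) * kronecker b (int n)"
  using assms
proof (induction n rule: prime_divisors_induct)
  case (factor p x)
  then have x: "x > 0" "p > 0" by (auto intro: Nat.gr0I)
  show ?case
    using factor x
    by (simp only: kronecker_mult_right[OF x(2,1)] kronecker_prime kron_prime_mult) (simp add: mult_ac)
qed auto

lemma kronecker_unit:
  assumes "n > 0" "coprime m (int n)"
  shows "kronecker m (int n) = 1 \<or> kronecker m (int n) = -1"
  using assms
proof (induction n rule: prime_divisors_induct)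
  case (factor p x)
  then have x: "x > 0" "p > 0" by (auto intro: Nat.gr0I)
  have c: "coprime m (int p)" "coprime m (int x)" using factor.prems by auto
  show ?case
    using factor.IH[OF x(1) c(2)] kron_prime_unit[OF factor.hyps c(1)]
    unfolding kronecker_mult_right[OF x(2,1)] kronecker_prime[OF factor.hyps] by auto
qed auto

text \<open>Every odd prime factor sees only the residue modulo that prime, whereas the factor at 2
  has period 8.\<close>

lemma kronecker_cong:
  assumes "n > 0" "odd n" "[a = b] (mod int n)"
  shows "kronecker a (int n) = kronecker b (int n)"
  using assms
proof (induction n rule: prime_divisors_induct)
  case (factor p x)
  then have x: "x > 0" "p > 0" "odd x" "p \<noteq> 2" by (auto intro: Nat.gr0I)
  have c: "[a = b] (mod int p)" "[a = b] (mod int x)"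
    using factor.prems by (auto intro: cong_dvd_modulus)
  show ?case
    using factor.IH[OF x(1,3) c(2)] Legendre_cong[OF c(1)] x(4)
    by (simp only: kronecker_mult_right[OF x(2,1)] kronecker_prime[OF factor.hyps(1)] kron_prime_def if_False)
qed auto

lemma kronecker_one_left [simp]: "n > 0 \<Longrightarrow> kronecker 1 (int n) = 1"
proof -
  assume n: "n > 0"
  have "kronecker 1 (int n) * kronecker 1 (int n) = kronecker 1 (int n)"
    using kronecker_mult_left[OF n, of 1 1] by simp
  moreover have "kronecker 1 (int n) = 1 \<or> kronecker 1 (int n) = -1"
    using kronecker_unit[OF n] by simp
  ultimately show ?thesis by auto
qed

section \<open>Supplementary laws and quadratic reciprocity for odd positive denominators\<close>

lemma Legendre_minus_one:
  assumes "prime p" "2 < p"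
  shows "Legendre (-1) (int p) = (if p mod 4 = 1 then 1 else -1)"
proof -
  have "odd p" using assms prime_odd_nat by auto
  have "[Legendre (-1) (int p) = (-1) ^ ((p - 1) div 2)] (mod int p)"
    using euler_criterion[OF assms] by simp
  moreover have "even ((p - 1) div 2) \<longleftrightarrow> p mod 4 = 1" using \<open>odd p\<close> by presburger
  ultimately have 1: "int p dvd Legendre (-1) (int p) - (if p mod 4 = 1 then 1 else -1)"
    by (auto simp: cong_iff_dvd_diff split: if_splits)
  have "\<bar>Legendre (-1) (int p) - (if p mod 4 = 1 then 1 else -1)\<bar> \<le> 2"
    by (auto simp: Legendre_def)
  then have "\<bar>Legendre (-1) (int p) - (if p mod 4 = 1 then 1 else -1)\<bar> < int p" using assms by linarith
  with 1 dvd_imp_le_int[of "Legendre (-1) (int p) - (if p mod 4 = 1 then 1 else -1)" "int p"]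
  show ?thesis by linarith
qed

lemma kronecker_minus_one:
  assumes "odd n"
  shows "kronecker (-1) (int n) = (if n mod 4 = 1 then 1 else -1)"
  using assms
proof (induction n rule: prime_divisors_induct)
  case (factor p x)
  then have x: "x > 0" "p > 0" "odd x" "p \<noteq> 2" "odd p" by (auto intro: Nat.gr0I)
  then have p2: "p > 2" using prime_ge_2_nat[OF factor.hyps(1)] by linarith
  have "p mod 4 = 1 \<or> p mod 4 = 3" "x mod 4 = 1 \<or> x mod 4 = 3" using x by presburger+
  then obtain i j where i: "p mod 4 = i" "i = 1 \<or> i = 3" and j: "x mod 4 = j" "j = 1 \<or> j = 3" by blast
  have ij: "(p * x) mod 4 = (i * j) mod 4" unfolding i(1)[symmetric] j(1)[symmetric] by (rule mod_mult_eq[symmetric])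
  have "kron_prime (-1) p = (if i = 1 then 1 else -1)"
    using Legendre_minus_one[OF factor.hyps p2] x(4) i(1) by (simp add: kron_prime_def)
  moreover have "kronecker (-1) (int x) = (if j = 1 then 1 else -1)" using factor.IH[OF x(3)] j(1) by simp
  ultimately show ?case
    unfolding kronecker_mult_right[OF x(2,1)] kronecker_prime[OF factor.hyps(1)] ij using i(2) j(2) by auto
qed auto

text \<open>For odd m and n this is (-1)^((m-1)/2 * (n-1)/2), written with residues modulo 4 so that
  its multiplicativity is a finite check.\<close>

definition rsign :: "nat \<Rightarrow> nat \<Rightarrow> int" where
  "rsign m n = (if m mod 4 = 3 \<and> n mod 4 = 3 then -1 else 1)"

lemma rsign_mult:
  assumes "odd m1" "odd m2" "odd n"
  shows "rsign (m1 * m2) n = rsign m1 n * rsign m2 n" "rsign n (m1 * m2) = rsign n m1 * rsign n m2"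
proof -
  have "m1 mod 4 = 1 \<or> m1 mod 4 = 3" "m2 mod 4 = 1 \<or> m2 mod 4 = 3" using assms by presburger+
  then obtain i j where i: "m1 mod 4 = i" "i = 1 \<or> i = 3" and j: "m2 mod 4 = j" "j = 1 \<or> j = 3" by blast
  have ij: "(m1 * m2) mod 4 = (i * j) mod 4" unfolding i(1)[symmetric] j(1)[symmetric] by (rule mod_mult_eq[symmetric])
  show "rsign (m1 * m2) n = rsign m1 n * rsign m2 n" "rsign n (m1 * m2) = rsign n m1 * rsign n m2"
    unfolding rsign_def ij i(1) j(1) using i(2) j(2) by auto
qed

lemma kronecker_reciprocity_prime:
  assumes "prime p" "p > 2" "odd n" "coprime p n"
  shows "kronecker (int p) (int n) * kronecker (int n) (int p) = rsign p n"
  using assms(3,4)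
proof (induction n rule: prime_divisors_induct)
  case (unit x)
  then show ?case using prime_gt_0_nat[OF assms(1)] by (auto simp: rsign_def)
next
  case (factor q x)
  then have x: "x > 0" "q > 0" "odd x" "q \<noteq> 2" "odd q" by (auto intro: Nat.gr0I)
  have q2: "q > 2" using x prime_ge_2_nat[OF factor.hyps(1)] by linarith
  have pq: "p \<noteq> q" using factor.prems assms(1) by auto
  have "odd p" using assms(1,2) prime_odd_nat by auto
  have p0: "p > 0" using assms(2) by simp
  have even_iff: "even ((p - 1) div 2 * ((q - 1) div 2)) \<longleftrightarrow> \<not> (p mod 4 = 3 \<and> q mod 4 = 3)"
  proof -
    have "even ((p - 1) div 2) \<longleftrightarrow> p mod 4 \<noteq> 3" "even ((q - 1) div 2) \<longleftrightarrow> q mod 4 \<noteq> 3"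
      using \<open>odd p\<close> \<open>odd q\<close> by presburger+
    then show ?thesis by simp
  qed
  have "Legendre p q * Legendre q p = rsign p q"
    using Quadratic_Reciprocity[OF assms(1,2) factor.hyps q2 pq] even_iff
    by (auto simp: rsign_def simp del: even_mult_iff)
  moreover have "kronecker (int p) (int x) * kronecker (int x) (int p) = rsign p x"
    using factor x by auto
  moreover have "kronecker (int p) (int q) = Legendre p q" "kronecker (int q) (int p) = Legendre q p"
    unfolding kronecker_prime[OF assms(1)] kronecker_prime[OF factor.hyps(1)]
    using q2 assms(2) by (simp_all add: kron_prime_def)
  moreover have e: "kronecker (int p) (int (q * x)) = kronecker (int p) (int q) * kronecker (int p) (int x)"
      "kronecker (int (q * x)) (int p) = kronecker (int q) (int p) * kronecker (int x) (int p)"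
    using kronecker_mult_right[OF x(2,1)] kronecker_mult_left[OF p0, of "int q" "int x"] by simp_all
  have "kronecker (int p) (int (q * x)) * kronecker (int (q * x)) (int p) =
     (kronecker (int p) (int q) * kronecker (int q) (int p)) * (kronecker (int p) (int x) * kronecker (int x) (int p))"
    unfolding e by (simp only: mult_ac)
  ultimately show ?case
    using rsign_mult(2)[OF x(5,3) \<open>odd p\<close>] by metis
qed auto

lemma kronecker_reciprocity_mult:
  assumes "odd m" "odd n" "coprime m n"
  shows "kronecker (int m) (int n) * kronecker (int n) (int m) = rsign m n"
  using assms
proof (induction m rule: prime_divisors_induct)
  case (unit x)
  then have "n > 0" by (auto intro: Nat.gr0I)
  then show ?case using unit by (auto simp: rsign_def)
next
  case (factor p x)
  then have x: "x > 0" "p > 0" "odd x" "p \<noteq> 2" "odd p" by (auto intro: Nat.gr0I)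
  have p2: "p > 2" using x prime_ge_2_nat[OF factor.hyps(1)] by linarith
  have n0: "n > 0" using factor.prems by (auto intro: Nat.gr0I)
  have "kronecker (int p) (int n) * kronecker (int n) (int p) = rsign p n"
    using kronecker_reciprocity_prime[OF factor.hyps p2] factor.prems by auto
  moreover have "kronecker (int x) (int n) * kronecker (int n) (int x) = rsign x n"
    using factor x by auto
  moreover have e: "kronecker (int n) (int (p * x)) = kronecker (int n) (int p) * kronecker (int n) (int x)"
      "kronecker (int (p * x)) (int n) = kronecker (int p) (int n) * kronecker (int x) (int n)"
    using kronecker_mult_right[OF x(2,1)] kronecker_mult_left[OF n0, of "int p" "int x"] by simp_all
  have "kronecker (int (p * x)) (int n) * kronecker (int n) (int (p * x)) =
     (kronecker (int p) (int n) * kronecker (int n) (int p)) * (kronecker (int x) (int n) * kronecker (int n) (int x))"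
    unfolding e by (simp only: mult_ac)
  ultimately show ?case
    using rsign_mult(1)[OF x(5,3) factor.prems(2)] by metis
qed auto

lemma kronecker_reciprocity:
  assumes "odd m" "odd n" "coprime m n"
  shows "kronecker (int m) (int n) = rsign m n * kronecker (int n) (int m)"
proof -
  have "m > 0" using assms by (auto intro: Nat.gr0I)
  then have "kronecker (int n) (int m) = 1 \<or> kronecker (int n) (int m) = -1"
    using kronecker_unit assms by (simp add: coprime_commute)
  then show ?thesis using kronecker_reciprocity_mult[OF assms] by auto
qed

text \<open>Descent from n to k = n - 2: modulo n the number 2 is -k, and modulo k the number n is
  2, so flipping (k/n) gives (2/n) = (-1/n) (2/k). The flip costs no sign, since k and k + 2 are not
  both 3 modulo 4.\<close>

lemma kronecker_two:
  assumes "odd n"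
  shows "kronecker 2 (int n) = (if n mod 8 = 1 \<or> n mod 8 = 7 then 1 else -1)"
  using assms
proof (induction n rule: less_induct)
  case (less n)
  show ?case
  proof (cases "n = 1")
    case False
    then obtain k where k: "n = k + 2" "odd k" using less.prems
      by (metis One_nat_def add_2_eq_Suc' even_Suc not0_implies_Suc odd_pos less_irrefl)
    have n0: "n > 0" "k > 0" using k by (auto intro: Nat.gr0I)
    have "coprime k (k + 2)" using k(2)
      by (metis coprime_iff_gcd_eq_1 gcd_add2 coprime_right_2_iff_odd)
    then have co: "coprime k n" using k by simp
    have "kronecker 2 (int n) = kronecker (-1 * int k) (int n)"
      by (rule kronecker_cong) (use n0 less.prems k in \<open>auto simp: cong_iff_dvd_diff\<close>)
    also have "\<dots> = kronecker (-1) (int n) * kronecker (int k) (int n)"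
      by (rule kronecker_mult_left[OF n0(1)])
    also have "kronecker (int k) (int n) = rsign k n * kronecker (int n) (int k)"
      by (rule kronecker_reciprocity) (use k less.prems co in auto)
    also have "kronecker (int n) (int k) = kronecker 2 (int k)"
      by (rule kronecker_cong) (use n0 k in \<open>auto simp: cong_iff_dvd_diff\<close>)
    also have "kronecker 2 (int k) = (if k mod 8 = 1 \<or> k mod 8 = 7 then 1 else -1)"
      by (rule less.IH) (use k in auto)
    also have "kronecker (-1) (int n) = (if n mod 4 = 1 then 1 else -1)"
      using less.prems by (rule kronecker_minus_one)
    also have "rsign k n = 1"
      unfolding rsign_def k(1) using k(2) by presburger
    finally have *: "kronecker 2 (int n) = (if n mod 4 = 1 then 1 else -1) * (if k mod 8 = 1 \<or> k mod 8 = 7 then 1 else -1)"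
      by simp
    have "k mod 8 = 1 \<or> k mod 8 = 3 \<or> k mod 8 = 5 \<or> k mod 8 = 7" using k(2) by presburger
    moreover have n8: "n mod 8 = (k mod 8 + 2) mod 8" unfolding k(1) by (rule mod_add_left_eq[symmetric])
    moreover have "n mod 4 = (n mod 8) mod 4" by (simp add: mod_mod_cancel)
    then have "n mod 4 = ((k mod 8 + 2) mod 8) mod 4" unfolding n8 .
    ultimately show ?thesis unfolding * by (elim disjE) simp_all
  qed simp
qed

subsection \<open>Dedekind sums\<close>

lemma sum_int_lessThan:
  fixes k :: int assumes "k \<ge> 0"
  shows "2 * (\<Sum>r\<in>{0..<k}. r) = k * (k - 1) \<and> 6 * (\<Sum>r\<in>{0..<k}. r^2) = (k - 1) * k * (2 * k - 1)"
  using assms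
proof (induction k rule: int_ge_induct)
  case (step i)
  have "{0..<i + 1} = insert i {0..<i}" using step.hyps by auto
  then show ?case using step.IH by (auto simp: algebra_simps power2_eq_square)
qed simp

lemma bij_betw_mult_mod:
  fixes h k :: int assumes "k > 0" "coprime h k"
  shows "bij_betw (\<lambda>r. (h * r) mod k) {0..<k} {0..<k}"
proof -
  have inj: "inj_on (\<lambda>r. (h * r) mod k) {0..<k}"
  proof (rule inj_onI)
    fix r s assume rs: "r \<in> {0..<k}" "s \<in> {0..<k}" "(h * r) mod k = (h * s) mod k"
    then have "[h * r = h * s] (mod k)" by (simp add: cong_def)
    then have "[r = s] (mod k)" using assms(2) by (simp add: cong_mult_lcancel)
    then show "r = s" using rs by (simp add: cong_def)
  qed
  moreover have "(\<lambda>r. (h * r) mod k) ` {0..<k} \<subseteq> {0..<k}" using assms by auto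
  ultimately show ?thesis
    by (simp add: bij_betw_def endo_inj_surj)
qed

lemma sawtooth_of_int_div:
  fixes m k :: int assumes "k > 0" "\<not> k dvd m"
  shows "sawtooth (of_int m / of_int k) = of_int (m mod k) / of_int k - 1/2"
proof -
  have "of_int m / of_int k \<notin> (\<int> :: real set)"
    using assms by (metis of_int_div_of_int_in_Ints_iff less_irrefl)
  moreover have "real_of_int m = of_int k * of_int (m div k) + of_int (m mod k)"
    by (metis mult_div_mod_eq of_int_add of_int_mult)
  then have "of_int m / of_int k = of_int (m div k) + of_int (m mod k) / (of_int k :: real)"
    using assms(1) by (simp add: field_simps)
  moreover have "\<lfloor>of_int m / of_int k :: real\<rfloor> = m div k" by (rule floor_divide_of_int_eq)
  ultimately show ?thesis by (simp add: sawtooth_def)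
qed

text \<open>Multiplication by h permutes the residues modulo k, so expanding the sawtooth product
  leaves a single unknown sum, which is an integer. Reciprocity can then be proved over the
  integers.\<close>

lemma dedekind_sum_eq:
  fixes h k :: int assumes k: "k > 0" and hk: "coprime h k"
  shows "dedekind_sum h k = of_int (\<Sum>r\<in>{0..<k}. r * ((h * r) mod k)) / (of_int k)^2 - (of_int k - 1) / 4"
proof -
  let ?rho = "\<lambda>r. (h * r) mod k"
  let ?K = "of_int k :: real"
  have bij: "(\<Sum>r\<in>{0..<k}. ?rho r) = (\<Sum>r\<in>{0..<k}. r)"
    using sum.reindex_bij_betw[OF bij_betw_mult_mod[OF k hk], of "\<lambda>x. x"] by simp
  have K: "?K \<noteq> 0" using k by simp
  have ins: "{0..<k} = insert 0 {1..<k}" using k by auto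
  have "dedekind_sum h k = (\<Sum>r\<in>{1..<k}. sawtooth (of_int r / ?K) * sawtooth (of_int (h * r) / ?K))"
    unfolding dedekind_sum_def ins by (simp add: sawtooth_def)
  also have "\<dots> = (\<Sum>r\<in>{1..<k}. (of_int r / ?K - 1/2) * (of_int (?rho r) / ?K - 1/2))"
  proof (rule sum.cong[OF refl])
    fix r assume r: "r \<in> {1..<k}"
    then have nd: "\<not> k dvd r" using zdvd_not_zless by auto
    then have "\<not> k dvd h * r" using hk by (simp add: coprime_commute coprime_dvd_mult_right_iff)
    then show "sawtooth (of_int r / ?K) * sawtooth (of_int (h * r) / ?K) = (of_int r / ?K - 1/2) * (of_int (?rho r) / ?K - 1/2)"
      using sawtooth_of_int_div[OF k nd] sawtooth_of_int_div[OF k, of "h * r"] r by simp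
  qed
  \<comment> \<open>The linear expression at r = 0 equals 1/4, while the sawtooth vanishes
    there.\<close>
  also have "\<dots> = (\<Sum>r\<in>{0..<k}. (of_int r / ?K - 1/2) * (of_int (?rho r) / ?K - 1/2)) - 1/4"
    unfolding ins by simp
  also have "(\<Sum>r\<in>{0..<k}. (of_int r / ?K - 1/2) * (of_int (?rho r) / ?K - 1/2))
     = (\<Sum>r\<in>{0..<k}. of_int (r * ?rho r) / ?K^2 - of_int r / (2 * ?K) - of_int (?rho r) / (2 * ?K) + 1/4)"
    by (rule sum.cong[OF refl]) (use K in \<open>simp add: field_simps power2_eq_square\<close>)
  also have "\<dots> = of_int (\<Sum>r\<in>{0..<k}. r * ?rho r) / ?K^2 - of_int (\<Sum>r\<in>{0..<k}. r) / (2 * ?K)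
        - of_int (\<Sum>r\<in>{0..<k}. ?rho r) / (2 * ?K) + ?K / 4"
    using k by (simp add: sum.distrib sum_subtractf sum_divide_distrib)
  also have "\<dots> = of_int (\<Sum>r\<in>{0..<k}. r * ?rho r) / ?K^2 - of_int (2 * (\<Sum>r\<in>{0..<k}. r)) / (2 * ?K) + ?K / 4"
    unfolding bij by (simp add: field_simps)
  also have "of_int (2 * (\<Sum>r\<in>{0..<k}. r)) / (2 * ?K) = (?K - 1) / 2"
    using sum_int_lessThan[of k] k by simp
  finally show ?thesis by (simp add: field_simps)
qed

section \<open>Reciprocity for Dedekind sums by counting lattice points\<close>

lemma int_div_less_iff_less_mult:
  fixes a b c :: int assumes b: "b > 0"
  shows "a div b < c \<longleftrightarrow> a < c * b"
proof -
  have a: "a = (a div b) * b + a mod b" by simp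
  have m: "0 \<le> a mod b" "a mod b < b" using b by auto
  show ?thesis
  proof
    assume "a div b < c"
    then have "(a div b + 1) * b \<le> c * b" using b by (intro mult_right_mono) auto
    then show "a < c * b" using a m(2) unfolding distrib_right by linarith
  next
    assume less: "a < c * b"
    show "a div b < c"
    proof (rule ccontr)
      assume "\<not> a div b < c"
      then have "c * b \<le> (a div b) * b" using b by (intro mult_right_mono) auto
      then show False using a m(1) less by linarith
    qed
  qed
qed

text \<open>With q the floor of hr/k, q(q+1) is twice the sum of all v up to q. Interchanging r and
  v counts the same lattice points along the other axis; coprimality keeps lattice points off the
  line, so v <= hr/k becomes kv/h < r.\<close>

lemma sum_floor_swap:
  fixes h k :: int assumes h: "h > 0" and k: "k > 0" and hk: "coprime h k"
  shows "(\<Sum>r\<in>{0..<k}. ((h * r) div k) * ((h * r) div k + 1))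
       = 2 * (\<Sum>v\<in>{0..<h}. v * (k - 1 - (k * v) div h))"
proof -
  have "(\<Sum>r\<in>{0..<k}. ((h * r) div k) * ((h * r) div k + 1))
      = (\<Sum>r\<in>{0..<k}. \<Sum>v\<in>{1..<h}. if v \<le> (h * r) div k then 2 * v else 0)"
  proof (rule sum.cong[OF refl])
    fix r assume r: "r \<in> {0..<k}"
    let ?q = "(h * r) div k"
    have q0: "?q \<ge> 0" using r h k by (simp add: pos_imp_zdiv_nonneg_iff)
    have "h * r < h * k" using r h by simp
    then have qh: "?q < h" using int_div_less_iff_less_mult[OF k] by blast
    have "(\<Sum>v\<in>{1..<h}. if v \<le> ?q then 2 * v else 0) = (\<Sum>v\<in>{v\<in>{1..<h}. v \<le> ?q}. 2 * v)"
      by (rule sum.inter_filter[symmetric]) simp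
    also have "{v\<in>{1..<h}. v \<le> ?q} = {0..<?q + 1} - {0}" using qh by auto
    also have "(\<Sum>v\<in>{0..<?q + 1} - {0}. 2 * v) = (\<Sum>v\<in>{0..<?q + 1}. 2 * v)"
      by (rule sum.mono_neutral_left) auto
    also have "\<dots> = 2 * (\<Sum>v\<in>{0..<?q + 1}. v)" by (simp add: sum_distrib_left)
    also have "\<dots> = (?q + 1) * (?q + 1 - 1)" by (rule sum_int_lessThan[THEN conjunct1]) (use q0 in simp)
    finally show "?q * (?q + 1) = (\<Sum>v\<in>{1..<h}. if v \<le> ?q then 2 * v else 0)" by simp
  qed
  also have "\<dots> = (\<Sum>v\<in>{1..<h}. \<Sum>r\<in>{0..<k}. if v \<le> (h * r) div k then 2 * v else 0)"
    by (rule sum.swap)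
  also have "\<dots> = (\<Sum>v\<in>{1..<h}. 2 * v * (k - 1 - (k * v) div h))"
  proof (rule sum.cong[OF refl])
    fix v assume v: "v \<in> {1..<h}"
    have kv0: "(k * v) div h \<ge> 0" using v h k by (simp add: pos_imp_zdiv_nonneg_iff)
    have "k * v < k * h" using v k by simp
    then have kvk: "(k * v) div h < k" using int_div_less_iff_less_mult[OF h] by blast
    have iff: "v \<le> (h * r) div k \<longleftrightarrow> (k * v) div h < r" for r
    proof -
      have "k * v \<noteq> h * r"
      proof
        assume "k * v = h * r"
        then have "h dvd k * v" by simp
        then have "h dvd v" using hk by (simp add: coprime_dvd_mult_right_iff)
        then show False using v zdvd_not_zless by auto
      qed
      moreover have "v \<le> (h * r) div k \<longleftrightarrow> v * k \<le> h * r" using int_div_less_iff_less_mult[OF k, of "h * r" v] by linarith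
      moreover have "(k * v) div h < r \<longleftrightarrow> k * v < r * h" using h by (rule int_div_less_iff_less_mult)
      ultimately show ?thesis by (auto simp: mult.commute)
    qed
    have "(\<Sum>r\<in>{0..<k}. if v \<le> (h * r) div k then 2 * v else 0) = (\<Sum>r\<in>{r\<in>{0..<k}. v \<le> (h * r) div k}. 2 * v)"
      by (rule sum.inter_filter[symmetric]) simp
    also have "{r\<in>{0..<k}. v \<le> (h * r) div k} = {(k * v) div h + 1..<k}"
      using kv0 by (auto simp: iff)
    finally show "(\<Sum>r\<in>{0..<k}. if v \<le> (h * r) div k then 2 * v else 0) = 2 * v * (k - 1 - (k * v) div h)"
      using kvk by simp
  qed
  also have "\<dots> = (\<Sum>v\<in>{0..<h}. 2 * v * (k - 1 - (k * v) div h))"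
    by (rule sum.mono_neutral_left) auto
  finally show ?thesis by (simp add: sum_distrib_left mult.assoc)
qed

text \<open>The squares of the residues hr mod k have the same sum as the squares of r. Expanding
  each residue as hr - k * floor expresses \<open>S\<close> by the sum of the squared floors, which
  \<open>sum_floor_swap\<close> converts into the weighted floors of the pair (k, h), that is, into
  \<open>S'\<close>.\<close>

lemma dedekind_reciprocity_int:
  fixes h k :: int assumes h: "h > 0" and k: "k > 0" and hk: "coprime h k"
  defines "S \<equiv> (\<Sum>r\<in>{0..<k}. r * ((h * r) mod k))" and "S' \<equiv> (\<Sum>v\<in>{0..<h}. v * ((k * v) mod h))"
  shows "12 * (h^2 * S + k^2 * S') = h * k * (h^2 + k^2 + 1 - 3 * h * k) + 3 * h^2 * k^2 * (h + k - 2)"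
proof -
  define Q where "Q = (\<Sum>r\<in>{0..<k}. r * ((h * r) div k))"
  define Q2 where "Q2 = (\<Sum>r\<in>{0..<k}. ((h * r) div k)^2)"
  define Q1 where "Q1 = (\<Sum>r\<in>{0..<k}. (h * r) div k)"
  define Q' where "Q' = (\<Sum>v\<in>{0..<h}. v * ((k * v) div h))"
  define R1 where "R1 = (\<Sum>r\<in>{0..<k}. r)"
  define R2 where "R2 = (\<Sum>r\<in>{0..<k}. r^2)"
  define V1 where "V1 = (\<Sum>r\<in>{0..<h}. r)"
  define V2 where "V2 = (\<Sum>r\<in>{0..<h}. r^2)"
  have md: "(h * r) mod k = h * r - k * ((h * r) div k)" for r by (simp add: minus_mult_div_eq_mod)
  have md': "(k * r) mod h = k * r - h * ((k * r) div h)" for r by (simp add: minus_mult_div_eq_mod)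
  have R: "2 * R1 = k * (k - 1)" "6 * R2 = (k - 1) * k * (2 * k - 1)"
    unfolding R1_def R2_def using sum_int_lessThan[of k] k by auto
  have V: "2 * V1 = h * (h - 1)" "6 * V2 = (h - 1) * h * (2 * h - 1)"
    unfolding V1_def V2_def using sum_int_lessThan[of h] h by auto
  have bij: "bij_betw (\<lambda>r. (h * r) mod k) {0..<k} {0..<k}" by (rule bij_betw_mult_mod[OF k hk])
  have "(\<Sum>r\<in>{0..<k}. (h * r) mod k) = R1"
    unfolding R1_def using sum.reindex_bij_betw[OF bij, of "\<lambda>x. x"] by simp
  then have e1: "h * R1 - k * Q1 = R1"
    unfolding R1_def Q1_def md by (simp add: sum_subtractf sum_distrib_left)
  have "(\<Sum>r\<in>{0..<k}. ((h * r) mod k)^2) = R2"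
    unfolding R2_def using sum.reindex_bij_betw[OF bij, of "\<lambda>x. x^2"] by simp
  moreover have "(\<Sum>r\<in>{0..<k}. ((h * r) mod k)^2) = h^2 * R2 - 2 * h * k * Q + k^2 * Q2"
  proof -
    have "((h * r) mod k)^2 = h^2 * r^2 - 2 * h * k * (r * ((h * r) div k)) + k^2 * ((h * r) div k)^2" for r
      unfolding md by (simp add: power2_eq_square algebra_simps)
    then show ?thesis unfolding R2_def Q_def Q2_def
      by (simp add: sum.distrib sum_subtractf sum_distrib_left)
  qed
  ultimately have e2: "h^2 * R2 - 2 * h * k * Q + k^2 * Q2 = R2" by simp
  have e3: "S = h * R2 - k * Q"
    unfolding S_def R2_def Q_def md by (simp add: right_diff_distrib sum_subtractf sum_distrib_left power2_eq_square mult_ac)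
  have e3': "S' = k * V2 - h * Q'"
    unfolding S'_def V2_def Q'_def md' by (simp add: right_diff_distrib sum_subtractf sum_distrib_left power2_eq_square mult_ac)
  have "Q2 + Q1 = (\<Sum>r\<in>{0..<k}. ((h * r) div k) * ((h * r) div k + 1))"
    unfolding Q2_def Q1_def by (simp add: sum.distrib[symmetric] power2_eq_square algebra_simps)
  also have "\<dots> = 2 * (\<Sum>v\<in>{0..<h}. v * (k - 1 - (k * v) div h))"
    by (rule sum_floor_swap[OF h k hk])
  also have "(\<Sum>v\<in>{0..<h}. v * (k - 1 - (k * v) div h)) = (k - 1) * V1 - Q'"
    unfolding V1_def Q'_def by (simp add: right_diff_distrib left_diff_distrib sum_subtractf sum_distrib_left mult_ac)
  finally have e4: "Q2 + Q1 = 2 * ((k - 1) * V1 - Q')" .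
  have Q1: "2 * Q1 = (h - 1) * (k - 1)"
  proof -
    have "k * (2 * Q1) = (h - 1) * (2 * R1)" using e1 by (simp add: algebra_simps)
    also have "\<dots> = k * ((h - 1) * (k - 1))" unfolding R(1) by (simp add: algebra_simps)
    finally show ?thesis using k by simp
  qed
  have "2 * h * S = h^2 * R2 + (h^2 * R2 - 2 * h * k * Q + k^2 * Q2) - k^2 * Q2"
    unfolding e3 by (simp add: power2_eq_square algebra_simps)
  then have "2 * h * S = (h^2 + 1) * R2 - k^2 * Q2"
    unfolding e2 by (simp add: algebra_simps)
  moreover have "Q2 = 2 * (k - 1) * V1 - 2 * Q' - Q1" using e4 by (simp add: algebra_simps)
  ultimately have a1: "2 * h * S = (h^2 + 1) * R2 - k^2 * (2 * (k - 1) * V1 - 2 * Q' - Q1)" by simp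
  have hQ': "h * Q' = k * V2 - S'" using e3' by simp
  have "12 * (h^2 * S) = 6 * h * (2 * h * S)" by (simp add: power2_eq_square)
  also have "\<dots> = h * (h^2 + 1) * (6 * R2) - k^2 * (6 * h * (k - 1) * (2 * V1) - 12 * (h * Q') - 3 * h * (2 * Q1))"
    unfolding a1 by (simp add: algebra_simps)
  also have "\<dots> = h * (h^2 + 1) * ((k - 1) * k * (2 * k - 1)) - k^2 * (6 * h * (k - 1) * (h * (h - 1)) - 2 * k * (6 * V2) + 12 * S' - 3 * h * ((h - 1) * (k - 1)))"
    unfolding R(2) V(1) hQ' Q1 by (simp add: algebra_simps)
  finally show ?thesis unfolding V(2) by (simp add: algebra_simps power2_eq_square)
qed

lemma dedekind_reciprocity:
  fixes h k :: int assumes h: "h > 0" and k: "k > 0" and hk: "coprime h k"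
  shows "12 * (dedekind_sum h k + dedekind_sum k h)
    = of_int h / of_int k + of_int k / of_int h + 1 / (of_int h * of_int k) - 3"
proof -
  define S where "S = (\<Sum>r\<in>{0..<k}. r * ((h * r) mod k))"
  define S' where "S' = (\<Sum>v\<in>{0..<h}. v * ((k * v) mod h))"
  define H K where "H = real_of_int h" and "K = real_of_int k"
  have HK: "H > 0" "K > 0" using h k by (auto simp: H_def K_def)
  have kh: "coprime k h" using hk by (simp add: coprime_commute)
  have "of_int (12 * (h^2 * S + k^2 * S')) = (of_int (h * k * (h^2 + k^2 + 1 - 3 * h * k) + 3 * h^2 * k^2 * (h + k - 2)) :: real)"
    unfolding S_def S'_def using dedekind_reciprocity_int[OF h k hk] by (simp only:)
  then have *: "12 * (H^2 * of_int S + K^2 * of_int S') = H * K * (H^2 + K^2 + 1 - 3 * H * K) + 3 * H^2 * K^2 * (H + K - 2)"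
    by (simp add: H_def K_def)
  have "12 * (dedekind_sum h k + dedekind_sum k h) = 12 * (H^2 * of_int S + K^2 * of_int S') / (H^2 * K^2) - 3 * (H + K - 2)"
    unfolding dedekind_sum_eq[OF k hk] dedekind_sum_eq[OF h kh] S_def[symmetric] S'_def[symmetric]
      H_def[symmetric] K_def[symmetric]
    using HK by (simp add: field_simps)
  also have "\<dots> = H / K + K / H + 1 / (H * K) - 3"
    unfolding * using HK by (simp add: field_simps power2_eq_square)
  finally show ?thesis by (simp add: H_def K_def)
qed

section \<open>Behaviour of \<Psi> under translation, reflection and inversion\<close>

lemma dedekind_sum_shift: "c > 0 \<Longrightarrow> dedekind_sum (h + j * c) c = dedekind_sum h c"
proof -
  assume c: "c > 0"
  have "sawtooth (of_int ((h + j * c) * r) / of_int c) = sawtooth (of_int (h * r) / of_int c)" for r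
  proof -
    have "of_int ((h + j * c) * r) / of_int c = (of_int (h * r) / of_int c + of_int (j * r) :: real)"
      using c by (simp add: field_simps)
    moreover have "sawtooth (x + of_int i) = sawtooth x" for x and i :: int
      by (simp add: sawtooth_def)
    ultimately show ?thesis by metis
  qed
  then show ?thesis by (simp add: dedekind_sum_def)
qed

lemma sawtooth_minus: "sawtooth (- x) = - sawtooth x"
proof (cases "x \<in> \<int>")
  case False
  then have "x \<noteq> of_int \<lfloor>x\<rfloor>" by (metis Ints_of_int)
  then have "\<lfloor>- x\<rfloor> = - \<lfloor>x\<rfloor> - 1" by linarith
  then show ?thesis using False by (simp add: sawtooth_def)
qed (simp add: sawtooth_def)

lemma dedekind_sum_minus: "dedekind_sum (- h) c = - dedekind_sum h c"
  by (simp add: dedekind_sum_def sawtooth_minus sum_negf)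

text \<open>Quotient, Dedekind sum and constant all change sign. For c > 0 the value depends on a,
  c, d only, which leaves the upper right entries on both sides unrelated; \<open>Psi_shift\<close>
  has the same freedom.\<close>

lemma Psi_neg_c: "c > 0 \<Longrightarrow> Psi (a, b, - c, d) = - Psi (a, b', c, d)"
  by (simp add: Psi_def dedekind_sum_minus)

lemma Psi_shift: "c > 0 \<Longrightarrow> Psi (a, b', c, d + j * c) = Psi (a, b, c, d) + of_int j"
  using dedekind_sum_shift[of c "- d" "- j"] by (simp add: Psi_def field_simps)

lemma Psi_reflect: "c > 0 \<Longrightarrow> Psi (- a, b, c, - d) = - Psi (a, b, c, d) - 6"
  by (simp add: Psi_def dedekind_sum_minus field_simps)

lemma Psi_invert:
  assumes "c > 0" "d > 0" "a * d - b * c = 1"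
  shows "Psi (a, b, c, d) = Psi (b, - a, d, - c) + 3"
proof -
  have "coprime d c"
    by (rule coprimeI) (use assms(3) in \<open>metis dvd_diff dvd_mult\<close>)
  then have rec: "12 * (dedekind_sum d c + dedekind_sum c d)
    = of_int d / of_int c + of_int c / of_int d + 1 / (of_int d * of_int c) - 3"
    using dedekind_reciprocity assms by blast
  define A B C D where "A = real_of_int a" and "B = real_of_int b" and "C = real_of_int c" and "D = real_of_int d"
  have CD: "C > 0" "D > 0" using assms by (auto simp: C_def D_def)
  have det: "A * D - B * C = 1" unfolding A_def B_def C_def D_def using assms(3)
    by (metis of_int_1 of_int_diff of_int_mult)
  \<comment> \<open>With the determinant equal to 1, the quotients of the two matrices differ
    exactly by the elementary terms of the reciprocity law.\<close>
  have "(A + D) / C - (B - C) / D = D / C + C / D + (A * D - B * C) / (D * C)"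
    using CD by (simp add: field_simps)
  then have "(A + D) / C - (B - C) / D = D / C + C / D + 1 / (D * C)" using det by simp
  then show ?thesis
    using rec assms(1,2) by (simp add: Psi_def dedekind_sum_minus A_def B_def C_def D_def)
qed

subsection \<open>The function \<open>\<Psi>\<close> modulo 24\<close>

lemma odd_nat_mod4: "odd (n::nat) \<Longrightarrow> (\<exists>i. n = 4 * i + 1) \<or> (\<exists>i. n = 4 * i + 3)" by presburger

lemma int_mod3: "(\<exists>i. c = 3 * i) \<or> (\<exists>i. c = 3 * i + 1) \<or> (\<exists>i. c = 3 * i - 1)" for c :: int by presburger

text \<open>Together with \<open>congE_int\<close> this trades a congruence for an explicit
  quotient. Most congruences below are proved by naming the quotient, which leaves a polynomial
  identity.\<close>

lemma congI_int: "x - y = m * t \<Longrightarrow> [x = y] (mod m)" for x y m t :: int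
  by (metis cong_iff_dvd_diff dvd_triv_left)

lemma congE_int:
  fixes x y m :: int assumes "[x = y] (mod m)"
  obtains t where "x = y + m * t"
  using assms by (metis cong_iff_dvd_diff dvdE diff_eq_eq add.commute)

lemma three_dvd_cube_minus_self: "3 dvd c * (c^2 - 1)" for c :: int
proof -
  have "c * (c^2 - 1) = (c - 1) * c * (c + 1)" by (simp add: algebra_simps power2_eq_square)
  then show ?thesis using int_mod3[of c] by auto
qed

lemma odd_square_cong_1: "odd c \<Longrightarrow> [c^2 = 1] (mod 8)" for c :: int
proof -
  assume "odd c"
  then obtain k where k: "c = 2 * k + 1" by (elim oddE)
  have "even (k * (k + 1))" by simp
  then obtain t where "k * (k + 1) = 2 * t" by blast
  then have "c^2 - 1 = 8 * t" unfolding k by (simp add: power2_eq_square algebra_simps)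
  then show ?thesis by (simp add: cong_iff_dvd_diff)
qed

lemma odd_squareE:
  fixes c :: int assumes "odd c" obtains t where "c^2 = 1 + 8 * t"
  using odd_square_cong_1[OF assms] by (rule congE_int)

lemma odd_nat_squareE:
  fixes n :: nat assumes "odd n" obtains t where "(int n)^2 = 1 + 8 * t"
  by (rule odd_squareE[of "int n"]) (use assms in auto)

text \<open>Signs \<open>s = \<plusminus>1\<close> enter congruences modulo 8 as \<open>2 - 2 s\<close>, which makes products additive.\<close>

lemma sign_cong_mult:
  fixes s t :: int assumes "s = 1 \<or> s = -1" "t = 1 \<or> t = -1"
  shows "[2 - 2 * (s * t) = (2 - 2 * s) + (2 - 2 * t)] (mod 8)"
  using assms by (auto simp: cong_def)

lemma sign_cong_mult4:
  fixes s1 s2 s3 s4 :: int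
  assumes "s1 = 1 \<or> s1 = -1" "s2 = 1 \<or> s2 = -1" "s3 = 1 \<or> s3 = -1" "s4 = 1 \<or> s4 = -1"
  shows "[2 - 2 * (s1 * (s2 * (s3 * s4))) = (2 - 2 * s1) + ((2 - 2 * s2) + ((2 - 2 * s3) + (2 - 2 * s4)))] (mod 8)"
  using assms by (elim disjE) (simp_all add: cong_def)

lemma sign_power: "s = 1 \<or> s = -1 \<Longrightarrow> s ^ n = 1 \<or> s ^ n = (-1 :: int)"
  by (metis minus_one_power_iff power_one)

lemma sign_cong_power:
  fixes s :: int assumes "s = 1 \<or> s = -1"
  shows "[2 - 2 * s ^ n = int n * (2 - 2 * s)] (mod 8)"
proof (induction n)
  case (Suc n)
  have "[2 - 2 * (s * s ^ n) = (2 - 2 * s) + (2 - 2 * s ^ n)] (mod 8)"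
    by (rule sign_cong_mult[OF assms sign_power[OF assms]])
  moreover have "[(2 - 2 * s) + (2 - 2 * s ^ n) = (2 - 2 * s) + int n * (2 - 2 * s)] (mod 8)"
    by (intro cong_add cong_refl Suc)
  ultimately show ?case using cong_trans by (fastforce simp: algebra_simps)
qed simp

lemma sign_cong_kronecker_minus_one:
  assumes "odd n" shows "[2 - 2 * kronecker (-1) (int n) = 2 * (int n - 1)] (mod 8)"
  using odd_nat_mod4[OF assms]
proof (elim disjE exE)
  fix i assume n: "n = 4 * i + 1"
  have "n mod 4 = 1" unfolding n by presburger
  then have "kronecker (-1) (int n) = 1" by (simp add: kronecker_minus_one[OF assms])
  then show ?thesis by (simp add: n cong_iff_dvd_diff)
next
  fix i assume n: "n = 4 * i + 3"
  have "n mod 4 \<noteq> 1" unfolding n by presburger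
  then have "kronecker (-1) (int n) = -1" by (simp add: kronecker_minus_one[OF assms])
  moreover have "4 - 2 * (int n - 1) = 8 * (- int i)" unfolding n by simp
  ultimately show ?thesis by (simp add: cong_iff_dvd_diff)
qed

text \<open>Both sides are 4 modulo 8 when m and n are 3 modulo 4, and 0 otherwise.\<close>

lemma sign_cong_rsign:
  assumes "odd m" "odd n" shows "[2 - 2 * rsign m n = (int m - 1) * (int n - 1)] (mod 8)"
proof -
  obtain i \<epsilon> where m: "m = 4 * i + \<epsilon>" "\<epsilon> = 1 \<or> \<epsilon> = 3" using odd_nat_mod4[OF assms(1)] by blast
  obtain j \<epsilon>' where n: "n = 4 * j + \<epsilon>'" "\<epsilon>' = 1 \<or> \<epsilon>' = 3" using odd_nat_mod4[OF assms(2)] by blast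
  have r: "rsign m n = (if \<epsilon> = 3 \<and> \<epsilon>' = 3 then -1 else 1)"
    using m n by (auto simp: rsign_def)
  have "(int m - 1) * (int n - 1) = 16 * (int i * int j) + 4 * int i * (int \<epsilon>' - 1) + 4 * int j * (int \<epsilon> - 1) + (int \<epsilon> - 1) * (int \<epsilon>' - 1)"
    unfolding m(1) n(1) by (simp add: algebra_simps)
  then have "2 - 2 * rsign m n - (int m - 1) * (int n - 1)
     = 8 * (- 2 * (int i * int j) - int i * (if \<epsilon>' = 3 then 1 else 0) - int j * (if \<epsilon> = 3 then 1 else 0))"
    unfolding r using m(2) n(2) by auto
  then show ?thesis by (simp add: cong_iff_dvd_diff)
qed

text \<open>For odd t this is 0 or 4 modulo 8, the latter exactly for t = 3, 5 modulo 8: the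
  additive form of the symbol of t at 2.\<close>

definition hsq :: "int \<Rightarrow> int" where "hsq t = (t^2 - 1) div 2"

lemma hsq_cong:
  assumes "odd t" shows "[hsq t = 2 - 2 * kron_prime t 2] (mod 8)"
proof -
  obtain i j where t: "t = 8 * i + j" "j \<in> {1, 3, 5, 7}"
    using odd_mod_8_cases[OF assms] by (metis insertCI mult_div_mod_eq)
  have "t mod 8 = j" using t by auto
  then have k: "kron_prime t 2 = (if j = 1 \<or> j = 7 then 1 else -1)"
    using assms by (simp add: kron_prime_def)
  have "t^2 - 1 = 2 * (8 * (4 * i^2 + i * j)) + (j^2 - 1)"
    unfolding t(1) by (simp add: algebra_simps power2_eq_square)
  then have "hsq t = 8 * (4 * i^2 + i * j) + (j^2 - 1) div 2"
    unfolding hsq_def by (simp only: div_mult_self4 zero_neq_numeral not_False_eq_True)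
  then have "[hsq t = (j^2 - 1) div 2] (mod 8)"
    by (simp add: cong_iff_dvd_diff)
  moreover have "[2 - 2 * kron_prime t 2 = (j^2 - 1) div 2] (mod 8)"
    unfolding k using t(2) by (auto simp: cong_def)
  ultimately show ?thesis using cong_trans cong_sym by blast
qed

lemma sign_cong_kronecker_two:
  assumes "odd n" shows "[2 - 2 * kronecker 2 (int n) = hsq (int n)] (mod 8)"
proof -
  have "int n mod 8 = int (n mod 8)" by (simp add: zmod_int)
  then have "kronecker 2 (int n) = kron_prime (int n) 2"
    using assms by (auto simp: kronecker_two[OF assms] kron_prime_def)
  then show ?thesis using hsq_cong[of "int n"] assms by (simp add: cong_sym)
qed

text \<open>For odd c this is the classical eta multiplier (d/c) e(((a+d)c - bd(c^2-1) - 3c)/24),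
  split along 24 = 3 * 8. The part modulo 8 is stated for odd c, where the denominator of the symbol
  is odd. The integer P records in addition that the real number \<Psi> is integral.\<close>

definition Psi_rep :: "int \<Rightarrow> int \<Rightarrow> int \<Rightarrow> int \<Rightarrow> int \<Rightarrow> bool" where
  "Psi_rep a b c d P \<longleftrightarrow> Psi (a, b, c, d) = of_int P \<and>
     [P = (a + d) * c - b * d * (c^2 - 1)] (mod 3) \<and>
     (odd c \<longrightarrow> [P = (a + d - 3) * c + 2 - 2 * kronecker d c] (mod 8))"

text \<open>Once ad is replaced by 1 + bc, the defect modulo 3 is a multiple of c (c^2 - 1); modulo
  8 it is j (c^2 - 1) with c odd.\<close>

lemma Psi_rep_shift:
  assumes "Psi_rep a b c d P" "c > 0" "a * d - b * c = 1"
  shows "Psi_rep a (b + j * a) c (d + j * c) (P + j)"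
  unfolding Psi_rep_def
proof (intro conjI impI)
  show "Psi (a, b + j * a, c, d + j * c) = of_int (P + j)"
    using Psi_shift[OF assms(2), of a "b + j * a" d j b] assms(1) by (simp add: Psi_rep_def)
  have ad: "a * d = 1 + b * c" using assms(3) by simp
  have "((a + d) * c - b * d * (c^2 - 1) + j) - ((a + (d + j * c)) * c - (b + j * a) * (d + j * c) * (c^2 - 1))
      = (c^2 - 1) * j * (a * d + b * c + j * a * c - 1)"
    by (simp add: algebra_simps power2_eq_square)
  also have "\<dots> = (c * (c^2 - 1)) * (j * (2 * b + j * a))"
    unfolding ad by (simp add: algebra_simps)
  finally have "[(a + d) * c - b * d * (c^2 - 1) + j = (a + (d + j * c)) * c - (b + j * a) * (d + j * c) * (c^2 - 1)] (mod 3)"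
    using three_dvd_cube_minus_self[of c] by (simp add: cong_iff_dvd_diff)
  moreover have "[P + j = (a + d) * c - b * d * (c^2 - 1) + j] (mod 3)"
    using assms(1) by (intro cong_add cong_refl) (simp add: Psi_rep_def)
  ultimately show "[P + j = (a + (d + j * c)) * c - (b + j * a) * (d + j * c) * (c^2 - 1)] (mod 3)"
    using cong_trans by blast
next
  assume c: "odd c"
  have k: "kronecker (d + j * c) c = kronecker d c"
    using kronecker_cong[of "nat c" "d + j * c" d] assms(2) c by (simp add: cong_iff_dvd_diff even_nat_iff)
  have "(a + (d + j * c) - 3) * c + 2 - 2 * kronecker d c - ((a + d - 3) * c + 2 - 2 * kronecker d c + j) = j * (c^2 - 1)"
    by (simp add: algebra_simps power2_eq_square)
  moreover have "8 dvd c^2 - 1" using odd_square_cong_1[OF c] by (simp add: cong_iff_dvd_diff)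
  ultimately have "[(a + (d + j * c) - 3) * c + 2 - 2 * kronecker d c = (a + d - 3) * c + 2 - 2 * kronecker d c + j] (mod 8)"
    by (simp add: cong_iff_dvd_diff)
  moreover have "[P + j = (a + d - 3) * c + 2 - 2 * kronecker d c + j] (mod 8)"
    using assms(1) c by (intro cong_add cong_refl) (simp add: Psi_rep_def)
  ultimately show "[P + j = (a + (d + j * c) - 3) * c + 2 - 2 * kronecker (d + j * c) c] (mod 8)"
    unfolding k using cong_trans cong_sym by blast
qed

text \<open>Allows a negative d to be exchanged for a positive one. Modulo 8 the symbol (-1/c)
  enters, and 6c - 10 + 2 (d/c) (1 + (-1/c)) is divisible by 8 in both residue classes of odd c
  modulo 4.\<close>

lemma Psi_rep_reflect:
  assumes "Psi_rep a b c d P" "c > 0" "a * d - b * c = 1"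
  shows "Psi_rep (- a) b c (- d) (- P - 6)"
  unfolding Psi_rep_def
proof (intro conjI impI)
  show "Psi (- a, b, c, - d) = of_int (- P - 6)"
    using Psi_reflect[OF assms(2)] assms(1) by (simp add: Psi_rep_def)
  have "3 dvd P - ((a + d) * c - b * d * (c^2 - 1))" using assms(1) by (simp add: Psi_rep_def cong_iff_dvd_diff)
  then obtain t where "P - ((a + d) * c - b * d * (c^2 - 1)) = 3 * t" by blast
  then have "- P - 6 - ((- a + - d) * c - b * (- d) * (c^2 - 1)) = 3 * (- t - 2)" by (simp add: algebra_simps)
  then show "[- P - 6 = (- a + - d) * c - b * (- d) * (c^2 - 1)] (mod 3)"
    by (rule congI_int)
next
  assume c: "odd c"
  define n where "n = nat c"
  have cn: "c = int n" "n > 0" "odd n" using assms(2) c by (auto simp: n_def even_nat_iff)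
  have "coprime d c" by (rule coprimeI) (use assms(3) in \<open>metis dvd_diff dvd_mult\<close>)
  then have s: "kronecker d c = 1 \<or> kronecker d c = -1" using kronecker_unit cn by simp
  have k: "kronecker (- d) c = kronecker (-1) c * kronecker d c"
    using kronecker_mult_left[OF cn(2), of "-1" d] cn by simp
  have "8 dvd P - ((a + d - 3) * c + 2 - 2 * kronecker d c)" using assms(1) c by (simp add: Psi_rep_def cong_iff_dvd_diff)
  then obtain t where "P - ((a + d - 3) * c + 2 - 2 * kronecker d c) = 8 * t" by blast
  then have "- P - 6 - ((- a + - d - 3) * c + 2 - 2 * kronecker (- d) c)
      = 6 * c - 10 + 2 * kronecker d c * (1 + kronecker (-1) c) - 8 * t"
    unfolding k by (simp add: algebra_simps)
  moreover have "8 dvd 6 * c - 10 + 2 * kronecker d c * (1 + kronecker (-1) c)"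
    using odd_nat_mod4[OF cn(3)]
  proof (elim disjE exE)
    fix i assume n: "n = 4 * i + 1"
    have "n mod 4 = 1" unfolding n by presburger
    then have k1: "kronecker (-1) c = 1" by (simp add: cn kronecker_minus_one[OF cn(3)])
    have c: "c = 4 * int i + 1" by (simp add: cn n)
    show ?thesis using s by (elim disjE; simp only: k1; simp only: c; presburger)
  next
    fix i assume n: "n = 4 * i + 3"
    have "n mod 4 \<noteq> 1" unfolding n by presburger
    then have k1: "kronecker (-1) c = -1" by (simp add: cn kronecker_minus_one[OF cn(3)])
    have c: "c = 4 * int i + 3" by (simp add: cn n)
    show ?thesis using s by (elim disjE; simp only: k1; simp only: c; presburger)
  qed
  then obtain w where "6 * c - 10 + 2 * kronecker d c * (1 + kronecker (-1) c) = 8 * w" by blast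
  ultimately have "- P - 6 - ((- a + - d - 3) * c + 2 - 2 * kronecker (- d) c) = 8 * w - 8 * t" by (simp only:)
  then have "- P - 6 - ((- a + - d - 3) * c + 2 - 2 * kronecker (- d) c) = 8 * (w - t)" by (simp only: right_diff_distrib[of 8 w t])
  then show "[- P - 6 = (- a + - d - 3) * c + 2 - 2 * kronecker (- d) c] (mod 8)"
    by (rule congI_int)
qed

text \<open>For odd c and d reciprocity turns (-c/d) into (d/c); the signs (-1/d) and
  \<open>rsign\<close> it leaves behind are polynomials in c and d modulo 8, and the rest is the
  determinant relation.\<close>

lemma Psi_rep_invert:
  assumes "Psi_rep b (- a) d (- c) P" "c > 0" "d > 0" "odd d" "a * d - b * c = 1"
  shows "Psi_rep a b c d (P + 3)"
  unfolding Psi_rep_def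
proof (intro conjI impI)
  show "Psi (a, b, c, d) = of_int (P + 3)"
    using Psi_invert[OF assms(2,3,5)] assms(1) by (simp add: Psi_rep_def)
  have ad: "a * d = 1 + b * c" using assms(5) by simp
  have "3 dvd P - ((b + - c) * d - (- a) * (- c) * (d^2 - 1))" using assms(1) by (simp add: Psi_rep_def cong_iff_dvd_diff)
  then obtain t where t: "P = ((b + - c) * d - (- a) * (- c) * (d^2 - 1)) + 3 * t" by (metis add_diff_cancel_left' dvdE diff_add_cancel add.commute)
  have "P + 3 - ((a + d) * c - b * d * (c^2 - 1)) = 3 * t + 3 - 2 * c * d - c * d * (a * d - b * c)"
    unfolding t by (simp add: algebra_simps power2_eq_square)
  also have "\<dots> = 3 * (t + 1 - c * d)" unfolding assms(5) by simp
  finally show "[P + 3 = (a + d) * c - b * d * (c^2 - 1)] (mod 3)"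
    by (rule congI_int)
next
  assume c: "odd c"
  define n m where "n = nat c" and "m = nat d"
  have cn: "c = int n" "n > 0" "odd n" using assms(2) c by (auto simp: n_def even_nat_iff)
  have dm: "d = int m" "m > 0" "odd m" using assms(3,4) by (auto simp: m_def even_nat_iff)
  have "coprime d c" by (rule coprimeI) (use assms(5) in \<open>metis dvd_diff dvd_mult\<close>)
  then have co: "coprime m n" by (simp add: cn dm)
  have k1: "kronecker (- c) d = kronecker (-1) d * kronecker c d"
    using kronecker_mult_left[OF dm(2), of "-1" c] dm by simp
  have k2: "kronecker d c = rsign m n * kronecker c d"
    unfolding cn dm by (rule kronecker_reciprocity[OF dm(3) cn(3) co])
  have s: "kronecker c d = 1 \<or> kronecker c d = -1"
    unfolding cn dm by (rule kronecker_unit[OF dm(2)]) (use co in \<open>simp add: coprime_commute\<close>)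
  have u: "kronecker (-1) d = 1 \<or> kronecker (-1) d = -1" "rsign m n = 1 \<or> rsign m n = -1"
    unfolding dm kronecker_minus_one[OF dm(3)] rsign_def by auto
  have "[2 - 2 * kronecker d c = (2 - 2 * rsign m n) + (2 - 2 * kronecker c d)] (mod 8)"
    unfolding k2 by (rule sign_cong_mult[OF u(2) s])
  moreover have "[2 - 2 * rsign m n = (d - 1) * (c - 1)] (mod 8)"
    unfolding cn dm by (rule sign_cong_rsign[OF dm(3) cn(3)])
  ultimately have A: "[2 - 2 * kronecker d c = (d - 1) * (c - 1) + (2 - 2 * kronecker c d)] (mod 8)"
    by (rule cong_trans[OF _ cong_add[OF _ cong_refl]])
  have "[2 - 2 * kronecker (- c) d = (2 - 2 * kronecker (-1) d) + (2 - 2 * kronecker c d)] (mod 8)"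
    unfolding k1 by (rule sign_cong_mult[OF u(1) s])
  moreover have "[2 - 2 * kronecker (-1) d = 2 * (d - 1)] (mod 8)"
    unfolding dm by (rule sign_cong_kronecker_minus_one[OF dm(3)])
  ultimately have B: "[2 - 2 * kronecker (- c) d = 2 * (d - 1) + (2 - 2 * kronecker c d)] (mod 8)"
    by (rule cong_trans[OF _ cong_add[OF _ cong_refl]])
  have C: "[P = (b + - c - 3) * d + 2 - 2 * kronecker (- c) d] (mod 8)"
    using assms(1,4) by (simp add: Psi_rep_def)
  obtain tA where tA: "2 - 2 * kronecker d c = (d - 1) * (c - 1) + (2 - 2 * kronecker c d) + 8 * tA"
    using A by (rule congE_int)
  obtain tB where tB: "2 - 2 * kronecker (- c) d = 2 * (d - 1) + (2 - 2 * kronecker c d) + 8 * tB"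
    using B by (rule congE_int)
  obtain tC where tC: "P = (b + - c - 3) * d + 2 - 2 * kronecker (- c) d + 8 * tC"
    using C by (rule congE_int)
  note t = tA tB tC
  obtain tc where tc: "c^2 = 1 + 8 * tc" using c by (rule odd_squareE)
  obtain td where td: "d^2 = 1 + 8 * td" using assms(4) by (rule odd_squareE)
  note tcd = tc td
  obtain c1 d1 where cd1: "c = 2 * c1 + 1" "d = 2 * d1 + 1" using c assms(4) by (meson oddE)
  have ad: "a * d = 1 + b * c" using assms(5) by simp
  \<comment> \<open>Quotient by 8 that appears when ad = 1 + bc is multiplied by cd and the squares
    of c and d are reduced; it makes ac congruent to cd + bd.\<close>
  define Z where "Z = tc * b * d - td * a * c"
  have "a * c * d^2 = (a * d) * (c * d)" by (simp add: power2_eq_square)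
  also have "\<dots> = d * c + b * d * c^2" unfolding ad by (simp add: power2_eq_square algebra_simps)
  finally have ac: "a * c = d * c + b * d + 8 * Z" unfolding tcd Z_def by (simp add: algebra_simps)
  have "P + 3 - ((a + d - 3) * c + 2 - 2 * kronecker d c) =
     (b - c - 3) * d + 2 * (d - 1) + 3 - a * c - (d - 3) * c - (d - 1) * (c - 1) + 8 * (tB + tC - tA)"
    using t by (simp add: algebra_simps)
  also have "\<dots> = 4 * c * (1 - d) + 8 * (tB + tC - tA - Z)"
    unfolding ac by (simp add: algebra_simps)
  also have "\<dots> = 8 * (tB + tC - tA - Z - c * d1)"
    unfolding cd1(2) by (simp add: algebra_simps)
  finally show "[P + 3 = (a + d - 3) * c + 2 - 2 * kronecker d c] (mod 8)"
    by (rule congI_int)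
qed

text \<open>The Euclidean steps keep the next lower left entry odd, so that only Jacobi symbols with
  odd denominators occur.\<close>

lemma Psi_rep_exists:
  assumes "c > 0" "a * d - b * c = 1"
  shows "\<exists>P. Psi_rep a b c d P"
  using assms
proof (induction "nat c" arbitrary: a b c d rule: less_induct)
  case less
  show ?case
  proof (cases "c = 1")
    case True
    have "{0..<1::int} = {0}" by auto
    then have "Psi_rep a b c d (a + d - 3)"
      unfolding Psi_rep_def True by (simp add: Psi_def dedekind_sum_def sawtooth_def cong_iff_dvd_diff)
    then show ?thesis by blast
  next
    case False
    have c1: "c > 1" using False less.prems by linarith
    have no_common: "\<not> (x dvd c \<and> x dvd d \<and> x > 1)" for x
    proof
      assume x: "x dvd c \<and> x dvd d \<and> x > 1"
      then have "x dvd a * d - b * c" by simp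
      then show False using less.prems(2) x by simp
    qed
    define d0 where "d0 = d mod c"
    have d0: "d0 \<ge> 0" "d0 < c" using c1 by (auto simp: d0_def)
    have dd0: "d = d0 + (d div c) * c" by (simp add: d0_def)
    have "\<exists>j d'. d = d' + j * c \<and> odd d' \<and> \<bar>d'\<bar> < c"
    proof (cases "odd d0")
      case True
      then show ?thesis using d0 dd0 by (intro exI[of _ "d div c"] exI[of _ d0]) auto
    next
      \<comment> \<open>Here c must be odd, since c and d have no common factor; hence subtracting c
        from the even remainder gives an odd one of absolute value below c.\<close>
      case ev: False
      have "d0 \<noteq> 0" using no_common[of c] c1 by (simp add: d0_def mod_eq_0_iff_dvd)
      moreover have "odd c"
      proof
        assume "even c"
        then have "even d" using ev dd0 by (metis dvd_add dvd_mult)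
        then show False using no_common[of 2] \<open>even c\<close> by simp
      qed
      ultimately show ?thesis using d0 dd0 ev
        by (intro exI[of _ "d div c + 1"] exI[of _ "d0 - c"]) (auto simp: algebra_simps)
    qed
    then obtain j d' where d': "d = d' + j * c" "odd d'" "\<bar>d'\<bar> < c" by blast
    define b' where "b' = b - j * a"
    have det: "a * d' - b' * c = 1" using less.prems(2) unfolding d'(1) b'_def by (simp add: algebra_simps)
    have "\<exists>P. Psi_rep a b' c d' P"
    proof (cases "d' > 0")
      case True
      have "\<exists>P. Psi_rep b' (- a) d' (- c) P"
        by (rule less.hyps) (use True d' det less.prems in auto)
      then obtain P where "Psi_rep b' (- a) d' (- c) P" ..
      then have "Psi_rep a b' c d' (P + 3)"
        by (rule Psi_rep_invert) (use True d' det less.prems in auto)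
      then show ?thesis by blast
    next
      \<comment> \<open>A negative remainder is reflected, inverted as a positive one, and reflected
        back.\<close>
      case neg: False
      have d0': "d' < 0" using neg d'(2) by (cases "d' = 0") auto
      have "\<exists>P. Psi_rep b' (- (- a)) (- d') (- c) P"
        by (rule less.hyps) (use d0' d' det less.prems in auto)
      then obtain P where "Psi_rep b' (- (- a)) (- d') (- c) P" ..
      then have "Psi_rep (- a) b' c (- d') (P + 3)"
        by (rule Psi_rep_invert) (use d0' d' det less.prems in auto)
      then have "Psi_rep (- (- a)) b' c (- (- d')) (- (P + 3) - 6)"
        by (rule Psi_rep_reflect) (use det less.prems in auto)
      then show ?thesis by auto
    qed
    then obtain P where "Psi_rep a b' c d' P" ..
    then have "Psi_rep a (b' + j * a) c (d' + j * c) (P + j)"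
      by (rule Psi_rep_shift) (use less.prems det in auto)
    then show ?thesis using d'(1) by (auto simp: b'_def)
  qed
qed

text \<open>Inversion makes the odd number d the lower left entry. There (-c/d) splits into (-1/d),
  a power of (2/d) and (c'/d); the power of (2/d) becomes the term in \<open>hsq d\<close>, and
  (c'/d) is flipped to (d/c').\<close>

lemma Psi_even_pos:
  assumes "c > 0" "d > 0" "a * d - b * c = 1" "c = 2 ^ \<alpha> * int c'" "odd c'" "even c"
  shows "\<exists>P. Psi (a, b, c, d) = of_int P \<and>
    [P = 1 - d + b * d - c * d + int \<alpha> * hsq d + (int c' - 1) * (d - 1) + (2 - 2 * kronecker d (int c'))] (mod 8)"
    (is "\<exists>P. _ \<and> [P = ?R] (mod 8)")
proof -
  have od: "odd d" using assms(3,6) by (metis dvd_diff dvd_mult odd_one)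
  define m where "m = nat d"
  have dm: "d = int m" "m > 0" "odd m" using assms(2) od by (auto simp: m_def even_nat_iff)
  obtain P where P: "Psi_rep b (- a) d (- c) P"
    using Psi_rep_exists[of d b "- c" "- a"] assms(2,3) by (auto simp: algebra_simps)
  have "coprime d c" by (rule coprimeI) (use assms(3) in \<open>metis dvd_diff dvd_mult\<close>)
  then have "coprime d (int c')" unfolding assms(4) by simp
  then have co: "coprime m c'" by (simp add: dm)
  let ?s1 = "kronecker (-1) d" and ?s2 = "kronecker 2 d ^ \<alpha>" and ?s3 = "rsign m c'" and ?s4 = "kronecker d (int c')"
  have c'0: "c' > 0" using assms(5) by (auto intro: Nat.gr0I)
  have kp: "kronecker (2 ^ \<alpha>) d = ?s2"
  proof (induction \<alpha>)
    case (Suc i) then show ?case using kronecker_mult_left[OF dm(2), of 2 "2 ^ i"] dm by simp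
  qed (use dm in simp)
  have "kronecker (- c) d = ?s1 * (?s2 * kronecker (int c') d)"
    using kronecker_mult_left[OF dm(2), of "-1" c] kronecker_mult_left[OF dm(2), of "2 ^ \<alpha>" "int c'"] dm kp assms(4) by simp
  moreover have "kronecker (int c') d = ?s3 * ?s4"
  proof -
    have "rsign m c' = rsign c' m" by (auto simp: rsign_def)
    then show ?thesis
      using kronecker_reciprocity[OF assms(5) dm(3)] co by (simp add: dm coprime_commute)
  qed
  ultimately have k: "kronecker (- c) d = ?s1 * (?s2 * (?s3 * ?s4))" by simp
  have u1: "?s1 = 1 \<or> ?s1 = -1" unfolding dm kronecker_minus_one[OF dm(3)] by auto
  have "kronecker 2 d = 1 \<or> kronecker 2 d = -1" unfolding dm kronecker_two[OF dm(3)] by auto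
  note u2 = sign_power[OF this, of \<alpha>] and p2 = sign_cong_power[OF this, of \<alpha>]
  have u3: "?s3 = 1 \<or> ?s3 = -1" by (auto simp: rsign_def)
  have u4: "?s4 = 1 \<or> ?s4 = -1" using kronecker_unit[OF c'0] co by (simp add: dm)
  have "[2 - 2 * kronecker (- c) d = (2 - 2 * ?s1) + ((2 - 2 * ?s2) + ((2 - 2 * ?s3) + (2 - 2 * ?s4)))] (mod 8)"
    unfolding k by (rule sign_cong_mult4[OF u1 u2 u3 u4])
  moreover have "[2 - 2 * ?s1 = 2 * (d - 1)] (mod 8)"
    unfolding dm by (rule sign_cong_kronecker_minus_one[OF dm(3)])
  moreover have "[2 - 2 * ?s2 = int \<alpha> * hsq d] (mod 8)"
    using p2 sign_cong_kronecker_two[OF dm(3)] unfolding dm by (meson cong_mult cong_refl cong_trans)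
  moreover have "[2 - 2 * ?s3 = (d - 1) * (int c' - 1)] (mod 8)"
    unfolding dm by (rule sign_cong_rsign[OF dm(3) assms(5)])
  ultimately have "[2 - 2 * kronecker (- c) d = 2 * (d - 1) + (int \<alpha> * hsq d + ((d - 1) * (int c' - 1) + (2 - 2 * ?s4)))] (mod 8)"
    by (meson cong_trans cong_add cong_refl)
  then obtain t where t: "2 - 2 * kronecker (- c) d = 2 * (d - 1) + (int \<alpha> * hsq d + ((d - 1) * (int c' - 1) + (2 - 2 * ?s4))) + 8 * t"
    by (rule congE_int)
  have "[P = (b + - c - 3) * d + 2 - 2 * kronecker (- c) d] (mod 8)"
    using P od by (simp add: Psi_rep_def)
  then obtain t' where t': "P = (b + - c - 3) * d + 2 - 2 * kronecker (- c) d + 8 * t'" by (rule congE_int)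
  have "P + 3 - (?R) = 8 * (t + t')"
    using t t' by (simp add: algebra_simps)
  then have "[P + 3 = ?R] (mod 8)"
    by (rule congI_int)
  moreover have "Psi (a, b, c, d) = of_int (P + 3)"
    using Psi_invert[OF assms(1,2,3)] P by (simp add: Psi_rep_def)
  ultimately show ?thesis by blast
qed

text \<open>Translating by 8 |d| makes d positive; a translation by a multiple of 8 changes neither
  \<Psi> nor the formula modulo 8.\<close>

lemma Psi_even:
  assumes "c > 0" "a * d - b * c = 1" "c = 2 ^ \<alpha> * int c'" "odd c'" "even c" "Psi (a, b, c, d) = of_int P"
  shows "[P = 1 - d + b * d - c * d + int \<alpha> * hsq d + (int c' - 1) * (d - 1) + (2 - 2 * kronecker d (int c'))] (mod 8)"
    (is "[P = ?R] (mod 8)")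
proof -
  have od: "odd d" using assms(2,5) by (metis dvd_diff dvd_mult odd_one)
  define t where "t = \<bar>d\<bar>"
  define d' b' where "d' = d + (8 * t) * c" and "b' = b + (8 * t) * a"
  have "d \<noteq> 0" using od by auto
  then have "t \<ge> 1" by (simp add: t_def)
  have "t * 1 \<le> t * c" using \<open>t \<ge> 1\<close> assms(1) by (intro mult_left_mono) auto
  then have d'0: "d' > 0" using \<open>t \<ge> 1\<close> unfolding d'_def t_def by linarith
  have det: "a * d' - b' * c = 1" using assms(2) by (simp add: d'_def b'_def algebra_simps)
  obtain P' where P': "Psi (a, b', c, d') = of_int P'"
     "[P' = 1 - d' + b' * d' - c * d' + int \<alpha> * hsq d' + (int c' - 1) * (d' - 1) + (2 - 2 * kronecker d' (int c'))] (mod 8)"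
    using Psi_even_pos[OF assms(1) d'0 det assms(3,4,5)] by blast
  have "of_int P' = (of_int (P + 8 * t) :: real)"
    using P'(1) assms(6) Psi_shift[OF assms(1), of a b' d "8 * t" b] by (simp add: d'_def)
  then have PP: "P' = P + 8 * t" by (simp only: of_int_eq_iff)
  have "c' > 0" using assms(4) by (auto intro: Nat.gr0I)
  then have k: "kronecker d' (int c') = kronecker d (int c')"
    by (intro kronecker_cong assms(4)) (auto simp: cong_iff_dvd_diff d'_def assms(3))
  have "d'^2 - 1 = 2 * (8 * (t * c * d + 4 * (t * c)^2)) + (d^2 - 1)"
    by (simp add: d'_def power2_eq_square algebra_simps)
  then have sq: "hsq d' = 8 * (t * c * d + 4 * (t * c)^2) + hsq d"
    unfolding hsq_def by (simp only: div_mult_self4 zero_neq_numeral not_False_eq_True)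
  obtain u where u: "P' = 1 - d' + b' * d' - c * d' + int \<alpha> * hsq d' + (int c' - 1) * (d' - 1) + (2 - 2 * kronecker d' (int c')) + 8 * u"
    using P'(2) by (rule congE_int)
  have "P - (?R)
     = 8 * (u - t - t * c + b * t * c + t * a * d + 8 * t * a * t * c - c * t * c + int \<alpha> * (t * c * d + 4 * (t * c)^2) + (int c' - 1) * (t * c))"
    using u unfolding PP k sq unfolding d'_def b'_def by (simp add: algebra_simps)
  then show ?thesis by (rule congI_int)
qed

section \<open>Odd parts, and the contribution of one divisor\<close>

definition odp :: "nat \<Rightarrow> nat" where "odp m = m div 2 ^ multiplicity 2 m"

lemma odp:
  assumes "m > 0" shows "m = 2 ^ multiplicity 2 m * odp m" "odd (odp m)" "odp m > 0"
proof -
  show 1: "m = 2 ^ multiplicity 2 m * odp m"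
    unfolding odp_def using multiplicity_dvd[of 2 m] by simp
  show "odd (odp m)"
    unfolding odp_def using assms multiplicity_decompose[of m 2] by simp
  show "odp m > 0" using 1 assms by (metis gr0I mult_0_right)
qed

lemma odp_odd: "odd m \<Longrightarrow> multiplicity 2 m = 0 \<and> odp m = m"
  by (simp add: odp_def not_dvd_imp_multiplicity_0)

lemma even_iff_multiplicity: "m > 0 \<Longrightarrow> even m \<longleftrightarrow> multiplicity 2 (m::nat) > 0"
  by (simp add: prime_multiplicity_gt_zero_iff)

lemma kron_prime_two_sign: "odd t \<Longrightarrow> kron_prime t 2 = 1 \<or> kron_prime t 2 = -1"
  by (auto simp: kron_prime_def)

lemma sign_cong_kronecker_split:
  assumes "m > 0" "coprime a (int m)"
  shows "[2 - 2 * kronecker a (int m) = int (multiplicity 2 m) * hsq a + (2 - 2 * kronecker a (int (odp m)))] (mod 8)"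
proof (cases "even m")
  case True
  have oa: "odd a" using coprime_common_divisor[OF assms(2), of 2] True by auto
  note m = odp[OF assms(1)]
  have p: "kronecker a (int (2 ^ i)) = kron_prime a 2 ^ i" for i
  proof (induction i)
    case (Suc i)
    then show ?case using kronecker_mult_right[of 2 "2 ^ i" a] kronecker_prime[of 2 a] by simp
  qed simp
  have "kronecker a (int (2 ^ multiplicity 2 m * odp m)) = kron_prime a 2 ^ multiplicity 2 m * kronecker a (int (odp m))"
    using kronecker_mult_right[of "2 ^ multiplicity 2 m" "odp m" a] m(3) p by simp
  then have k: "kronecker a (int m) = kron_prime a 2 ^ multiplicity 2 m * kronecker a (int (odp m))"
    using m(1) by simp
  have "odp m dvd m" using m(1) by (metis dvd_triv_right)
  then have co: "coprime a (int (odp m))" using assms(2) by (meson coprime_divisors dvd_refl of_nat_dvd_iff)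
  have s: "kron_prime a 2 = 1 \<or> kron_prime a 2 = -1" using oa by (rule kron_prime_two_sign)
  have "[2 - 2 * kronecker a (int m) = (2 - 2 * kron_prime a 2 ^ multiplicity 2 m) + (2 - 2 * kronecker a (int (odp m)))] (mod 8)"
    unfolding k by (rule sign_cong_mult[OF sign_power[OF s] kronecker_unit[OF m(3) co]])
  moreover have "[2 - 2 * kron_prime a 2 ^ multiplicity 2 m = int (multiplicity 2 m) * hsq a] (mod 8)"
    by (rule cong_trans[OF sign_cong_power[OF s] cong_mult[OF cong_refl cong_sym[OF hsq_cong[OF oa]]]])
  ultimately show ?thesis by (rule cong_trans[OF _ cong_add[OF _ cong_refl]])
next
  case False
  then show ?thesis using odp_odd[OF False] by simp
qed

text \<open>Since axy = 1 modulo m, the symbols of a, x, y over m have product 1. Hence (y/md) and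
  (x/m) together leave (a/m) (y/d), where x has disappeared.\<close>

lemma symbol_cong:
  assumes m: "m > 0" "odd m" and a: "a * x * y = 1 + int m * t"
    and d: "d > 0" "coprime y (int d)"
  shows "[(2 - 2 * kronecker y (int (m * d))) - (2 - 2 * kronecker x (int m))
       = (2 - 2 * kronecker a (int m)) + (2 - 2 * kronecker y (int d))] (mod 8)"
proof -
  have cop: "coprime q (int m)" if "q dvd a * x * y" for q
  proof (rule coprimeI)
    fix e assume "e dvd q" "e dvd int m"
    then have "e dvd 1 + int m * t" "e dvd int m * t" using that a by (metis dvd_trans, simp)
    then show "is_unit e" by (metis dvd_add_left_iff)
  qed
  let ?A = "kronecker a (int m)" and ?X = "kronecker x (int m)" and ?Y = "kronecker y (int m)"
  have u: "?A = 1 \<or> ?A = -1" "?X = 1 \<or> ?X = -1" "?Y = 1 \<or> ?Y = -1"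
    by (rule kronecker_unit[OF m(1)], rule cop, simp)+
  have v: "kronecker y (int d) = 1 \<or> kronecker y (int d) = -1"
    by (rule kronecker_unit[OF d])
  have "?A * ?X * ?Y = kronecker (a * x * y) (int m)"
    by (simp add: kronecker_mult_left[OF m(1)])
  also have "\<dots> = kronecker 1 (int m)"
    by (rule kronecker_cong[OF m]) (simp add: a cong_iff_dvd_diff)
  also have "\<dots> = 1" using m(1) by simp
  finally have 1: "?A * ?X * ?Y = 1" .
  have 2: "kronecker y (int (m * d)) = ?Y * kronecker y (int d)"
    by (rule kronecker_mult_right[OF m(1) d(1)])
  show ?thesis unfolding 2 using u v 1 by (elim disjE) (simp_all add: cong_def)
qed

lemma square_cong_1_mod3: "\<not> 3 dvd c \<Longrightarrow> [c^2 = 1] (mod 3)" for c :: int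
  using three_dvd_cube_minus_self[of c] prime_dvd_mult_iff[of "3::int" c "c^2 - 1"] by (simp add: cong_iff_dvd_diff)

text \<open>The contribution of a single divisor \<open>n\<close> of \<open>N\<close>, with \<open>m = N / n\<close>. The first matrix has
  negative lower left entry; since \<open>\<Psi>\<close> is odd in it, its contribution is \<open>- PA\<close>.\<close>

locale hecke_pair =
  fixes a b x y z :: int and d m n :: nat
  assumes d0: "d > 0" and m0: "m > 0"
    and det: "(a * x - int m * int n * b) * y + int m * int n * int d * z = 1"
begin

definition u where "u = a * x - int m * int n * b"
definition w where "w = b * y - int d * z"
text \<open>The floor only turns the real value, shown to be integral in \<open>repA\<close> and
  \<open>repB\<close>, into an integer.\<close>

definition PA where "PA = \<lfloor>Psi (u, - (z * int n), int m * int d, y)\<rfloor>"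
definition PB where "PB = \<lfloor>Psi (a * y, w * int n, int m, x)\<rfloor>"

lemma axy: "a * x * y = 1 + int m * (int n * w)"
  using det by (simp add: w_def algebra_simps)

lemma detA: "u * y - (- (z * int n)) * (int m * int d) = 1"
  using det by (simp add: u_def algebra_simps)

lemma detB: "(a * y) * x - (w * int n) * int m = 1"
  using axy by (simp add: algebra_simps)

lemma repA: "Psi_rep u (- (z * int n)) (int m * int d) y PA"
proof -
  obtain P where "Psi_rep u (- (z * int n)) (int m * int d) y P"
    using Psi_rep_exists[OF _ detA] d0 m0 by auto
  then show ?thesis by (auto simp: PA_def Psi_rep_def)
qed

lemma repB: "Psi_rep (a * y) (w * int n) (int m) x PB"
proof -
  obtain P where "Psi_rep (a * y) (w * int n) (int m) x P"
    using Psi_rep_exists[OF _ detB] m0 by auto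
  then show ?thesis by (auto simp: PB_def Psi_rep_def)
qed

lemma PA_eq: "Psi (u, - (z * int n), int m * int d, y) = of_int PA"
  using repA by (simp add: Psi_rep_def)

lemma PB_eq: "Psi (a * y, w * int n, int m, x) = of_int PB"
  using repB by (simp add: Psi_rep_def)

text \<open>The terms are grouped so that the coefficients of m and n involve m and n only through
  mn = N; summation over the divisors then produces just two linear forms.\<close>

lemma cong3:
  "[PA - PB = int m * ((u + y) * int d - a * y - x + z * y * (int m * int n) * (int d)^2 + w * x * (int m * int n))
     + int n * (- z * y - w * x)] (mod 3)"
proof -
  obtain s where s: "PA = (u + y) * (int m * int d) - (- (z * int n)) * y * ((int m * int d)^2 - 1) + 3 * s"
    using repA unfolding Psi_rep_def by (auto elim: congE_int)
  obtain t where t: "PB = (a * y + x) * int m - (w * int n) * x * ((int m)^2 - 1) + 3 * t"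
    using repB unfolding Psi_rep_def by (auto elim: congE_int)
  show ?thesis
    by (rule congI_int[of _ _ _ "s - t"]) (simp add: s t algebra_simps power2_eq_square)
qed

text \<open>From ad = 1 one gets a = d modulo 3, and the expression collapses to (m^2 - 1) n G with
  G = z (y - xd) + b (xy - d). If 3 does not divide m the first factor vanishes; if it does, axy = 1
  yields xy = d and y = xd, so G vanishes.\<close>

lemma cong3_one:
  assumes "[a * int d = 1] (mod 3)"
  shows "3 dvd int m * ((u + y) * int d - a * y - x + z * y * (int m * int n) * (int d)^2 + w * x * (int m * int n))
     + int n * (- z * y - w * x) + b * int d * int n"
proof -
  let ?m = "int m" and ?d = "int d" and ?n = "int n"
  obtain s where s: "a * ?d = 1 + 3 * s" using assms by (rule congE_int)
  have "\<not> 3 dvd 1 + 3 * s" by presburger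
  then have "\<not> 3 dvd a * ?d" unfolding s .
  then have nd: "\<not> 3 dvd a" "\<not> 3 dvd ?d" by auto
  obtain q where q: "?d^2 = 1 + 3 * q"
    using square_cong_1_mod3[OF nd(2)] by (rule congE_int)
  have p: "\<exists>p. a = ?d + 3 * p"
  proof -
    have "a * ?d^2 = (a * ?d) * ?d" by (simp add: power2_eq_square)
    also have "\<dots> = ?d + 3 * (s * ?d)" unfolding s by (simp add: algebra_simps)
    finally have "a * ?d^2 = ?d + 3 * (s * ?d)" .
    then have "a = ?d + 3 * (s * ?d - q * a)" unfolding q by (simp add: algebra_simps)
    then show ?thesis by blast
  qed
  then obtain p where p: "a = ?d + 3 * p" ..
  let ?G = "z * y + w * x - b * ?d"
  have E: "?m * ((u + y) * ?d - a * y - x + z * y * (?m * ?n) * ?d^2 + w * x * (?m * ?n)) + ?n * (- z * y - w * x) + b * ?d * ?n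
     = (?m^2 - 1) * (?n * ?G) + 3 * (?m * (x * s - p * y + z * y * (?m * ?n) * q))"
  proof -
    have "(u + y) * ?d - a * y - x = (a * ?d) * x - ?m * ?n * b * ?d + y * (?d - a) - x" by (simp add: u_def algebra_simps)
    also have "\<dots> = 3 * (x * s - p * y) - ?m * ?n * b * ?d" unfolding s by (subst p) (simp add: algebra_simps)
    finally have 1: "(u + y) * ?d - a * y - x = 3 * (x * s - p * y) - ?m * ?n * b * ?d" .
    show ?thesis unfolding 1 q by (simp add: algebra_simps power2_eq_square)
  qed
  have "3 dvd (?m^2 - 1) * (?n * ?G)"
  proof (cases "3 dvd ?m")
    case False
    then have "3 dvd ?m^2 - 1" using three_dvd_cube_minus_self[of ?m] prime_dvd_mult_iff[of "3::int"] by auto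
    then show ?thesis by simp
  next
    case True
    then obtain m' where m': "?m = 3 * m'" by blast
    have "a * (x * y - ?d) = 3 * (m' * (?n * w) - s)" using axy s unfolding m' by (simp add: algebra_simps)
    then have "3 dvd a * (x * y - ?d)" by simp
    then have xy: "3 dvd x * y - ?d" using nd(1) prime_dvd_mult_iff[of "3::int"] by auto
    then obtain e where e: "x * y = ?d + 3 * e" by (metis dvdE diff_eq_eq add.commute)
    have "\<not> 3 dvd x"
    proof
      assume "3 dvd x"
      then have "3 dvd x * y" by simp
      then have "3 dvd ?d" using e by presburger
      then show False using nd(2) by simp
    qed
    then obtain q' where q': "x^2 = 1 + 3 * q'"
      using square_cong_1_mod3 by (blast elim: congE_int)
    have "x * (x * y) = x^2 * y" by (simp add: power2_eq_square)
    then have "x * (x * y) = y + 3 * q' * y" unfolding q' by (simp add: algebra_simps)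
    then have "y = x * ?d + 3 * (x * e - q' * y)" unfolding e by (simp add: algebra_simps)
    then have y: "3 dvd y - x * ?d" by (metis add_diff_cancel_left' dvd_triv_left)
    have "?G = z * (y - x * ?d) + b * (x * y - ?d)" by (simp add: w_def algebra_simps)
    then have "3 dvd ?G" using y xy by simp
    then show ?thesis by simp
  qed
  then show ?thesis unfolding E by simp
qed

lemma coprime_y: "coprime y (int m * int n * int d)"
proof (rule coprimeI)
  fix e assume "e dvd y" "e dvd int m * int n * int d"
  then have "e dvd u * y + int m * int n * int d * z" by simp
  then show "is_unit e" using det by (simp add: u_def)
qed

lemma coprime_a_m: "coprime a (int m)"
proof (rule coprimeI)
  fix e assume e: "e dvd a" "e dvd int m"
  then have "e dvd a * x * y" "e dvd int m * (int n * w)" by simp_all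
  then show "is_unit e" unfolding axy by (metis dvd_add_left_iff)
qed

abbreviation symb where "symb \<equiv> (2 - 2 * kronecker a (int m)) + (2 - 2 * kronecker y (int (odp d)))"
abbreviation al where "al \<equiv> int (multiplicity 2 m)"
abbreviation be where "be \<equiv> int (multiplicity 2 d)"
abbreviation mo where "mo \<equiv> int (odp m)"
abbreviation dd where "dd \<equiv> int (odp d)"

lemma coprime_y_odp: "coprime y dd"
proof -
  have "odp d dvd d" using odp(1)[OF d0] by (metis dvd_triv_right)
  then have "dd dvd int m * int n * int d" by (meson dvd_mult of_nat_dvd_iff)
  then show ?thesis using coprime_y by (meson coprime_divisors dvd_refl)
qed

text \<open>The symbols arise over the odd part of m; replacing it by m itself, as
  \<open>varpi\<close> requires, costs \<open>al * hsq a\<close>.\<close>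

lemma symbol:
  "[(2 - 2 * kronecker y (int (odp m * odp d))) - (2 - 2 * kronecker x mo) = symb - al * hsq a] (mod 8)"
proof -
  have "a * x * y = 1 + mo * (2 ^ multiplicity 2 m * int n * w)"
    unfolding axy using arg_cong[OF odp(1)[OF m0], of int] by (simp add: mult_ac)
  then have "[(2 - 2 * kronecker y (int (odp m * odp d))) - (2 - 2 * kronecker x mo)
      = (2 - 2 * kronecker a mo) + (2 - 2 * kronecker y dd)] (mod 8)"
    by (rule symbol_cong[OF odp(3,2)[OF m0] _ odp(3)[OF d0] coprime_y_odp])
  moreover have "[(2 - 2 * kronecker a mo) + (2 - 2 * kronecker y dd) = symb - al * hsq a] (mod 8)"
  proof -
    obtain t where t: "2 - 2 * kronecker a (int m) = al * hsq a + (2 - 2 * kronecker a mo) + 8 * t"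
      using sign_cong_kronecker_split[OF m0 coprime_a_m] by (rule congE_int)
    show ?thesis by (rule congI_int[of _ _ _ "- t"]) (use t in simp)
  qed
  ultimately show ?thesis by (rule cong_trans)
qed

lemma cong8_odd_odd:
  assumes "odd m" "odd d"
  shows "[PA - PB = symb + int m * ((u + y - 3) * int d - (a * y + x - 3))] (mod 8)"
proof -
  have o: "odp m = m" "odp d = d" "multiplicity 2 m = 0" using odp_odd assms by auto
  obtain s where s: "PA = (u + y - 3) * (int m * int d) + 2 - 2 * kronecker y (int m * int d) + 8 * s"
    using repA assms unfolding Psi_rep_def by (auto elim: congE_int)
  obtain t where t: "PB = (a * y + x - 3) * int m + 2 - 2 * kronecker x (int m) + 8 * t"
    using repB assms unfolding Psi_rep_def by (auto elim: congE_int)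
  obtain v where "(2 - 2 * kronecker y (int m * int d)) - (2 - 2 * kronecker x (int m)) = symb + 8 * v"
    using symbol unfolding o by (auto elim: congE_int)
  then show ?thesis
    by (intro congI_int[of _ _ _ "s - t + v"]) (simp add: s t algebra_simps)
qed

lemma cong8_odd_even:
  assumes "odd m" "even d"
  shows "[PA - PB = symb + (1 - y - z * int n * y - int m * int d * y + be * hsq y + (int m * dd - 1) * (y - 1)
       - (a * y + x - 3) * int m)] (mod 8)"
proof -
  have o: "odp m = m" "multiplicity 2 m = 0" using odp_odd assms by auto
  have md: "int m * int d = 2 ^ multiplicity 2 d * int (m * odp d)"
    using arg_cong[OF odp(1)[OF d0], of int] by (simp add: mult_ac)
  obtain s where s: "PA = 1 - y + (- (z * int n)) * y - (int m * int d) * y + be * hsq y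
      + (int (m * odp d) - 1) * (y - 1) + (2 - 2 * kronecker y (int (m * odp d))) + 8 * s"
    by (rule congE_int[OF Psi_even[OF _ detA md _ _ PA_eq]]) (use assms d0 m0 odp(2)[OF d0] in auto)[3]
  obtain t where t: "PB = (a * y + x - 3) * int m + 2 - 2 * kronecker x (int m) + 8 * t"
    using repB assms unfolding Psi_rep_def by (auto elim: congE_int)
  obtain v where "(2 - 2 * kronecker y (int (m * odp d))) - (2 - 2 * kronecker x (int m)) = symb + 8 * v"
    using symbol unfolding o by (auto elim: congE_int)
  then show ?thesis
    by (intro congI_int[of _ _ _ "s - t + v"]) (simp add: s t hsq_def algebra_simps)
qed

text \<open>For even N the divisors have m = N/n of either parity, so a single formula for all
  parities of m and d is needed before summing. The case m even has this shape directly; for odd m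
  the determinant relation rewrites the other formulas into it.\<close>

lemma cong8_even:
  assumes mn: "even (m * n)"
  shows "[PA - PB = symb + (int n * (- z * y - w * x) + int m * (x - int d * y) + (x - y + be * hsq y + (dd - 1) * (y - 1))
       + al * (hsq y - hsq x - hsq a) + (mo - 1) * (y - x))] (mod 8)"
proof -
  have "odd (a * x * y)" unfolding axy using mn by auto
  then have "odd a" "odd x" "odd y" by auto
  then obtain x1 y1 where xy1: "x = 2 * x1 + 1" "y = 2 * y1 + 1" by (meson oddE)
  obtain tx where tx: "x^2 = 1 + 8 * tx" using \<open>odd x\<close> by (rule odd_squareE)
  obtain ty where ty: "y^2 = 1 + 8 * ty" using \<open>odd y\<close> by (rule odd_squareE)
  have "odd dd" "odd mo" using odp(2)[OF d0] odp(2)[OF m0] by auto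
  then obtain d1 o1 where do1: "dd = 2 * d1 + 1" "mo = 2 * o1 + 1" by (meson oddE)
  show ?thesis
  proof (cases "even m")
    case True
    have md: "int m * int d = 2 ^ (multiplicity 2 m + multiplicity 2 d) * int (odp m * odp d)"
      using arg_cong[OF odp(1)[OF d0], of int] arg_cong[OF odp(1)[OF m0], of int] by (simp add: mult_ac power_add)
    have mm: "int m = 2 ^ multiplicity 2 m * int (odp m)"
      using arg_cong[OF odp(1)[OF m0], of int] by simp
    obtain s where s: "PA = 1 - y + (- (z * int n)) * y - (int m * int d) * y + int (multiplicity 2 m + multiplicity 2 d) * hsq y
        + (int (odp m * odp d) - 1) * (y - 1) + (2 - 2 * kronecker y (int (odp m * odp d))) + 8 * s"
      by (rule congE_int[OF Psi_even[OF _ detA md _ _ PA_eq]]) (use True d0 m0 odp(2)[OF d0] odp(2)[OF m0] in auto)[3]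
    obtain t where t: "PB = 1 - x + (w * int n) * x - int m * x + al * hsq x
        + (mo - 1) * (x - 1) + (2 - 2 * kronecker x mo) + 8 * t"
      by (rule congE_int[OF Psi_even[OF _ detB mm _ _ PB_eq]]) (use True m0 odp(2)[OF m0] in auto)[3]
    obtain v where v: "(2 - 2 * kronecker y (int (odp m * odp d))) - (2 - 2 * kronecker x mo) = symb - al * hsq a + 8 * v"
      using symbol by (auto elim: congE_int)
    \<comment> \<open>The defect is (mo - 1)(dd - 1)(y - 1), a product of three even
      numbers.\<close>
    have e: "(mo * dd - 1) * (y - 1) - (mo - 1) * (x - 1) = (dd - 1) * (y - 1) + (mo - 1) * (y - x) + 8 * (o1 * d1 * y1)"
      unfolding do1 xy1 by (simp add: algebra_simps)
    have "PA - PB = x - y - z * int n * y - int m * int d * y + int m * x - w * int n * x + (al + be) * hsq y - al * hsq x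
        + ((mo * dd - 1) * (y - 1) - (mo - 1) * (x - 1))
        + ((2 - 2 * kronecker y (int (odp m * odp d))) - (2 - 2 * kronecker x mo)) + 8 * (s - t)"
      unfolding s t hsq_def by (simp add: algebra_simps)
    also have "\<dots> = symb + (int n * (- z * y - w * x) + int m * (x - int d * y) + (x - y + be * hsq y + (dd - 1) * (y - 1))
       + al * (hsq y - hsq x - hsq a) + (mo - 1) * (y - x)) + 8 * (s - t + v + o1 * d1 * y1)"
      unfolding v e by (simp add: algebra_simps)
    finally show ?thesis by (intro congI_int[of _ _ _ "s - t + v + o1 * d1 * y1"]) simp
  next
    case om: False
    have o: "odp m = m" "multiplicity 2 m = 0" using odp_odd om by auto
    obtain m1 where m1: "int m = 2 * m1 + 1" using do1(2) o by auto
    obtain tm where tm: "(int m)^2 = 1 + 8 * tm"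
      by (rule odd_nat_squareE) (use om in auto)
    \<comment> \<open>Quotient from multiplying axy = 1 + mnw by mx and reducing the squares of m
      and x modulo 8; it replaces nwx by m (ay - x).\<close>
    define W where "W = tx * int m * a * y - tm * int n * w * x"
    have "int n * w * x * (int m)^2 = int m * x * (a * x * y - 1)"
      unfolding axy by (simp add: power2_eq_square algebra_simps)
    also have "\<dots> = int m * (a * y * x^2 - x)" by (simp add: power2_eq_square algebra_simps)
    finally have nwx: "int n * w * x = int m * (a * y - x) + 8 * W"
      unfolding tm tx W_def by (simp add: algebra_simps)
    show ?thesis
    proof (cases "even d")
      case True
      obtain s where s: "PA - PB = symb + (1 - y - z * int n * y - int m * int d * y + be * hsq y + (int m * dd - 1) * (y - 1)
       - (a * y + x - 3) * int m) + 8 * s" using cong8_odd_even[OF om True] by (rule congE_int)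
      have "(1 - y - z * int n * y - int m * int d * y + be * hsq y + (int m * dd - 1) * (y - 1) - (a * y + x - 3) * int m)
        - (int n * (- z * y - w * x) + int m * (x - int d * y) + (x - y + be * hsq y + (dd - 1) * (y - 1))
         + 0 * (hsq y - hsq x - hsq a) + (int m - 1) * (y - x))
        = (1 - x) + (int m - 1) * dd * (y - 1) - int m * (a * y + 2 * x - 3) + int n * w * x - (int m - 1) * (y - x)"
        by (simp add: algebra_simps)
      also have "\<dots> = (1 - x) * (2 * int m + 2) + (int m - 1) * (dd - 1) * (y - 1) + 8 * W"
        unfolding nwx by (simp add: algebra_simps)
      also have "\<dots> = 8 * (W - x1 * (m1 + 1) + m1 * d1 * y1)"
        unfolding m1 do1(1) xy1 by (simp add: algebra_simps)
      finally show ?thesis unfolding o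
        by (intro congI_int[of _ _ _ "s + W - x1 * (m1 + 1) + m1 * d1 * y1"]) (use s in \<open>simp add: algebra_simps\<close>)
    next
      case od: False
      have o': "odp d = d" "multiplicity 2 d = 0" using odp_odd od by auto
      obtain t where t: "(int m * int d)^2 = 1 + 8 * t"
        by (rule odd_squareE[of "int m * int d"]) (use om od in auto)
      \<comment> \<open>The analogous quotient for the other matrix: uy + mndz = 1, multiplied by
        mdy, replaces nzy by md (y - u).\<close>
      define V where "V = - (int m * int d * u * ty) - t * int n * z * y"
      have "int n * z * y * (int m * int d)^2 = int m * int d * y * (int m * int n * int d * z)"
        by (simp add: power2_eq_square algebra_simps)
      also have "int m * int n * int d * z = 1 - u * y" using det by (simp add: u_def)
      also have "int m * int d * y * (1 - u * y) = int m * int d * (y - u * y^2)" by (simp add: power2_eq_square algebra_simps)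
      finally have nzy: "int n * z * y = int m * int d * (y - u) + 8 * V"
        unfolding t ty V_def by (simp add: algebra_simps)
      obtain s where s: "PA - PB = symb + int m * ((u + y - 3) * int d - (a * y + x - 3)) + 8 * s"
        using cong8_odd_odd[OF om od] by (rule congE_int)
      have "int m * ((u + y - 3) * int d - (a * y + x - 3))
        - (int n * (- z * y - w * x) + int m * (x - int d * y) + (x - y + 0 * hsq y + (int d - 1) * (y - 1))
         + 0 * (hsq y - hsq x - hsq a) + (int m - 1) * (y - x))
        = int m * ((u + y - 3) * int d - (a * y + x - 3)) + int n * z * y + int n * w * x - int m * (x - int d * y)
          - (x - y + (int d - 1) * (y - 1)) - (int m - 1) * (y - x)"
        by (simp add: algebra_simps)
      also have "\<dots> = (3 * int m - 1) * (int d * (y - 1) - (x - 1)) - (int m - 3) * (y - x) + 8 * (V + W)"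
        unfolding nwx nzy by (simp add: algebra_simps)
      also have "\<dots> = 8 * (V + W + (3 * m1 + 1) * d1 * y1 + (m1 + 1) * (y1 - x1))"
        unfolding m1 do1(1)[unfolded o'] xy1 by (simp add: algebra_simps)
      finally show ?thesis unfolding o o'
        by (intro congI_int[of _ _ _ "s + V + W + (3 * m1 + 1) * d1 * y1 + (m1 + 1) * (y1 - x1)"]) (use s o' in \<open>simp add: algebra_simps\<close>)
    qed
  qed
qed

end

text \<open>The part of the congruence modulo 8 for even \<open>N\<close> that does not involve \<open>l\<close>.\<close>

lemma core_scalar:
  fixes a x y N w s v D Sm Sn :: int
  assumes axy: "a * x * y = 1 + N * w" and N: "even N" and D: "even D"
    and r2: "\<And>N'. N = 2 * N' \<Longrightarrow> odd N' \<Longrightarrow> even (v - Sn) \<and> [D = Sm + N' * Sn + s] (mod 4)"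
    and r4: "\<And>N'. N = 4 * N' \<Longrightarrow> odd N' \<Longrightarrow> even (v + s + Sm + Sn)"
  shows "8 dvd (a * y - x) * (w * Sn - Sm) + s * (x - y + (a - 1) * (y + 2)) + v * (hsq y - hsq x - hsq a)
           + D * (y - x + 3 * (a - 1))"
proof -
  have "odd (a * x * y)" unfolding axy using N by auto
  then have o: "odd a" "odd x" "odd y" by auto
  then obtain a1 x1 y1 where 1: "a = 2 * a1 + 1" "x = 2 * x1 + 1" "y = 2 * y1 + 1" by (meson oddE)
  obtain ta where ta: "a^2 = 1 + 8 * ta" using o(1) by (rule odd_squareE)
  obtain tx where tx: "x^2 = 1 + 8 * tx" using o(2) by (rule odd_squareE)
  obtain ty where ty: "y^2 = 1 + 8 * ty" using o(3) by (rule odd_squareE)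
  obtain D1 where D1: "D = 2 * D1" using D by blast
  obtain N' where N': "N = 2 * N'" using N by blast
  \<comment> \<open>Half of ay - x. All terms turn out to be 2g times something modulo 8, and the
    determinant gives g = x (N/2) w modulo 4.\<close>
  define g where "g = a1 * y + y1 - x1"
  have g: "a * y - x = 2 * g" unfolding g_def 1 by (simp add: algebra_simps)
  have x: "x = a * y - 2 * g" using g by simp
  have "a * y * x^2 - x = x * N * w" using axy by (simp add: power2_eq_square algebra_simps)
  then have gN: "g = x * N' * w - 4 * (tx * a * y)" using g unfolding tx N' by (simp add: algebra_simps)
  have hh: "2 * hsq t = t^2 - 1" if "odd t" for t using that by (auto simp: hsq_def elim: oddE)
  have "2 * (hsq y - hsq x - hsq a) = y^2 - x^2 - a^2 + 1"
    using hh[OF o(1)] hh[OF o(2)] hh[OF o(3)] by simp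
  also have "\<dots> = (1 - a^2) * (1 + y^2) + 4 * (a * y * g - g^2)"
    by (subst x) (simp add: power2_eq_square algebra_simps)
  also have "\<dots> = 2 * (2 * (a * y * g - g^2) - 8 * (ta * (1 + 4 * ty)))"
    unfolding ta ty by (simp add: algebra_simps)
  finally have H: "hsq y - hsq x - hsq a = 2 * (a * y * g - g^2) - 8 * (ta * (1 + 4 * ty))" by simp
  have xs: "x - y + (a - 1) * (y + 2) = - 2 * g + 8 * (a1 * (y1 + 1))"
    unfolding x unfolding 1(1,3) by (simp add: algebra_simps)
  have ys: "y - x + 3 * (a - 1) = 2 * g + 4 * (a1 * (1 - y1))"
    unfolding x unfolding 1(1,3) by (simp add: algebra_simps)
  let ?B = "w * Sn - Sm - s + v * (a * y - g) + D"
  have E: "(a * y - x) * (w * Sn - Sm) + s * (x - y + (a - 1) * (y + 2)) + v * (hsq y - hsq x - hsq a) + D * (y - x + 3 * (a - 1))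
     = 2 * (g * ?B) + 8 * (s * a1 * (y1 + 1) - v * ta * (1 + 4 * ty) + D1 * a1 * (1 - y1))"
    unfolding g xs ys H D1 by (simp add: algebra_simps power2_eq_square)
  \<comment> \<open>If 8 | N, or if 4 | N and w is even, then 4 | g. If N is 4 modulo 8 and w is
    odd, g is even and \<open>r4\<close> makes the bracket even. If N is 2 modulo 4, then
    \<open>r2\<close> gives an even bracket beside an even g for even w, and a bracket divisible by
    4 for odd w.\<close>
  have "4 dvd g * ?B"
  proof (cases "even N'")
    case True
    then obtain N2 where N2: "N' = 2 * N2" by blast
    have g2: "g = 2 * (x * N2 * w - 2 * (tx * a * y))" using gN unfolding N2 by (simp add: algebra_simps)
    show ?thesis
    proof (cases "even N2 \<or> even w")
      case True
      then have "even (x * N2 * w - 2 * (tx * a * y))" by auto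
      then have "4 dvd g" unfolding g2 by presburger
      then show ?thesis by simp
    next
      case False
      then have "even (v + s + Sm + Sn)" using r4[of N2] N' N2 by auto
      moreover have "even g" using g2 by simp
      ultimately have "even ?B" using False D o by auto
      with \<open>even g\<close> show ?thesis by (elim evenE) simp
    qed
  next
    case False
    have r: "even (v - Sn)" "[D = Sm + N' * Sn + s] (mod 4)" using r2[OF N' False] by auto
    obtain e where e: "D = Sm + N' * Sn + s + 4 * e" using r(2) by (rule congE_int)
    obtain f where f: "v = Sn + 2 * f" using r(1) by (metis evenE diff_eq_eq add.commute)
    have B: "?B = Sn * (w + N' + a * y - g) + 2 * f * (a * y - g) + 4 * e" unfolding e f by (simp add: algebra_simps)
    show ?thesis
    proof (cases "even w")
      case True
      then have "even g" using gN by simp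
      moreover have "even ?B" unfolding B using True \<open>even g\<close> False o by simp
      ultimately show ?thesis by (elim evenE) simp
    next
      case ow: False
      then have "odd g" using gN False o by simp
      then have "even (a * y - g)" using o by simp
      have "w + N' + a * y - g = w + N' + x + g" using x by simp
      also have "\<dots> = (w + N') * (1 + x * N') + x * (1 - N'^2) - 4 * (tx * a * y)"
        unfolding gN by (simp add: algebra_simps power2_eq_square)
      finally have *: "w + N' + a * y - g = (w + N') * (1 + x * N') + x * (1 - N'^2) - 4 * (tx * a * y)" .
      have "even (w + N')" "even (1 + x * N')" using ow False o by auto
      then have "4 dvd (w + N') * (1 + x * N')" by (elim evenE) simp
      moreover obtain q where "N'^2 = 1 + 8 * q" using False by (rule odd_squareE)
      then have "x * (1 - N'^2) = 4 * (- 2 * x * q)" by simp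
      then have "4 dvd x * (1 - N'^2)" by (metis dvd_triv_left)
      ultimately have "4 dvd w + N' + a * y - g" unfolding * by simp
      moreover have "4 dvd 2 * f * (a * y - g)" using \<open>even (a * y - g)\<close> by (elim evenE) simp
      ultimately have "4 dvd ?B" unfolding B by simp
      then show ?thesis by simp
    qed
  qed
  then obtain c where "g * ?B = 4 * c" by blast
  then have "2 * (g * ?B) = 8 * c" by simp
  then show ?thesis unfolding E by (metis dvd_add dvd_triv_left)
qed

text \<open>A sign contributes 0 or 4 modulo 8, so its multiplier counts only modulo 2. This also
  replaces |r_n| by r_n, and the exponent 2k by its parity.\<close>

lemma sign_mult_parity:
  fixes s i j :: int assumes "s = 1 \<or> s = -1" "even (i - j)"
  shows "[i * (2 - 2 * s) = j * (2 - 2 * s)] (mod 8)"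
proof -
  obtain k where "i = j + 2 * k" using assms(2) by (metis evenE diff_eq_eq add.commute)
  then show ?thesis using assms(1) by (auto simp: cong_iff_dvd_diff algebra_simps)
qed

section \<open>Symbols, odd parts and 2-adic valuations of products\<close>

lemma kronecker_power_right:
  assumes "n > 0" shows "kronecker a (int (n ^ k)) = kronecker a (int n) ^ k"
proof (induction k)
  case (Suc k)
  then show ?case using kronecker_mult_right[of n "n ^ k" a] assms by simp
qed simp

lemma sign_cong_kronecker_prod:
  assumes "finite I" "\<And>i. i \<in> I \<Longrightarrow> f i > 0 \<and> coprime a (int (f i))"
  shows "[2 - 2 * kronecker a (int (\<Prod>i\<in>I. f i ^ nat \<bar>r i\<bar>)) = (\<Sum>i\<in>I. r i * (2 - 2 * kronecker a (int (f i))))] (mod 8)"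
  using assms
proof (induction I rule: finite_induct)
  case (insert i I)
  let ?P = "\<Prod>i\<in>I. f i ^ nat \<bar>r i\<bar>"
  have P0: "?P > 0" using insert by (auto intro!: prod_pos)
  have fi: "f i > 0" "coprime a (int (f i))" using insert by auto
  have "coprime a (int ?P)" using insert by (auto simp: of_nat_prod intro!: prod_coprime_right)
  then have u: "kronecker a (int ?P) = 1 \<or> kronecker a (int ?P) = -1" using P0 by (rule kronecker_unit[rotated])
  have s: "kronecker a (int (f i)) = 1 \<or> kronecker a (int (f i)) = -1" using fi by (rule kronecker_unit)
  have k: "kronecker a (int (\<Prod>i\<in>insert i I. f i ^ nat \<bar>r i\<bar>)) = kronecker a (int (f i)) ^ nat \<bar>r i\<bar> * kronecker a (int ?P)"
    unfolding prod.insert[OF insert.hyps(1,2)] kronecker_mult_right[OF zero_less_power[OF fi(1)] P0] kronecker_power_right[OF fi(1)] ..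
  have A: "[2 - 2 * kronecker a (int (\<Prod>i\<in>insert i I. f i ^ nat \<bar>r i\<bar>))
     = (2 - 2 * kronecker a (int (f i)) ^ nat \<bar>r i\<bar>) + (2 - 2 * kronecker a (int ?P))] (mod 8)"
    unfolding k by (rule sign_cong_mult[OF sign_power[OF s] u])
  have B: "[2 - 2 * kronecker a (int (f i)) ^ nat \<bar>r i\<bar> = r i * (2 - 2 * kronecker a (int (f i)))] (mod 8)"
    by (rule cong_trans[OF sign_cong_power[OF s] sign_mult_parity[OF s]]) auto
  have C: "[2 - 2 * kronecker a (int ?P) = (\<Sum>i\<in>I. r i * (2 - 2 * kronecker a (int (f i))))] (mod 8)"
    using insert by blast
  show ?case unfolding sum.insert[OF insert.hyps(1,2)]
    by (rule cong_trans[OF A cong_add[OF B C]])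
qed simp

lemma multiplicity_2_mult: "m > 0 \<Longrightarrow> n > 0 \<Longrightarrow> multiplicity 2 (m * n :: nat) = multiplicity 2 m + multiplicity 2 n"
  by (rule prime_elem_multiplicity_mult_distrib) auto

lemma odp_mult: "m > 0 \<Longrightarrow> n > 0 \<Longrightarrow> odp (m * n) = odp m * odp n"
proof -
  assume mn: "m > 0" "n > 0"
  have "2 ^ multiplicity 2 (m * n) * odp (m * n) = m * n" using odp(1)[of "m * n"] mn by simp
  also have "\<dots> = (2 ^ multiplicity 2 m * odp m) * (2 ^ multiplicity 2 n * odp n)"
    using odp(1)[OF mn(1)] odp(1)[OF mn(2)] by simp
  also have "\<dots> = 2 ^ multiplicity 2 (m * n) * (odp m * odp n)"
    by (simp add: multiplicity_2_mult[OF mn] power_add)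
  finally show ?thesis by simp
qed

lemma odp_one [simp]: "odp 1 = 1" by (simp add: odp_def)

lemma odp_power: "m > 0 \<Longrightarrow> odp (m ^ k) = odp m ^ k"
  by (induction k) (use odp_one in \<open>auto simp: odp_mult\<close>)

lemma multiplicity_2_power: "m > 0 \<Longrightarrow> multiplicity 2 (m ^ k :: nat) = k * multiplicity 2 m"
  by (induction k) (auto simp: multiplicity_2_mult)

lemma odd_cong_mult4:
  fixes p q :: int assumes "odd p" "odd q"
  shows "[p * q - 1 = (p - 1) + (q - 1)] (mod 4)"
proof -
  obtain p1 q1 where "p = 2 * p1 + 1" "q = 2 * q1 + 1" using assms by (meson oddE)
  then show ?thesis by (intro congI_int[of _ _ _ "p1 * q1"]) (simp add: algebra_simps)
qed

lemma odd_cong_power4: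
  fixes p :: int assumes "odd p"
  shows "[p ^ k - 1 = int k * (p - 1)] (mod 4)"
proof (induction k)
  case (Suc k)
  have "[p * p ^ k - 1 = (p - 1) + (p ^ k - 1)] (mod 4)" by (rule odd_cong_mult4) (use assms in auto)
  moreover have "[(p - 1) + (p ^ k - 1) = (p - 1) + int k * (p - 1)] (mod 4)" by (intro cong_add cong_refl Suc)
  ultimately have "[p * p ^ k - 1 = (p - 1) + int k * (p - 1)] (mod 4)" by (rule cong_trans)
  then show ?case by (simp add: algebra_simps)
qed simp

text \<open>For odd numbers p - 1 is additive modulo 4 under multiplication, and being even it also
  allows |r i| to be exchanged for r i. Applied to \<open>varpi\<close>, this reads two divisor sums
  off its odd part and its valuation.\<close>

lemma odp_prod_cong:
  assumes "finite I" "\<And>i. i \<in> I \<Longrightarrow> f i > 0"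
  shows "[int (odp (\<Prod>i\<in>I. f i ^ nat \<bar>r i\<bar>)) - 1 = (\<Sum>i\<in>I. r i * (int (odp (f i)) - 1))] (mod 4)
   \<and> even (int (multiplicity 2 (\<Prod>i\<in>I. f i ^ nat \<bar>r i\<bar>)) - (\<Sum>i\<in>I. r i * int (multiplicity 2 (f i))))"
  using assms
proof (induction I rule: finite_induct)
  case (insert i I)
  let ?P = "\<Prod>i\<in>I. f i ^ nat \<bar>r i\<bar>" and ?k = "nat \<bar>r i\<bar>"
  have P0: "?P > 0" using insert by (auto intro!: prod_pos)
  have fi: "f i > 0" "f i ^ ?k > 0" using insert by auto
  have of: "odd (int (odp (f i)))" "odd (int (odp ?P))" using odp(2)[OF fi(1)] odp(2)[OF P0] by auto
  have IH: "[int (odp ?P) - 1 = (\<Sum>i\<in>I. r i * (int (odp (f i)) - 1))] (mod 4)"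
    "even (int (multiplicity 2 ?P) - (\<Sum>i\<in>I. r i * int (multiplicity 2 (f i))))" using insert by auto
  have o: "int (odp (\<Prod>i\<in>insert i I. f i ^ nat \<bar>r i\<bar>)) = int (odp (f i)) ^ ?k * int (odp ?P)"
    using insert.hyps odp_mult[OF fi(2) P0] odp_power[OF fi(1)] by simp
  have A: "[int (odp (f i)) ^ ?k * int (odp ?P) - 1 = (int (odp (f i)) ^ ?k - 1) + (int (odp ?P) - 1)] (mod 4)"
    by (rule odd_cong_mult4) (use of in auto)
  have B: "[int (odp (f i)) ^ ?k - 1 = int ?k * (int (odp (f i)) - 1)] (mod 4)"
    by (rule odd_cong_power4[OF of(1)])
  have C: "[int ?k * (int (odp (f i)) - 1) = r i * (int (odp (f i)) - 1)] (mod 4)"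
  proof -
    obtain q where q: "int (odp (f i)) = 2 * q + 1" using of(1) by (meson oddE)
    have "even (int ?k - r i)" by auto
    then obtain t where "int ?k - r i = 2 * t" by blast
    then show ?thesis unfolding q
      by (intro congI_int[of _ _ _ "t * q"]) (simp add: left_diff_distrib[symmetric])
  qed
  have 1: "[int (odp (\<Prod>i\<in>insert i I. f i ^ nat \<bar>r i\<bar>)) - 1 = (\<Sum>i\<in>insert i I. r i * (int (odp (f i)) - 1))] (mod 4)"
    unfolding o sum.insert[OF insert.hyps(1,2)]
    by (rule cong_trans[OF A cong_add[OF cong_trans[OF B C] IH(1)]])
  have m: "multiplicity 2 (\<Prod>i\<in>insert i I. f i ^ nat \<bar>r i\<bar>) = ?k * multiplicity 2 (f i) + multiplicity 2 ?P"
    using insert.hyps multiplicity_2_mult[OF fi(2) P0] multiplicity_2_power[OF fi(1)] by simp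
  have "even (int ?k * int (multiplicity 2 (f i)) - r i * int (multiplicity 2 (f i)))" by auto
  then have 2: "even (int (multiplicity 2 (\<Prod>i\<in>insert i I. f i ^ nat \<bar>r i\<bar>)) - (\<Sum>i\<in>insert i I. r i * int (multiplicity 2 (f i))))"
    unfolding m using insert.hyps IH(2) by auto
  show ?case using 1 2 by blast
qed (simp add: odp_def)

text \<open>Here \<open>lam\<close> stands for l - 1 and d = al modulo 8. The right side separates
  the expression of \<open>core_scalar\<close>, which is free of l, from terms with the factor
  \<open>lam\<close> and from multiples of 8.\<close>

lemma reduce_odd:
  fixes A a d y x W Sn Sm s D lam Nn k e1 v H :: int
  assumes "A = W * (d * y - x) + 8 * e1" "d = a + a * lam - 8 * k"
  shows "Sn * A + Sm * (x - d * y) + s * (x - y + (d - 1) * (y - 1) + 3 * (d - 1) - 3 * lam * (Nn - 1)) + v * H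
     + D * (y - x + 3 * (d - 1) - 3 * lam * (Nn - 1))
   = ((a * y - x) * (W * Sn - Sm) + s * (x - y + (a - 1) * (y + 2)) + v * H + D * (y - x + 3 * (a - 1)))
     + (W * a * y) * (lam * Sn) - (a * y) * (lam * Sm) + s * lam * (a * (y + 2) - 3 * (Nn - 1)) + D * lam * (3 * a - 3 * (Nn - 1))
     + 8 * (Sn * e1 - Sn * W * k * y + Sm * k * y - s * k * (y + 2) - 3 * D * k)"
  unfolding assms by (simp add: algebra_simps)

lemma four_dvd_mult: "even p \<Longrightarrow> even q \<Longrightarrow> 4 dvd p * q" for p q :: int
  by (elim evenE) simp

lemma eight_dvd_mult: "even p \<Longrightarrow> even q \<Longrightarrow> even t \<Longrightarrow> 8 dvd p * q * t" for p q t :: int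
  by (elim evenE) simp

lemma hsq_four: "odd t \<Longrightarrow> 4 dvd hsq t"
proof -
  assume "odd t"
  then obtain k where "t^2 = 1 + 8 * k" using odd_square_cong_1 by (blast elim: congE_int)
  then show ?thesis by (simp add: hsq_def)
qed

lemma mult2_pow: "odd N' \<Longrightarrow> multiplicity 2 (2 ^ k * N' :: nat) = k"
proof -
  assume o: "odd N'"
  then have "N' > 0" by (auto intro: Nat.gr0I)
  then show ?thesis using multiplicity_2_mult[of "2 ^ k" N'] o multiplicity_2_power[of 2 k] by (simp add: not_dvd_imp_multiplicity_0)
qed

subsection \<open>The product of the two character values\<close>

locale eta_hecke =
  fixes N :: nat and r :: "nat \<Rightarrow> int" and a d :: nat and b x y z :: int
  assumes N0: "N > 0" and a0: "a > 0" and d0: "d > 0"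
    and det: "(- int N * b + int a * x) * y + int N * int d * z = 1"
    and hSm: "24 dvd (int (a * d) - 1) * (\<Sum>n\<in>divs N. int (N div n) * r n)"
    and hSn: "24 dvd (int (a * d) - 1) * x_N N r"
    and hsquare: "odd (\<Sum>n\<in>divs N. r n) \<Longrightarrow> \<exists>t. a * d = t ^ 2"
begin

text \<open>One linear functional for all sums over divisors, so that congruences holding for each n
  can be added. Of its values, s is 2k', \<open>Sn\<close> is \<open>x_N\<close>, v is the valuation
  of \<open>varpi\<close> modulo 2, and D is the odd part of \<open>varpi\<close> minus 1 modulo
  4.\<close>

definition S :: "(nat \<Rightarrow> int) \<Rightarrow> int" where "S g = (\<Sum>n\<in>divs N. r n * g n)"
definition s where "s = S (\<lambda>_. 1)"
definition Sm where "Sm = S (\<lambda>n. int (N div n))"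
definition Sn where "Sn = S int"
definition v where "v = S (\<lambda>n. int (multiplicity 2 (N div n)))"
definition D where "D = S (\<lambda>n. int (odp (N div n)) - 1)"
definition U where "U = int a * x - int N * b"
definition W where "W = b * y - int d * z"
definition QA where "QA n = \<lfloor>Psi (U, - (z * int n), int (N div n) * int d, y)\<rfloor>"
definition QB where "QB n = \<lfloor>Psi (int a * y, W * int n, int (N div n), x)\<rfloor>"
definition T where "T = S (\<lambda>n. QA n - QB n)"
definition lam where "lam = int (a * d) - 1"
abbreviation H where "H \<equiv> hsq y - hsq x - hsq (int a)"
abbreviation be where "be \<equiv> int (multiplicity 2 d)"
abbreviation dd where "dd \<equiv> int (odp d)"
abbreviation M where "M n \<equiv> int (N div n)"

section \<open>Summation over the divisors of N and the value of T modulo 3 and 8\<close>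

lemma finite_divs: "finite (divs N)"
  using N0 by (simp add: divs_def)

lemma S_add: "S (\<lambda>n. g n + h n) = S g + S h" by (simp add: S_def sum.distrib distrib_left)
lemma S_diff: "S (\<lambda>n. g n - h n) = S g - S h" by (simp add: S_def sum_subtractf right_diff_distrib)
lemma S_cmult: "S (\<lambda>n. c * g n) = c * S g" by (simp add: S_def sum_distrib_left mult.left_commute)
lemma S_multc: "S (\<lambda>n. g n * c) = S g * c" by (simp add: S_def sum_distrib_right mult.assoc)
lemma S_const: "S (\<lambda>n. c) = c * s" using S_cmult[of c "\<lambda>_. 1"] by (simp add: s_def)
lemma S_cong: "(\<And>n. n \<in> divs N \<Longrightarrow> [g n = h n] (mod q)) \<Longrightarrow> [S g = S h] (mod q)"
  unfolding S_def by (intro cong_sum cong_mult cong_refl) auto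
lemma S_dvd: "(\<And>n. n \<in> divs N \<Longrightarrow> q dvd g n) \<Longrightarrow> q dvd S g"
  unfolding S_def by (intro dvd_sum dvd_mult) auto
lemma S_eq: "(\<And>n. n \<in> divs N \<Longrightarrow> g n = h n) \<Longrightarrow> S g = S h"
  unfolding S_def by (intro sum.cong refl) auto

lemma s_eq: "s = (\<Sum>n\<in>divs N. r n)" by (simp add: s_def S_def)
lemma Sn_eq: "Sn = x_N N r" by (simp add: Sn_def S_def x_N_def mult.commute)
lemma Sm_eq: "Sm = (\<Sum>n\<in>divs N. M n * r n)" by (simp add: Sm_def S_def mult.commute)

lemma lam_Sm: "24 dvd lam * Sm" using hSm by (simp add: lam_def Sm_eq)
lemma lam_Sn: "24 dvd lam * Sn" using hSn by (simp add: lam_def Sn_eq)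

lemma divsD:
  assumes "n \<in> divs N"
  shows "n > 0" "N div n > 0" "(N div n) * n = N" "M n * int n = int N"
proof -
  have "n dvd N" using assms by (simp add: divs_def)
  then show 1: "(N div n) * n = N" by simp
  show "n > 0" "N div n > 0" using 1 N0 by (metis gr0I mult_0_right, metis gr0I mult_0)
  show "M n * int n = int N" by (metis 1 of_nat_mult)
qed

lemma pair:
  assumes "n \<in> divs N" shows "hecke_pair (int a) b x y z d (N div n) n"
proof
  show "d > 0" "N div n > 0" using d0 divsD[OF assms] by auto
  show "(int a * x - M n * int n * b) * y + M n * int n * int d * z = 1"
    unfolding divsD(4)[OF assms] using det by (simp add: algebra_simps)
qed

lemma axy: "int a * x * y = 1 + int N * W"
  using det by (simp add: W_def algebra_simps)

lemma Uy: "U * y + int N * int d * z = 1"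
  using det by (simp add: U_def algebra_simps)

lemma pair_defs:
  assumes n: "n \<in> divs N"
  shows "hecke_pair.PA (int a) b x y z d (N div n) n = QA n"
    and "hecke_pair.PB (int a) b x y z d (N div n) n = QB n"
    and "hecke_pair.u (int a) b x (N div n) n = U"
    and "hecke_pair.w b y z d = W"
proof -
  interpret p: hecke_pair "int a" b x y z d "N div n" n by (rule pair[OF n])
  show u: "p.u = U" unfolding p.u_def U_def divsD(4)[OF n] ..
  show w: "p.w = W" unfolding p.w_def W_def ..
  show "p.PA = QA n" "p.PB = QB n" unfolding p.PA_def p.PB_def QA_def QB_def u w by auto
qed

lemma Psi_QA: "n \<in> divs N \<Longrightarrow> Psi (U, - (z * int n), M n * int d, y) = of_int (QA n)"
  using hecke_pair.PA_eq[OF pair] by (simp add: pair_defs)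

lemma Psi_QB: "n \<in> divs N \<Longrightarrow> Psi (int a * y, W * int n, M n, x) = of_int (QB n)"
  using hecke_pair.PB_eq[OF pair] by (simp add: pair_defs)

text \<open>If 3 | l - 1, the formula for each divisor collapses by \<open>cong3_one\<close>.
  Otherwise 3 divides both \<open>Sm\<close> and \<open>Sn\<close>, and both sides are 0.\<close>

lemma T_cong3: "[T = - (b * int d * Sn)] (mod 3)"
proof -
  define X where "X = (U + y) * int d - int a * y - x + z * y * int N * (int d)^2 + W * x * int N"
  define Y where "Y = - z * y - W * x"
  have "[QA n - QB n = M n * X + int n * Y] (mod 3)" if n: "n \<in> divs N" for n
    using hecke_pair.cong3[OF pair[OF n]] unfolding pair_defs[OF n] divsD(4)[OF n] X_def Y_def .
  then have "[T = S (\<lambda>n. M n * X + int n * Y)] (mod 3)"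
    unfolding T_def by (rule S_cong)
  also have "S (\<lambda>n. M n * X + int n * Y) = Sm * X + Sn * Y"
    unfolding S_add S_multc Sm_def Sn_def ..
  finally have 1: "[T = Sm * X + Sn * Y] (mod 3)" .
  show ?thesis
  proof (cases "3 dvd lam")
    case True
    then have c: "[int a * int d = 1] (mod 3)" by (simp add: lam_def cong_iff_dvd_diff)
    have "3 dvd M n * X + int n * Y + b * int d * int n" if n: "n \<in> divs N" for n
      using hecke_pair.cong3_one[OF pair[OF n] c] unfolding pair_defs[OF n] divsD(4)[OF n] X_def Y_def .
    then have "3 dvd S (\<lambda>n. M n * X + int n * Y + b * int d * int n)" by (rule S_dvd)
    then have "3 dvd Sm * X + Sn * Y + b * int d * Sn"
      unfolding S_add S_multc S_cmult Sm_def Sn_def .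
    then have "[Sm * X + Sn * Y = - (b * int d * Sn)] (mod 3)" by (simp add: cong_iff_dvd_diff)
    with 1 show ?thesis by (rule cong_trans)
  next
    case False
    have "3 dvd lam * Sm" "3 dvd lam * Sn" using lam_Sm lam_Sn by (auto intro: dvd_trans[of 3 24])
    then have d: "3 dvd Sm" "3 dvd Sn" using False prime_dvd_mult_iff[of "3::int"] by auto
    then have "[Sm * X + Sn * Y = - (b * int d * Sn)] (mod 3)" by (simp add: cong_iff_dvd_diff)
    with 1 show ?thesis by (rule cong_trans)
  qed
qed

lemma D_even: "even D"
  unfolding D_def by (rule S_dvd) (use odp(2) divsD(2) in auto)

lemma mult2_N: "n \<in> divs N \<Longrightarrow> multiplicity 2 (N div n) + multiplicity 2 n = multiplicity 2 N"
  using multiplicity_2_mult[of "N div n" n] divsD[of n] by simp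

lemma parity_div:
  assumes "n \<in> divs N" shows "even (N div n) \<longleftrightarrow> multiplicity 2 (N div n) > 0" "even n \<longleftrightarrow> multiplicity 2 n > 0"
  using even_iff_multiplicity[of "N div n"] even_iff_multiplicity[of n] divsD[OF assms] by auto

text \<open>True divisor by divisor: if N is 2 modulo 4, exactly one of n and N/n is even. Together
  with \<open>rel4\<close> this supplies the relations among the linear forms that
  \<open>core_scalar\<close> assumes.\<close>

lemma rel2:
  assumes "int N = 2 * N'" "odd N'"
  shows "even (v - Sn) \<and> [D = Sm + N' * Sn + s] (mod 4)"
proof -
  define N1 where "N1 = nat N'"
  have N1: "N = 2 * N1" "odd N1" "N' = int N1" using assms N0 by (auto simp: N1_def even_nat_iff)
  have mN: "multiplicity 2 N = 1" using mult2_pow[OF N1(2), of 1] N1 by simp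
  have "even (int (multiplicity 2 (N div n)) - int n) \<and> [int (odp (N div n)) - 1 = M n + N' * int n + 1] (mod 4)"
    if n: "n \<in> divs N" for n
  proof -
    have sum1: "multiplicity 2 (N div n) + multiplicity 2 n = 1" using mult2_N[OF n] mN by simp
    show ?thesis
    proof (cases "multiplicity 2 (N div n) = 0")
      case True
      then have "odd (N div n)" "even n" using parity_div[OF n] sum1 by auto
      moreover have "int n = 2 * int (odp n)" "odd (odp n)"
        using odp[of n] divsD(1)[OF n] sum1 True by (metis add_0 of_nat_mult of_nat_numeral power_one_right, simp)
      moreover have "odp (N div n) = N div n" using odp_odd \<open>odd (N div n)\<close> by blast
      moreover have "\<exists>k. N' * (2 * int (odp n)) = 4 * k + 2"
      proof -
        have "odd (N' * int (odp n))" using assms(2) \<open>odd (odp n)\<close> by simp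
        then obtain k where "N' * int (odp n) = 2 * k + 1" by (meson oddE)
        then have "N' * (2 * int (odp n)) = 4 * k + 2" by simp
        then show ?thesis ..
      qed
      then obtain k where "N' * (2 * int (odp n)) = 4 * k + 2" ..
      ultimately show ?thesis using True by (auto intro!: congI_int[of _ _ _ "- k - 1"])
    next
      case False
      then have m1: "multiplicity 2 (N div n) = 1" "multiplicity 2 n = 0" using sum1 by auto
      then have on: "odd n" using parity_div[OF n] by auto
      let ?o = "int (odp (N div n))"
      have m: "M n = 2 * ?o" "odd (odp (N div n))"
        using odp[of "N div n"] divsD(2)[OF n] m1 by (metis of_nat_mult of_nat_numeral power_one_right, simp)
      have "2 * N' = 2 * (?o * int n)" using divsD(4)[OF n] m(1) assms(1) by simp
      then have N'o: "N' = ?o * int n" by simp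
      obtain t where t: "(int n)^2 = 1 + 8 * t"
        by (rule odd_nat_squareE) (use on in auto)
      have "N' * int n = ?o * (int n)^2" unfolding N'o by (simp add: power2_eq_square)
      then have N'n: "N' * int n = ?o + 8 * (t * ?o)" unfolding t by (simp add: algebra_simps)
      obtain q where "?o = 2 * q + 1" using m(2) by (metis even_of_nat_iff oddE)
      then have "[?o - 1 = M n + N' * int n + 1] (mod 4)" unfolding m(1) N'n
        by (intro congI_int[of _ _ _ "- q - 1 - 2 * (t * ?o)"]) simp
      then show ?thesis using m1 on by simp
    qed
  qed
  then have e: "even (int (multiplicity 2 (N div n)) - int n)" and c: "[int (odp (N div n)) - 1 = M n + N' * int n + 1] (mod 4)"
    if "n \<in> divs N" for n using that by auto
  have "even (S (\<lambda>n. int (multiplicity 2 (N div n)) - int n))" using e by (rule S_dvd)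
  moreover have "[D = S (\<lambda>n. M n + N' * int n + 1)] (mod 4)" unfolding D_def using c by (rule S_cong)
  ultimately show ?thesis unfolding S_add S_diff S_cmult v_def Sn_def Sm_def s_def by blast
qed

text \<open>With v_2(N) = 2 the pair (v_2(N/n), v_2(n)) is (0,2), (1,1) or (2,0), and each gives an
  even summand.\<close>

lemma rel4:
  assumes "int N = 4 * N'" "odd N'"
  shows "even (v + s + Sm + Sn)"
proof -
  define N1 where "N1 = nat N'"
  have N1: "N = 4 * N1" "odd N1" "N' = int N1" using assms N0 by (auto simp: N1_def even_nat_iff)
  have mN: "multiplicity 2 N = 2" using mult2_pow[OF N1(2), of 2] N1 by simp
  have "even (int (multiplicity 2 (N div n)) + 1 + M n + int n)" if n: "n \<in> divs N" for n
  proof -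
    have "multiplicity 2 (N div n) + multiplicity 2 n = 2" using mult2_N[OF n] mN by simp
    then consider "multiplicity 2 (N div n) = 0" "multiplicity 2 n = 2" | "multiplicity 2 (N div n) = 1" "multiplicity 2 n = 1"
      | "multiplicity 2 (N div n) = 2" "multiplicity 2 n = 0" by linarith
    then show ?thesis using parity_div[OF n] by cases auto
  qed
  then have "even (S (\<lambda>n. int (multiplicity 2 (N div n)) + 1 + M n + int n))" by (rule S_dvd)
  then show ?thesis unfolding S_add v_def Sn_def Sm_def s_def .
qed

definition sy where "sy = S (\<lambda>n. 2 - 2 * kronecker (int a) (M n)) + s * (2 - 2 * kronecker y (dd))"

lemma coprime_a: "coprime (int a) (int N)"
proof (rule coprimeI)
  fix e assume e: "e dvd int a" "e dvd int N"
  then have "e dvd int a * x * y" "e dvd int N * W" by simp_all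
  then show "is_unit e" unfolding axy by (metis dvd_add_left_iff)
qed

lemma sy_cong: "[sy = (2 - 2 * kronecker (int a) (int (varpi N r))) + s * (2 - 2 * kronecker y (dd))] (mod 8)"
  unfolding sy_def varpi_def S_def
proof (rule cong_add[OF cong_sym cong_refl], rule sign_cong_kronecker_prod[OF finite_divs])
  fix n assume n: "n \<in> divs N"
  have "(N div n) dvd N" using divsD(3)[OF n] by (metis dvd_triv_left)
  then have "coprime (int a) (M n)" using coprime_a by (meson coprime_divisors dvd_refl of_nat_dvd_iff)
  then show "N div n > 0 \<and> coprime (int a) (M n)" using divsD(2)[OF n] by simp
qed

lemma T_even:
  assumes "even N"
  shows "[T = sy + (Sn * (- z * y - W * x) + Sm * (x - int d * y)
    + s * (x - y + be * hsq y + (dd - 1) * (y - 1))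
    + v * H + D * (y - x))] (mod 8)"
proof -
  let ?C = "x - y + be * hsq y + (dd - 1) * (y - 1)"
  let ?g = "\<lambda>n. ((2 - 2 * kronecker (int a) (M n)) + (2 - 2 * kronecker y (dd))) +
     (int n * (- z * y - W * x) + M n * (x - int d * y) + ?C
       + int (multiplicity 2 (N div n)) * H + (int (odp (N div n)) - 1) * (y - x))"
  have "[QA n - QB n = ?g n] (mod 8)" if n: "n \<in> divs N" for n
    using hecke_pair.cong8_even[OF pair[OF n]] assms unfolding pair_defs[OF n] divsD(3)[OF n] by blast
  then have "[T = S ?g] (mod 8)" unfolding T_def by (rule S_cong)
  also have "S ?g = sy + (Sn * (- z * y - W * x) + Sm * (x - int d * y) + s * ?C
    + v * H + D * (y - x))"
    unfolding S_add S_multc S_const sy_def Sn_def Sm_def v_def D_def by (simp only: mult.commute distrib_right add_ac) (simp add: algebra_simps)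
  finally show ?thesis .
qed

lemma odd_square_lam:
  assumes "odd s" "odd (a * d)" shows "8 dvd lam"
proof -
  obtain t where t: "a * d = t ^ 2" using hsquare assms(1) by (auto simp: s_eq)
  then have "odd (int t)" using assms(2) by simp
  then show ?thesis using odd_square_cong_1[of "int t"] unfolding lam_def t by (simp add: cong_iff_dvd_diff)
qed

text \<open>As a^2 = 1 modulo 8, d = a * (ad) modulo 8, that is, a + a (l - 1).\<close>

lemma d_expand:
  assumes "odd a" obtains k where "int d = int a + int a * lam - 8 * k"
proof -
  obtain ta where ta: "(int a)^2 = 1 + 8 * ta"
    by (rule odd_nat_squareE) (use assms in auto)
  have "int a * lam = (int a)^2 * int d - int a" by (simp add: lam_def power2_eq_square algebra_simps)
  then have "int d = int a + int a * lam - 8 * (ta * int d)" unfolding ta by (simp add: algebra_simps)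
  then show ?thesis using that by blast
qed

lemma core:
  assumes "even N"
  shows "8 dvd (int a * y - x) * (W * Sn - Sm) + s * (x - y + (int a - 1) * (y + 2)) + v * H
           + D * (y - x + 3 * (int a - 1))"
  by (rule core_scalar[OF axy]) (use assms D_even rel2 rel4 in auto)

lemma oddness:
  assumes "even N" shows "odd a" "odd x" "odd y"
proof -
  have "odd (int a * x * y)" unfolding axy using assms by auto
  then show "odd a" "odd x" "odd y" by auto
qed

text \<open>After \<open>core\<close> is removed every term carries l - 1. Those with
  \<open>Sm\<close> and \<open>Sn\<close> vanish by the hypotheses on l; those with s or D are
  products of three even factors, or, for odd s, contain l - 1 for an odd square l. The right side
  has the shape of \<psi>, with s + D in place of 2k + 2 \<delta>.\<close>

lemma T_odd_l_even_N:
  assumes N: "even N" and l: "odd (a * d)"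
  shows "[T = sy - b * int d * Sn - 3 * (s + D) * (int d - 1) + 3 * (s + D) * lam * (int N - 1)] (mod 8)" (is "[T = ?V] (mod 8)")
proof -
  note o = oddness[OF N]
  have od: "odd d" using l by simp
  have odd_d: "odp d = d" "multiplicity 2 d = 0" using odp_odd[OF od] by auto
  obtain td where td: "(int d)^2 = 1 + 8 * td"
    by (rule odd_nat_squareE) (use od in auto)
  obtain ty where ty: "y^2 = 1 + 8 * ty" using o(3) by (rule odd_squareE)
  define e1 where "e1 = td * y * z - ty * b * int d"
  have "b * int d * y^2 = int d * y * W + (int d)^2 * y * z" by (simp add: W_def power2_eq_square algebra_simps)
  then have A: "b * int d - z * y - W * x = W * (int d * y - x) + 8 * e1"
    unfolding ty td e1_def by (simp add: algebra_simps)
  obtain k where k: "int d = int a + int a * lam - 8 * k" using d_expand[OF o(1)] .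
  let ?E = "Sn * (b * int d - z * y - W * x) + Sm * (x - int d * y) + s * (x - y + (int d - 1) * (y - 1) + 3 * (int d - 1) - 3 * lam * (int N - 1)) + v * H
     + D * (y - x + 3 * (int d - 1) - 3 * lam * (int N - 1))"
  have lam: "even lam" using l by (simp add: lam_def)
  have l8: "8 dvd lam * Sn" "8 dvd lam * Sm" using lam_Sm lam_Sn by (auto intro: dvd_trans[of 8 24])
  have K1: "8 dvd s * lam * (int a * (y + 2) - 3 * (int N - 1))"
  proof (cases "even s")
    case True
    then show ?thesis using lam N o by (intro eight_dvd_mult) auto
  next
    case False
    then show ?thesis using odd_square_lam l by simp
  qed
  have K2: "8 dvd D * lam * (3 * int a - 3 * (int N - 1))"
    using D_even lam N o by (intro eight_dvd_mult) auto
  have "8 dvd ?E"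
    unfolding reduce_odd[OF A k, of Sn Sm s "int N" v H D]
    by (rule dvd_add[OF dvd_add[OF dvd_add[OF dvd_diff[OF dvd_add[OF core[OF N] dvd_mult[OF l8(1)]] dvd_mult[OF l8(2)]] K1] K2] dvd_triv_left])
  moreover obtain q where "T = sy + (Sn * (- z * y - W * x) + Sm * (x - int d * y)
    + s * (x - y + (int d - 1) * (y - 1)) + v * H + D * (y - x)) + 8 * q"
    using T_even[OF N] unfolding odd_d by (auto elim: congE_int)
  then have "T - ?V = ?E + 8 * q"
    by (simp add: algebra_simps)
  ultimately show ?thesis unfolding cong_iff_dvd_diff by simp
qed

lemma odd_N_props:
  assumes "odd N" "n \<in> divs N"
  shows "odd (N div n)" "odd n" "odp (N div n) = N div n" "multiplicity 2 (N div n) = 0"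
proof -
  have "odd ((N div n) * n)" using assms(1) divsD(3)[OF assms(2)] by metis
  then show 1: "odd (N div n)" "odd n" by auto
  show "odp (N div n) = N div n" "multiplicity 2 (N div n) = 0" using odp_odd[OF 1(1)] by auto
qed

lemma odd_N_D: assumes "odd N" shows "D = Sm - s"
proof -
  have "D = S (\<lambda>n. M n - 1)" unfolding D_def by (rule S_eq) (simp add: odd_N_props[OF assms])
  then show ?thesis unfolding S_diff Sm_def s_def .
qed

text \<open>For odd m = N/n one has Nm = n m^2, which is n modulo 8.\<close>

lemma odd_N_Sn: assumes "odd N" shows "[Sn = int N * Sm] (mod 8)"
proof -
  have "[int n = int N * M n] (mod 8)" if n: "n \<in> divs N" for n
  proof -
    obtain t where t: "(M n)^2 = 1 + 8 * t"
      by (rule odd_nat_squareE) (use odd_N_props[OF assms n] in auto)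
    have "int N * M n = int n * (M n)^2"
      unfolding divsD(4)[OF n, symmetric] by (simp add: power2_eq_square)
    then show ?thesis unfolding t by (intro congI_int[of _ _ _ "- (int n * t)"]) (simp add: algebra_simps)
  qed
  then have "[Sn = S (\<lambda>n. int N * M n)] (mod 8)" unfolding Sn_def by (rule S_cong)
  then show ?thesis unfolding S_cmult Sm_def .
qed

lemma T_odd_odd:
  assumes N: "odd N" and d: "odd d"
  shows "[T = sy + Sm * ((U + y - 3) * int d - (int a * y + x - 3))] (mod 8)"
proof -
  let ?g = "\<lambda>n. ((2 - 2 * kronecker (int a) (M n)) + (2 - 2 * kronecker y (dd))) +
     M n * ((U + y - 3) * int d - (int a * y + x - 3))"
  have "[QA n - QB n = ?g n] (mod 8)" if n: "n \<in> divs N" for n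
    using hecke_pair.cong8_odd_odd[OF pair[OF n] odd_N_props(1)[OF N n] d] unfolding pair_defs[OF n] .
  then have "[T = S ?g] (mod 8)" unfolding T_def by (rule S_cong)
  also have "S ?g = sy + Sm * ((U + y - 3) * int d - (int a * y + x - 3))"
    unfolding S_add S_multc S_const sy_def Sm_def by (simp add: mult.commute)
  finally show ?thesis .
qed

text \<open>For odd N the forms D and \<open>Sn\<close> reduce to \<open>Sm\<close> and s, so the
  whole difference is a multiple of (l - 1) \<open>Sm\<close> modulo 8.\<close>

lemma T_odd_l_odd_N:
  assumes N: "odd N" and l: "odd (a * d)"
  shows "[T = sy - b * int d * Sn - 3 * (s + D) * (int d - 1) + 3 * (s + D) * lam * (int N - 1)] (mod 8)" (is "[T = ?V] (mod 8)")
proof -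
  have od: "odd d" "odd a" using l by auto
  obtain k where k: "int d = int a + int a * lam - 8 * k" using d_expand[OF od(2)] .
  obtain q where q: "Sn = int N * Sm + 8 * q" using odd_N_Sn[OF N] by (rule congE_int)
  obtain p where p: "T = sy + Sm * ((U + y - 3) * int d - (int a * y + x - 3)) + 8 * p"
    using T_odd_odd[OF N od(1)] by (rule congE_int)
  have sD: "s + D = Sm" using odd_N_D[OF N] by simp
  have Ud: "U * int d = x * (lam + 1) - int N * b * int d" by (simp add: U_def lam_def algebra_simps)
  have ya: "y * (int d - int a) = int a * y * lam - 8 * (k * y)" unfolding k by (simp add: algebra_simps)
  have "T - ?V
    = Sm * (U * int d + y * (int d - int a) - x - 3 * lam * (int N - 1) + b * int d * int N) + 8 * (p + b * int d * q)"
    unfolding p sD q by (simp add: algebra_simps)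
  also have "\<dots> = (lam * Sm) * (x + int a * y - 3 * (int N - 1)) + 8 * (p + b * int d * q - k * y * Sm)"
    unfolding Ud ya by (simp add: algebra_simps)
  finally show ?thesis
    using lam_Sm unfolding cong_iff_dvd_diff by (auto intro: dvd_trans[of 8 24])
qed

text \<open>For even l the factor l - 1 is odd and can be cancelled from the divisibility by
  8.\<close>

lemma Sm_even_l:
  assumes "even (a * d)" shows "8 dvd Sm" "8 dvd Sn"
proof -
  have o: "odd lam" using assms by (simp add: lam_def)
  then have "coprime lam 2" by simp
  then have "coprime lam (2 ^ 3)" by (simp only: coprime_power_right_iff) simp
  then have c: "coprime 8 lam" by (simp add: coprime_commute)
  have "8 dvd lam * Sn" "8 dvd lam * Sm" using lam_Sm lam_Sn by (auto intro: dvd_trans[of 8 24])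
  then show "8 dvd Sm" "8 dvd Sn" using c by (simp_all add: coprime_dvd_mult_right_iff)
qed

lemma even_s_odd_N:
  assumes "odd N" "even (a * d)" shows "even s"
proof -
  have "even D" by (rule D_even)
  moreover have "even Sm" using Sm_even_l[OF assms(2)] by (auto intro: dvd_trans[of 2 8])
  ultimately show ?thesis using odd_N_D[OF assms(1)] by simp
qed

text \<open>Now 8 divides \<open>Sm\<close> and \<open>Sn\<close>. For even d the other terms carry
  s, which is even, next to 2 (1 - y) or \<open>hsq y\<close>, both divisible by 4 because y is odd.
  Only the signs survive.\<close>

lemma T_even_l_odd_N:
  assumes N: "odd N" and l: "even (a * d)"
  shows "[T = sy] (mod 8)"
proof (cases "odd d")
  case True
  have "8 dvd Sm * ((U + y - 3) * int d - (int a * y + x - 3))" using Sm_even_l[OF l] by simp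
  with T_odd_odd[OF N True] show ?thesis unfolding cong_iff_dvd_diff
    by (metis diff_diff_eq dvd_diff_commute dvd_diffD diff_add_cancel add_diff_eq dvd_add_right_iff)
next
  case False
  then have ed: "even d" by simp
  have "odd (U * y)" using Uy ed by (metis dvd_add_left_iff dvd_mult dvd_mult2 even_add even_of_nat_iff odd_one)
  then have oy: "odd y" by simp
  let ?g = "\<lambda>n. ((2 - 2 * kronecker (int a) (M n)) + (2 - 2 * kronecker y (dd))) +
     (1 - y - z * int n * y - M n * int d * y + be * hsq y + (M n * dd - 1) * (y - 1)
       - (int a * y + x - 3) * M n)"
  have "[QA n - QB n = ?g n] (mod 8)" if n: "n \<in> divs N" for n
    using hecke_pair.cong8_odd_even[OF pair[OF n] odd_N_props(1)[OF N n] ed] unfolding pair_defs[OF n] .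
  then have T: "[T = S ?g] (mod 8)" unfolding T_def by (rule S_cong)
  let ?X = "- int d * y + dd * (y - 1) - (int a * y + x - 3)"
  have "S ?g = S (\<lambda>n. ((2 - 2 * kronecker (int a) (M n)) + (2 - 2 * kronecker y (dd))) +
     ((2 * (1 - y) + be * hsq y) + int n * (- z * y) + M n * ?X))"
    by (rule S_eq) (simp add: algebra_simps)
  also have "\<dots> = sy + (s * (2 * (1 - y)) + be * (s * hsq y) + Sn * (- z * y) + Sm * ?X)"
    unfolding S_add S_multc S_const sy_def Sm_def Sn_def by (simp add: algebra_simps)
  finally have e: "S ?g = sy + (s * (2 * (1 - y)) + be * (s * hsq y) + Sn * (- z * y) + Sm * ?X)" .
  have es: "even s" by (rule even_s_odd_N[OF N l])
  have "8 dvd s * (2 * (1 - y))" using eight_dvd_mult[of s 2 "1 - y"] es oy by (simp add: mult.assoc)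
  moreover have "8 dvd s * hsq y" using es hsq_four[OF oy] by (elim evenE dvdE) simp
  ultimately have "8 dvd s * (2 * (1 - y)) + be * (s * hsq y) + Sn * (- z * y) + Sm * ?X"
    using Sm_even_l[OF l] by (intro dvd_add[OF dvd_add[OF dvd_add[OF _ dvd_mult] dvd_mult2] dvd_mult2])
  then have "[S ?g = sy] (mod 8)" unfolding e cong_iff_dvd_diff by simp
  with T show ?thesis by (rule cong_trans)
qed

text \<open>ad is a square and a is odd, so v_2(d) is even, and a times the odd part of d is an odd
  square, hence 1 modulo 8.\<close>

lemma square_parts:
  assumes "odd s" "odd a" shows "even (multiplicity 2 d)" "4 dvd dd - int a"
proof -
  obtain t where t: "a * d = t ^ 2" using hsquare assms(1) by (auto simp: s_eq)
  have t0: "t > 0" using t a0 d0 by (metis gr0I mult_is_0 zero_power2 less_irrefl)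
  have "multiplicity 2 (a * d) = 2 * multiplicity 2 t" unfolding t by (rule multiplicity_2_power[OF t0])
  then have "multiplicity 2 d = 2 * multiplicity 2 t"
    using multiplicity_2_mult[OF a0 d0] odp_odd[OF assms(2)] by simp
  then show "even (multiplicity 2 d)" by simp
  have "a * odp d = odp t ^ 2" using odp_mult[OF a0 d0] odp_odd[OF assms(2)] odp_power[OF t0, of 2] t by simp
  then have 1: "int a * dd = (int (odp t))^2" by (metis of_nat_mult of_nat_power)
  obtain p where p: "(int (odp t))^2 = 1 + 8 * p"
    by (rule odd_nat_squareE) (use odp(2)[OF t0] in auto)
  obtain q where q: "(int a)^2 = 1 + 8 * q"
    by (rule odd_nat_squareE) (use assms(2) in auto)
  have "(int a)^2 * dd = int a * (int a * dd)" by (simp add: power2_eq_square)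
  then have "dd - int a = 4 * (2 * (int a * p - q * dd))" unfolding 1 p q by (simp add: algebra_simps)
  then show "4 dvd dd - int a" by (metis dvd_triv_left)
qed

lemma T_even_l_even_N:
  assumes N: "even N" and l: "even (a * d)"
    and dl: "\<delta> = 0 \<or> \<delta> = 1" "4 dvd N \<Longrightarrow> odd s \<Longrightarrow> odd v \<Longrightarrow> \<delta> = 1"
  shows "[T = sy - b * int d * Sn - 3 * (s + D) * (int a - 1) - 3 * int N * (s + D) * (1 + \<delta>) * b] (mod 8)"
proof -
  note o = oddness[OF N]
  let ?h = "be * hsq y + (dd - int a) * (y - 1)"
  obtain p q where pq: "Sm = 8 * p" "Sn = 8 * q" using Sm_even_l[OF l] by (metis dvdE)
  have K3: "8 dvd s * ?h"
  proof (cases "even s")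
    case True
    have "odd (dd)" using odp(2)[OF d0] by simp
    then have "4 dvd (dd - int a) * (y - 1)" using o by (intro four_dvd_mult) auto
    moreover have "4 dvd be * hsq y" using hsq_four[OF o(3)] by simp
    ultimately have "4 dvd ?h" by simp
    with True show ?thesis by (elim evenE dvdE) simp
  next
    case False
    have "8 dvd be * hsq y"
      using square_parts(1)[OF False o(1)] hsq_four[OF o(3)] by (elim evenE dvdE) simp
    moreover have "even (y - 1)" using o by simp
    then have "8 dvd (dd - int a) * (y - 1)"
      using square_parts(2)[OF False o(1)] by (elim evenE dvdE) simp
    ultimately show ?thesis by simp
  qed
  \<comment> \<open>The factors 2 are collected according to v_2(N): if N is 2 modulo 4,
    \<open>rel2\<close> gives 4 | s + D; if N is 4 modulo 8, either s + D is even, or s and v are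
    odd and \<delta> = 1.\<close>
  have K4: "8 dvd 3 * int N * (s + D) * (1 + \<delta>) * b"
  proof -
    obtain N' where N': "int N = 2 * N'" using N by (metis even_of_nat_iff evenE)
    show ?thesis
    proof (cases "even N'")
      case False
      then have "[D = Sm + N' * Sn + s] (mod 4)" using rel2[OF N'] by simp
      then obtain e where "D = Sm + N' * Sn + s + 4 * e" by (rule congE_int)
      then have sD: "s + D = 2 * s + 4 * (2 * p + 2 * N' * q + e)" unfolding pq by simp
      have "even D" by (rule D_even)
      then have "even s" using \<open>D = Sm + N' * Sn + s + 4 * e\<close> unfolding pq by simp
      then have "4 dvd s + D" unfolding sD by (elim evenE) simp
      then show ?thesis unfolding N' by (elim dvdE) simp
    next
      case True
      then obtain N2 where N2: "N' = 2 * N2" by blast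
      show ?thesis
      proof (cases "even N2")
        case True
        then show ?thesis unfolding N' N2 by (elim evenE) simp
      next
        case oN2: False
        have "even (v + s + Sm + Sn)" using rel4[of N2] oN2 N' N2 by simp
        then have "even (v + s)" unfolding pq by simp
        have "4 dvd int N" unfolding N' N2 by simp
        then have "4 dvd N" by presburger
        then have "odd s \<Longrightarrow> \<delta> = 1" using dl(2) \<open>even (v + s)\<close> by auto
        then have "even ((s + D) * (1 + \<delta>))" using D_even by auto
        then have "8 dvd 3 * (4 * N2) * ((s + D) * (1 + \<delta>)) * b" by (elim evenE) simp
        then show ?thesis unfolding N' N2 by (simp add: mult_ac)
      qed
    qed
  qed
  obtain c where c: "(int a * y - x) * (W * Sn - Sm) + s * (x - y + (int a - 1) * (y + 2)) + v * H
           + D * (y - x + 3 * (int a - 1)) = 8 * c" using core[OF N] by blast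
  obtain t where t: "T = sy + (Sn * (- z * y - W * x) + Sm * (x - int d * y)
    + s * (x - y + be * hsq y + (dd - 1) * (y - 1)) + v * H + D * (y - x)) + 8 * t"
    using T_even[OF N] by (rule congE_int)
  have "T - (sy - b * int d * Sn - 3 * (s + D) * (int a - 1) - 3 * int N * (s + D) * (1 + \<delta>) * b)
    = ((int a * y - x) * (W * Sn - Sm) + s * (x - y + (int a - 1) * (y + 2)) + v * H + D * (y - x + 3 * (int a - 1)))
     + s * ?h + 3 * int N * (s + D) * (1 + \<delta>) * b
     + Sn * (b * int d - z * y - W * x - (int a * y - x) * W) + Sm * (x - int d * y + (int a * y - x)) + 8 * t"
    unfolding t by (simp add: algebra_simps)
  also have "8 dvd \<dots>" unfolding c
    by (intro dvd_add K3 K4 dvd_triv_left) (simp_all add: pq)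
  finally show ?thesis unfolding cong_iff_dvd_diff .
qed

end

section \<open>Exponentials and roots of unity of order 24\<close>

lemma e_add: "e (x + y) = e x * e y"
  by (simp add: e_def distrib_left exp_add)

lemma e_minus: "e (- x) = inverse (e x)"
  by (simp add: e_def exp_minus)

lemma e_0 [simp]: "e 0 = 1" by (simp add: e_def)

lemma e_nonzero [simp]: "e x \<noteq> 0" by (simp add: e_def)

lemma e_of_int [simp]: "e (of_int i) = 1"
proof -
  have "2 * of_real pi * \<i> * of_int i = (of_int (2 * i) * pi) * \<i>" by simp
  then show ?thesis unfolding e_def by (metis exp_integer_2pi Ints_of_int mult.commute mult.left_commute
      of_int_mult of_int_numeral of_real_mult of_real_of_int_eq of_real_numeral)
qed

lemma e_half: "e (1 / 2) = -1"
  by (simp add: e_def exp_pi_i')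

definition e24 :: "int \<Rightarrow> complex" where "e24 i = e (of_real (of_int i / 24))"

lemma e24_add: "e24 (i + j) = e24 i * e24 j"
  by (simp add: e24_def add_divide_distrib e_add)

lemma e24_cong:
  assumes "[i = j] (mod 24)" shows "e24 i = e24 j"
proof -
  obtain t where "i = j + 24 * t" using assms by (rule congE_int)
  moreover have "e24 (24 * t) = 1" using e_of_int[of t] by (simp add: e24_def)
  ultimately show ?thesis by (simp add: e24_add)
qed

lemma e24_sign: "s = 1 \<or> s = -1 \<Longrightarrow> e24 (3 * (2 - 2 * s)) = of_int s"
  using e_half by (auto simp: e24_def)

text \<open>\<open>psi_lr\<close> with an integer in place of the natural number b, matching the
  integer b of \<open>eta_hecke\<close>.\<close>

definition psiZ :: "nat \<Rightarrow> (nat \<Rightarrow> int) \<Rightarrow> real \<Rightarrow> nat \<Rightarrow> nat \<Rightarrow> int \<Rightarrow> complex" where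
  "psiZ N r k l a b =
     (let d = l div a; \<delta> = delta0 N r; \<delta>\<^sub>1 = delta1 N r k l in
      if odd l then
        e (of_real (- (k + \<delta>) / 4 * (real d - 1) + (k + \<delta>) * (real l - 1) * (real N - 1) / 4))
      else if even N then
        e (of_real (- (k + \<delta>) / 4 * (real a - 1) - real N * (k + \<delta>) * (1 + \<delta>\<^sub>1) / 4 * of_int b))
      else 1)"

lemma psi_lr_eq: "psi_lr N r k l a b = psiZ N r k l a (int b)"
  by (simp only: psi_lr_def psiZ_def of_int_of_nat_eq)

context eta_hecke begin

lemma varpi0: "varpi N r > 0"
  unfolding varpi_def by (intro prod_pos) (use divsD in auto)

lemma varpi_odp: "[int (odp (varpi N r)) - 1 = D] (mod 4)"
  unfolding varpi_def D_def S_def by (rule odp_prod_cong[OF finite_divs divsD(2), THEN conjunct1])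

lemma varpi_mult: "even (int (multiplicity 2 (varpi N r)) - v)"
  unfolding varpi_def v_def S_def by (rule odp_prod_cong[OF finite_divs divsD(2), THEN conjunct2])

definition \<delta>i :: int where "\<delta>i = (if odp (varpi N r) mod 4 = 1 then 0 else 1)"

lemma delta0_eq: "delta0 N r = of_int \<delta>i"
proof -
  have "(\<exists>\<alpha> m::nat. varpi N r = 2 ^ \<alpha> * (4 * m + 1)) \<longleftrightarrow> odp (varpi N r) mod 4 = 1"
  proof
    assume "\<exists>\<alpha> m::nat. varpi N r = 2 ^ \<alpha> * (4 * m + 1)"
    then obtain \<alpha> m where am: "varpi N r = 2 ^ \<alpha> * (4 * m + 1)" by blast
    have "odp (2::nat) = 1" by (simp add: odp_def)
    moreover have "odd (4 * m + 1)" by simp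
    ultimately have "odp (varpi N r) = 4 * m + 1"
      unfolding am by (simp add: odp_mult odp_power odp_odd del: mult_Suc_right)
    then show "odp (varpi N r) mod 4 = 1" by (metis mod_mult_self4 mod_less one_less_numeral_iff semiring_norm(76))
  next
    assume "odp (varpi N r) mod 4 = 1"
    then have "odp (varpi N r) = 4 * (odp (varpi N r) div 4) + 1" by presburger
    then show "\<exists>\<alpha> m::nat. varpi N r = 2 ^ \<alpha> * (4 * m + 1)" using odp(1)[OF varpi0] by metis
  qed
  then show ?thesis by (simp add: delta0_def \<delta>i_def)
qed

text \<open>The odd part of \<open>varpi\<close> is 1 or 3 modulo 4, so its excess over 1 is 2
  \<delta>. This puts \<delta> among the linear forms in r.\<close>

lemma \<delta>i_cong: "[2 * \<delta>i = D] (mod 4)"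
proof -
  have "odd (odp (varpi N r))" by (rule odp(2)[OF varpi0])
  then have "[2 * \<delta>i = int (odp (varpi N r)) - 1] (mod 4)"
    using odd_nat_mod4[of "odp (varpi N r)"] unfolding \<delta>i_def
    by (auto simp: cong_iff_dvd_diff)
  then show ?thesis using varpi_odp by (rule cong_trans)
qed

text \<open>Ensures that the symbol raised to the power 2k is a sign, so that no power of zero
  arises.\<close>

lemma coprime_Nb_gcd: "coprime (- int N * b) (int (gcd a d))"
proof (rule coprimeI)
  fix c assume c: "c dvd - int N * b" "c dvd int (gcd a d)"
  then have ad: "c dvd int a" "c dvd int d" by (auto intro: dvd_trans)
  have "c dvd (- int N * b + int a * x) * y + int N * int d * z"
    by (rule dvd_add[OF dvd_mult2[OF dvd_add[OF c(1) dvd_mult2[OF ad(1)]]] dvd_mult2[OF dvd_mult[OF ad(2)]]])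
  then show "is_unit c" unfolding det .
qed

lemma kronecker_square: "q > 0 \<Longrightarrow> coprime t (int q) \<Longrightarrow> kronecker t (int (q ^ 2)) = 1"
  using kronecker_power_right[of q t 2] kronecker_unit[of q t] by (auto simp: power2_eq_square)

text \<open>For odd s the product ad is a square. With g = gcd(a, d) the cofactors a/g and d/g are
  coprime with square product, so d/g is a square and the symbol of y over the odd part of d is
  (y/g). Modulo g, U is -Nb and Uy is 1, whence (y/g) = (-Nb/g).\<close>

lemma kronecker_y_odp_d:
  assumes "odd s" "odd a"
  shows "kronecker y (int (odp d)) = kronecker (- int N * b) (int (gcd a d))"
proof -
  define g where "g = gcd a d"
  obtain a' d' where ad: "a = g * a'" "d = g * d'" "coprime a' d'" "g > 0"
    unfolding g_def using gcd_coprime_exists[of a d] a0 by (metis gcd_pos_nat mult.commute neq0_conv)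
  have pos: "a' > 0" "d' > 0" using ad a0 d0 by auto
  have og: "odd g" using assms(2) ad(1) by auto
  obtain t where t: "a * d = t ^ 2" using hsquare assms(1) by (auto simp: s_eq)
  have "g ^ 2 * (a' * d') = t ^ 2" using t ad by (simp add: power2_eq_square mult_ac)
  then have "g ^ 2 dvd t ^ 2" by (metis dvd_triv_left)
  then have "g dvd t" by simp
  then obtain q where "t = g * q" by blast
  then have "a' * d' = q ^ 2" using \<open>g ^ 2 * (a' * d') = t ^ 2\<close> ad(4) by (simp add: power_mult_distrib)
  then have "is_nth_power 2 (a' * d')" by simp
  then have "is_nth_power 2 d'"
    using is_nth_power_mult_coprime_natD(2)[of a' d' 2] ad(3) pos by simp
  then obtain p where p: "d' = p ^ 2" by (auto simp: is_nth_power_def)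
  have p0: "p > 0" using pos p by (auto intro: Nat.gr0I)
  have dd: "odp d = g * (odp p) ^ 2"
    using odp_mult[of g d'] ad(2,4) pos odp_odd[OF og] odp_power[OF p0, of 2] p by simp
  have yd: "coprime y (int d)"
  proof (rule coprimeI)
    fix c assume "c dvd y" "c dvd int d"
    then have "c dvd U * y + int N * int d * z" by simp
    then show "is_unit c" unfolding Uy .
  qed
  have "odp p dvd p" using odp(1)[OF p0] by (metis dvd_triv_right)
  then have "odp p dvd d" unfolding ad(2) p by (simp add: power2_eq_square)
  then have yp: "coprime y (int (odp p))" using yd by (meson coprime_divisors dvd_refl of_nat_dvd_iff)
  have "kronecker y (int (odp d)) = kronecker y (int g)"
    unfolding dd using kronecker_mult_right[of g "odp p ^ 2" y] ad(4) odp(3)[OF p0] kronecker_square[OF odp(3)[OF p0] yp] by simp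
  moreover have "kronecker y (int g) = kronecker (- int N * b) (int g)"
  proof -
    have "kronecker (- int N * b) (int g) = kronecker U (int g)"
    proof (rule kronecker_cong[OF ad(4) og])
      have "int a = int g * int a'" by (metis ad(1) of_nat_mult)
      then show "[- int N * b = U] (mod int g)"
        by (intro congI_int[of _ _ _ "- (int a' * x)"]) (simp add: U_def algebra_simps)
    qed
    moreover have "kronecker U (int g) * kronecker y (int g) = kronecker (U * y) (int g)"
      by (rule kronecker_mult_left[OF ad(4), symmetric])
    moreover have "kronecker (U * y) (int g) = kronecker 1 (int g)"
    proof (rule kronecker_cong[OF ad(4) og])
      have "U * y - 1 = int g * (- (int N * int d' * z))" using Uy ad(2) by (simp add: algebra_simps)
      then show "[U * y = 1] (mod int g)" by (rule congI_int)
    qed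
    moreover have "kronecker y (int g) = 1 \<or> kronecker y (int g) = -1"
      by (rule kronecker_unit[OF ad(4)]) (use yd ad(2) in auto)
    ultimately show ?thesis using ad(4) by auto
  qed
  ultimately show ?thesis by (simp add: g_def)
qed

text \<open>Passing from the entry -Nd to Nd reverses the sign of every \<Psi>; therefore the
  product of the two inverse values is governed by a difference of sums.\<close>

lemma chi_A: "chi_r N r (- int N * b + int a * x, z, - int N * int d, y) 1 = e24 (- S QA)"
proof -
  have "Psi (- int N * b + int a * x, z * int n, (- int N * int d) div int n, y) = - of_int (QA n)" if n: "n \<in> divs N" for n
  proof -
    have "- int N * int d = int n * (- (M n * int d))"
      unfolding divsD(4)[OF n, symmetric] by simp
    then have "(- int N * int d) div int n = - (M n * int d)"
      using divsD(1)[OF n] by (metis nonzero_mult_div_cancel_left of_nat_0_less_iff less_irrefl)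
    moreover have "M n * int d > 0" using divsD(2)[OF n] d0 by simp
    ultimately show ?thesis
      using Psi_neg_c[of "M n * int d" U "z * int n" y "- (z * int n)"] Psi_QA[OF n] by (simp add: U_def)
  qed
  then have eq: "(\<Sum>n\<in>divs N. of_int (r n) * Psi (- int N * b + int a * x, z * int n, (- int N * int d) div int n, y)) = of_int (- S QA)"
    unfolding S_def by (simp add: sum_negf)
  show ?thesis unfolding chi_r_def prod.case eq e24_def by simp
qed

lemma chi_B: "chi_r N r (int a * y, b * y - int d * z, int N, x) 1 = e24 (S QB)"
proof -
  have "Psi (int a * y, (b * y - int d * z) * int n, int N div int n, x) = of_int (QB n)" if n: "n \<in> divs N" for n
    using Psi_QB[OF n] by (simp add: W_def zdiv_int)
  then have eq: "(\<Sum>n\<in>divs N. of_int (r n) * Psi (int a * y, (b * y - int d * z) * int n, int N div int n, x)) = of_int (S QB)"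
    unfolding S_def by simp
  show ?thesis unfolding chi_r_def prod.case eq e24_def by simp
qed

lemma chi_AB: "inverse (chi_r N r (- int N * b + int a * x, z, - int N * int d, y) 1) *
    inverse (chi_r N r (int a * y, b * y - int d * z, int N, x) 1) = e24 T"
proof -
  have inv: "inverse (e24 i) = e24 (- i)" for i by (simp add: e24_def e_minus[symmetric])
  show ?thesis unfolding chi_A chi_B inv T_def S_diff by (simp add: e24_add[symmetric])
qed

lemma s_odd_a_odd: assumes "odd s" shows "odd a"
proof (rule ccontr)
  assume "\<not> odd a"
  then have ev: "even (a * d)" "\<not> even N" using oddness(1) by auto
  then show False using even_s_odd_N assms by blast
qed

definition \<delta>1i :: int where "\<delta>1i = (if even (a * d) \<and> 4 dvd N \<and> odd s \<and> odd (multiplicity 2 (varpi N r)) then 1 else 0)"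

lemma mult_even_cong: "[p = q] (mod 4) \<Longrightarrow> even t \<Longrightarrow> [3 * p * t = 3 * q * t] (mod 8)" for p q t :: int
proof -
  assume "[p = q] (mod 4)" "even t"
  then obtain i j where "p = q + 4 * i" "t = 2 * j" by (auto elim!: congE_int evenE)
  then show ?thesis by (intro congI_int[of _ _ _ "3 * i * j"]) (simp add: algebra_simps)
qed

theorem chi_product:
  assumes k: "k = kprime N r + 2 * of_int j"
  shows "inverse (chi_r N r (- int N * b + int a * x, z, - int N * int d, y) 1) *
    inverse (chi_r N r (int a * y, b * y - int d * z, int N, x) 1)
    = of_int (kronecker (int a) (int (varpi N r))) *
      of_int (kronecker (- int N * b) (int (gcd a d))) powr (of_real (2 * k)) *
      e (of_real (- (of_int b * of_nat d * of_int (x_N N r) / 24))) * psiZ N r k (a * d) a b"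
proof -
  define \<kappa> where "\<kappa> = s + 4 * j"
  have k2: "k = of_int \<kappa> / 2" unfolding k kprime_def \<kappa>_def s_eq by (simp add: add_divide_distrib)
  let ?K = "kronecker (int a) (int (varpi N r))" and ?\<sigma> = "kronecker (- int N * b) (int (gcd a d))"
  \<comment> \<open>The value of the symbol to the power 2k: the parity of 2k is that of s.\<close>
  define \<tau> where "\<tau> = (if even s then 1 else ?\<sigma>)"
  have coa: "coprime (int a) (int (varpi N r))"
  proof -
    have "coprime (int a) (int (N div n))" if n: "n \<in> divs N" for n
    proof -
      have "(N div n) dvd N" using divsD(3)[OF n] by (metis dvd_triv_left)
      then show ?thesis using coprime_a by (meson coprime_divisors dvd_refl of_nat_dvd_iff)
    qed
    then show ?thesis unfolding varpi_def by (auto simp: of_nat_prod intro!: prod_coprime_right)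
  qed
  have K: "?K = 1 \<or> ?K = -1" by (rule kronecker_unit[OF varpi0 coa])
  have g0: "gcd a d > 0" using a0 by simp
  have \<sigma>: "?\<sigma> = 1 \<or> ?\<sigma> = -1" by (rule kronecker_unit[OF g0 coprime_Nb_gcd])
  have \<tau>: "\<tau> = 1 \<or> \<tau> = -1" using \<sigma> by (auto simp: \<tau>_def)
  have pow: "of_int ?\<sigma> powr (of_real (2 * k)) = (of_int \<tau> :: complex)"
  proof (cases "?\<sigma> = 1")
    case False
    then have s1: "?\<sigma> = -1" using \<sigma> by blast
    \<comment> \<open>The principal logarithm of -1 is i times pi, and 2k is the integer
      \<kappa>.\<close>
    have "(-1 :: complex) powr (of_real (2 * k)) = exp (of_real (2 * k) * (\<i> * of_real pi))"
      by (simp add: powr_def)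
    also have "\<dots> = e (of_real (of_int \<kappa> / 2))" unfolding e_def k2 by (simp add: mult_ac)
    also have "\<dots> = (if even \<kappa> then 1 else -1)"
    proof (cases "even \<kappa>")
      case True
      then obtain i where "\<kappa> = 2 * i" by blast
      then show ?thesis using e_of_int[of i] True by simp
    next
      case False
      then obtain i where "\<kappa> = 2 * i + 1" by (meson oddE)
      moreover have "complex_of_real (of_int (2 * i + 1) / 2) = of_int i + 1 / 2" by (simp add: field_simps)
      ultimately show ?thesis using e_of_int[of i] e_half False by (simp only: e_add) simp
    qed
    also have "\<dots> = of_int \<tau>" unfolding \<tau>_def s1 by (simp add: \<kappa>_def)
    finally show ?thesis unfolding s1 by simp
  qed (simp add: \<tau>_def)
  have symbol: "[s * (2 - 2 * kronecker y (int (odp d))) = 2 - 2 * \<tau>] (mod 8)"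
  proof -
    have oy: "coprime y (int (odp d))"
    proof (rule coprimeI)
      fix c assume c: "c dvd y" "c dvd int (odp d)"
      have "odp d dvd d" using odp(1)[OF d0] by (metis dvd_triv_right)
      then have "c dvd int d" using c(2) by (meson dvd_trans of_nat_dvd_iff)
      then have "c dvd U * y + int N * int d * z" using c(1) by simp
      then show "is_unit c" unfolding Uy .
    qed
    have u: "kronecker y (int (odp d)) = 1 \<or> kronecker y (int (odp d)) = -1"
      by (rule kronecker_unit[OF odp(3)[OF d0] oy])
    show ?thesis
    proof (cases "even s")
      case True
      then show ?thesis using sign_mult_parity[OF u, of s 0] by (simp add: \<tau>_def)
    next
      case False
      then show ?thesis using sign_mult_parity[OF u, of s 1] kronecker_y_odp_d[OF False s_odd_a_odd[OF False]] by (simp add: \<tau>_def)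
    qed
  qed
  have sy: "[sy = (2 - 2 * ?K) + (2 - 2 * \<tau>)] (mod 8)"
    by (rule cong_trans[OF sy_cong cong_add[OF cong_refl symbol]])
  have kd: "[\<kappa> + 2 * \<delta>i = s + D] (mod 4)"
    unfolding \<kappa>_def by (rule cong_add[OF _ \<delta>i_cong]) (simp add: cong_iff_dvd_diff)
  have l: "(a * d) div a = d" using a0 by simp
  have \<delta>1: "delta1 N r k (a * d) = of_int \<delta>1i"
  proof -
    have "k \<in> {x + 1/2 | x. x \<in> \<int>} \<longleftrightarrow> odd s"
    proof
      assume "k \<in> {x + 1/2 | x. x \<in> \<int>}"
      then obtain i where "k = of_int i + 1/2" by (auto elim: Ints_cases)
      then have "(of_int \<kappa> :: real) = of_int (2 * i + 1)" unfolding k2 by simp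
      then have "\<kappa> = 2 * i + 1" by (simp only: of_int_eq_iff)
      then have "s = 2 * (i - 2 * j) + 1" by (simp add: \<kappa>_def)
      then show "odd s" by simp
    next
      assume "odd s"
      then have "odd \<kappa>" by (simp add: \<kappa>_def)
      then obtain i where "\<kappa> = 2 * i + 1" by (meson oddE)
      then have "k = of_int i + 1/2" unfolding k2 by (simp add: add_divide_distrib)
      then show "k \<in> {x + 1/2 | x. x \<in> \<int>}" by auto
    qed
    then show ?thesis by (simp add: delta1_def \<delta>1i_def)
  qed
  \<comment> \<open>24 times the exponent of \<psi>. It is a multiple of 3, and the factor \<kappa>
    + 2 \<delta> always meets an even one, so modulo 8 it may be replaced by s + D.\<close>
  define Z where "Z = (if odd (a * d) then - (3 * (\<kappa> + 2 * \<delta>i) * (int d - 1)) + 3 * (\<kappa> + 2 * \<delta>i) * (lam * (int N - 1))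
     else if even N then - (3 * (\<kappa> + 2 * \<delta>i) * (int a - 1)) - 3 * (\<kappa> + 2 * \<delta>i) * (int N * (1 + \<delta>1i) * b) else 0)"
  have psi: "psiZ N r k (a * d) a b = e24 Z"
    unfolding psiZ_def Let_def l delta0_eq \<delta>1 unfolding e24_def Z_def lam_def k2
    by (auto simp: field_simps intro!: arg_cong[of _ _ e])
  have Z3: "3 dvd Z" by (simp add: Z_def mult.assoc)
  \<comment> \<open>The factor 3 makes 2 - 2s equal to 0 or 12: zero modulo 3, unchanged modulo 8,
    and the sign s itself under \<open>e24\<close>.\<close>
  define V where "V = 3 * (2 - 2 * ?K) + 3 * (2 - 2 * \<tau>) + (- (b * int d * Sn)) + Z"
  have V3: "[T = V] (mod 3)"
  proof -
    obtain i where "Z = 3 * i" using Z3 by blast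
    then have "[- (b * int d * Sn) = V] (mod 3)"
      unfolding V_def by (intro congI_int[of _ _ _ "- (2 - 2 * ?K) - (2 - 2 * \<tau>) - i"]) simp
    with T_cong3 show ?thesis by (rule cong_trans)
  qed
  have V8: "[T = V] (mod 8)"
  proof -
    let ?B = "sy + (- (b * int d * Sn))"
    have "[(2 - 2 * ?K) + (2 - 2 * \<tau>) = 3 * (2 - 2 * ?K) + 3 * (2 - 2 * \<tau>)] (mod 8)"
      using K \<tau> by (auto simp: cong_def)
    with sy have sy3: "[sy = 3 * (2 - 2 * ?K) + 3 * (2 - 2 * \<tau>)] (mod 8)" by (rule cong_trans)
    have "[T = ?B + Z] (mod 8)"
    proof (cases "odd (a * d)")
      case True
      have Td: "[T = sy - b * int d * Sn - 3 * (s + D) * (int d - 1) + 3 * (s + D) * lam * (int N - 1)] (mod 8)"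
        using T_odd_l_even_N T_odd_l_odd_N True by (cases "even N") auto
      have "even (int d - 1)" "even (lam * (int N - 1))" using True by (auto simp: lam_def)
      note c = mult_even_cong[OF kd this(1)] mult_even_cong[OF kd this(2)]
      have "[Z = - (3 * (s + D) * (int d - 1)) + 3 * (s + D) * (lam * (int N - 1))] (mod 8)"
        unfolding Z_def if_P[OF True] by (intro cong_add c(2)) (use c(1) in \<open>simp add: cong_minus_minus_iff\<close>)
      then have P: "[?B + Z = ?B + (- (3 * (s + D) * (int d - 1)) + 3 * (s + D) * (lam * (int N - 1)))] (mod 8)"
        by (intro cong_add cong_refl)
      have Q: "?B + (- (3 * (s + D) * (int d - 1)) + 3 * (s + D) * (lam * (int N - 1)))
        = sy - b * int d * Sn - 3 * (s + D) * (int d - 1) + 3 * (s + D) * lam * (int N - 1)" by (simp add: mult.assoc)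
      show ?thesis by (rule cong_trans[OF Td cong_sym[OF P[unfolded Q]]])
    next
      case el: False
      then have el': "even (a * d)" by simp
      show ?thesis
      proof (cases "even N")
        case True
        have "\<delta>1i = 0 \<or> \<delta>1i = 1" by (simp add: \<delta>1i_def)
        moreover have "\<delta>1i = 1" if "4 dvd N" "odd s" "odd v"
          using that el' varpi_mult unfolding \<delta>1i_def by auto
        ultimately have Te: "[T = sy - b * int d * Sn - 3 * (s + D) * (int a - 1) - 3 * int N * (s + D) * (1 + \<delta>1i) * b] (mod 8)"
          by (rule T_even_l_even_N[OF True el'])
        have "even (int a - 1)" "even (int N * (1 + \<delta>1i) * b)" using True oddness(1)[OF True] by auto
        note c = mult_even_cong[OF kd this(1)] mult_even_cong[OF kd this(2)]
        have "[Z = - (3 * (s + D) * (int a - 1)) - 3 * (s + D) * (int N * (1 + \<delta>1i) * b)] (mod 8)"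
          unfolding Z_def if_not_P[OF el] if_P[OF True] by (intro cong_diff c(2)) (use c(1) in \<open>simp add: cong_minus_minus_iff\<close>)
        then have P: "[?B + Z = ?B + (- (3 * (s + D) * (int a - 1)) - 3 * (s + D) * (int N * (1 + \<delta>1i) * b))] (mod 8)"
          by (intro cong_add cong_refl)
        have Q: "?B + (- (3 * (s + D) * (int a - 1)) - 3 * (s + D) * (int N * (1 + \<delta>1i) * b))
          = sy - b * int d * Sn - 3 * (s + D) * (int a - 1) - 3 * int N * (s + D) * (1 + \<delta>1i) * b" by (simp add: mult_ac)
        show ?thesis by (rule cong_trans[OF Te cong_sym[OF P[unfolded Q]]])
      next
        case False
        have "8 dvd b * int d * Sn" using Sm_even_l[OF el'] by simp
        then have "[?B + Z = sy] (mod 8)"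
          unfolding Z_def if_not_P[OF el] if_not_P[OF False] by (simp add: cong_iff_dvd_diff)
        then show ?thesis by (rule cong_trans[OF T_even_l_odd_N[OF False el'] cong_sym])
      qed
    qed
    moreover have "[?B + Z = V] (mod 8)"
      unfolding V_def by (intro cong_add cong_refl sy3)
    ultimately show ?thesis by (rule cong_trans)
  qed
  have "[T = V] (mod 24)"
    using V3 V8 unfolding cong_iff_dvd_diff by presburger
  then have "e24 T = e24 V" by (rule e24_cong)
  also have "\<dots> = of_int ?K * of_int \<tau> * e24 (- (b * int d * Sn)) * e24 Z"
    unfolding V_def e24_add e24_sign[OF K] e24_sign[OF \<tau>] ..
  also have "e24 (- (b * int d * Sn)) = e (of_real (- (of_int b * of_nat d * of_int (x_N N r) / 24)))"
    unfolding e24_def Sn_eq by simp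
  finally show ?thesis unfolding chi_AB pow psi .
qed

end

subsection \<open>Fourier expansions\<close>

lemma e_of_real_eq_1_iff: "e (of_real q) = 1 \<longleftrightarrow> q \<in> \<int>"
proof
  assume "e (of_real q) = 1"
  then obtain n :: int where "2 * pi * q = of_int (2 * n) * pi"
    unfolding e_def exp_eq_1 by auto
  then have "q = of_int n" by simp
  then show "q \<in> \<int>" by simp
next
  assume "q \<in> \<int>"
  then obtain n where "q = of_int n" by (elim Ints_cases)
  then show "e (of_real q) = 1" using e_of_int[of n] by simp
qed

lemma e_power: "e x ^ n = e (of_nat n * x)"
  by (induction n) (simp_all add: e_add distrib_right)

lemma sum_e_roots:
  assumes "K > 0"
  shows "(\<Sum>j<K. e (of_int i * of_nat j / of_nat K)) = (if int K dvd i then of_nat K else 0)"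
proof -
  define w where "w = e (of_real (of_int i / of_nat K))"
  have pw: "e (of_int i * of_nat j / of_nat K) = w ^ j" for j
    unfolding w_def e_power by (simp add: mult.commute)
  have "of_int i / real K \<in> \<int> \<longleftrightarrow> int K dvd i"
    using of_int_div_of_int_in_Ints_iff[of i "int K", where 'a=real] assms by simp
  then have w1: "w = 1 \<longleftrightarrow> int K dvd i" unfolding w_def e_of_real_eq_1_iff .
  have wK: "w ^ K = 1" unfolding w_def e_power using assms e_of_int[of i] by simp
  show ?thesis
  proof (cases "int K dvd i")
    case True
    then show ?thesis using w1 by (simp add: pw)
  next
    case False
    then have "w \<noteq> 1" using w1 by simp
    then show ?thesis using False wK by (simp add: pw geometric_sum)
  qed
qed

lemma has_sum_sum_finite:
  fixes f :: "'i \<Rightarrow> 'a \<Rightarrow> 'b :: topological_comm_monoid_add"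
  assumes "finite I" "\<And>i. i \<in> I \<Longrightarrow> (f i has_sum s i) A"
  shows "((\<lambda>x. \<Sum>i\<in>I. f i x) has_sum (\<Sum>i\<in>I. s i)) A"
  using assms
proof (induction I rule: finite_induct)
  case (insert i I)
  then show ?case by (simp add: has_sum_add)
qed (simp add: has_sum_0)

lemma has_sum_metricE:
  fixes f :: "'a \<Rightarrow> 'b :: {metric_space, comm_monoid_add}"
  assumes "(f has_sum x) UNIV" "\<epsilon> > 0"
  obtains F where "finite F" "\<And>G. finite G \<Longrightarrow> F \<subseteq> G \<Longrightarrow> dist (sum f G) x < \<epsilon>"
proof -
  have "eventually (\<lambda>G. dist (sum f G) x < \<epsilon>) (finite_subsets_at_top UNIV)"
    using assms unfolding has_sum_def by (rule tendstoD)
  then show ?thesis using that unfolding eventually_finite_subsets_at_top by auto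
qed

text \<open>Averaging over the translates \<open>\<tau> + j H / K\<close>, \<open>j < K\<close>, keeps only the
  coefficients congruent to a given one modulo \<open>K\<close>; for large \<open>K\<close> the others are negligible.\<close>

lemma fourier_coefficient_zero:
  fixes c :: "int \<Rightarrow> complex"
  assumes H: "H > 0"
    and hs: "\<And>\<tau>. Im \<tau> = t \<Longrightarrow> ((\<lambda>m. c m * e (of_int m / of_nat H * \<tau>)) has_sum 0) UNIV"
  shows "c m0 = 0"
proof (rule ccontr)
  assume nz: "c m0 \<noteq> 0"
  define g where "g m = c m * e (of_int m / of_nat H * (\<i> * of_real t))" for m
  have g_sum: "(g has_sum 0) UNIV" unfolding g_def by (rule hs) simp
  then have "g summable_on UNIV" by (auto simp: summable_on_def)
  then have "(\<lambda>m. norm (g m)) summable_on UNIV"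
    by (simp add: summable_on_iff_abs_summable_on_complex)
  then obtain L where L: "((\<lambda>m. norm (g m)) has_sum L) UNIV" by (auto simp: summable_on_def)
  define \<epsilon> where "\<epsilon> = norm (g m0)"
  have \<epsilon>: "\<epsilon> > 0" using nz by (simp add: \<epsilon>_def g_def)
  obtain F where F: "finite F" "\<And>G. finite G \<Longrightarrow> F \<subseteq> G \<Longrightarrow> dist (\<Sum>m\<in>G. norm (g m)) L < \<epsilon> / 4"
    using has_sum_metricE[OF L, of "\<epsilon> / 4"] \<epsilon> by auto
  have tail: "(\<Sum>m\<in>G. norm (g m)) < \<epsilon> / 2" if G: "finite G" "G \<inter> F = {}" for G
  proof -
    have "dist (\<Sum>m\<in>F \<union> G. norm (g m)) L < \<epsilon> / 4" "dist (\<Sum>m\<in>F. norm (g m)) L < \<epsilon> / 4"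
      using F G by auto
    moreover have "(\<Sum>m\<in>F \<union> G. norm (g m)) = (\<Sum>m\<in>F. norm (g m)) + (\<Sum>m\<in>G. norm (g m))"
      by (rule sum.union_disjoint) (use F G in auto)
    ultimately show ?thesis unfolding dist_real_def by linarith
  qed
  \<comment> \<open>K exceeds the distance from m0 to every index in F; so no index of F other than
    m0 is congruent to m0 modulo K.\<close>
  define K where "K = nat (1 + (\<Sum>m\<in>F. \<bar>m - m0\<bar>))"
  have sum0: "(\<Sum>m\<in>F. \<bar>m - m0\<bar>) \<ge> 0" by (rule sum_nonneg) simp
  have K0: "K > 0" unfolding K_def zero_less_nat_eq using sum0 by linarith
  have KF: "\<bar>m - m0\<bar> < int K" if "m \<in> F" for m
    using member_le_sum[of m F "\<lambda>m. \<bar>m - m0\<bar>"] that F(1) sum0 by (simp add: K_def)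
  define h where "h m = (if int K dvd m - m0 then g m else 0)" for m
  have "(h has_sum 0) UNIV"
  proof -
    have "((\<lambda>m. g m * e (of_int (m - m0) * of_nat j / of_nat K)) has_sum 0) UNIV" for j
    proof -
      \<comment> \<open>The factor H clears the denominator of the exponents, so this translation
        multiplies the m-th term by e(mj/K) and leaves the height unchanged.\<close>
      let ?\<tau> = "\<i> * of_real t + of_nat (j * H) / of_nat K"
      have "((\<lambda>m. c m * e (of_int m / of_nat H * ?\<tau>)) has_sum 0) UNIV"
        by (rule hs) (simp add: Im_divide_of_nat)
      from has_sum_cmult_right[OF this, of "e (- (of_int m0 * of_nat j / of_nat K))"]
      have "((\<lambda>m. e (- (of_int m0 * of_nat j / of_nat K)) * (c m * e (of_int m / of_nat H * ?\<tau>))) has_sum 0) UNIV"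
        by simp
      moreover have "e (- (of_int m0 * of_nat j / of_nat K)) * (c m * e (of_int m / of_nat H * ?\<tau>))
          = g m * e (of_int (m - m0) * of_nat j / of_nat K)" for m
      proof -
        have "of_int m / of_nat H * ?\<tau> = of_int m / of_nat H * (\<i> * of_real t) + of_int m * of_nat j / of_nat K"
          using H by (simp add: field_simps)
        moreover have "of_int (m - m0) * of_nat j / (of_nat K :: complex) = of_int m * of_nat j / of_nat K + (- (of_int m0 * of_nat j / of_nat K))"
          by (simp add: diff_divide_distrib left_diff_distrib)
        ultimately show ?thesis unfolding g_def by (simp only: e_add mult_ac)
      qed
      ultimately show ?thesis by simp
    qed
    then have "((\<lambda>m. \<Sum>j<K. g m * e (of_int (m - m0) * of_nat j / of_nat K)) has_sum (\<Sum>j<K. 0)) UNIV"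
      by (intro has_sum_sum_finite) auto
    moreover have "(\<Sum>j<K. g m * e (of_int (m - m0) * of_nat j / of_nat K)) = of_nat K * h m" for m
      unfolding sum_distrib_left[symmetric] sum_e_roots[OF K0] by (simp add: h_def)
    ultimately have "((\<lambda>m. of_nat K * h m) has_sum 0) UNIV" by simp
    from has_sum_cmult_right[OF this, of "1 / of_nat K"] show ?thesis using K0 by simp
  qed
  then obtain X where X: "finite X" "\<And>G. finite G \<Longrightarrow> X \<subseteq> G \<Longrightarrow> dist (sum h G) 0 < \<epsilon> / 4"
    using has_sum_metricE[of h 0 "\<epsilon> / 4"] \<epsilon> by auto
  define Y where "Y = X - {m0}"
  define G where "G = {m \<in> Y. int K dvd m - m0}"
  have fin: "finite Y" "finite G" using X(1) by (auto simp: Y_def G_def)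
  have "G \<inter> F = {}"
  proof -
    have False if "m \<in> G" "m \<in> F" for m
    proof -
      have "int K dvd m - m0" "m - m0 \<noteq> 0" using that(1) by (auto simp: G_def Y_def)
      then have "int K \<le> \<bar>m - m0\<bar>" using dvd_imp_le_int[of "m - m0" "int K"] by simp
      then show False using KF[OF that(2)] by simp
    qed
    then show ?thesis by blast
  qed
  then have "(\<Sum>m\<in>G. norm (g m)) < \<epsilon> / 2" using tail fin by blast
  moreover have "norm (sum h Y) \<le> (\<Sum>m\<in>G. norm (g m))"
  proof -
    have "sum h Y = sum g G"
      unfolding h_def G_def by (rule sum.inter_filter[symmetric]) (rule fin)
    then show ?thesis by (simp add: norm_sum)
  qed
  moreover have "m0 \<notin> Y" "h m0 = g m0" by (simp_all add: Y_def h_def)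
  then have "sum h (insert m0 Y) = g m0 + sum h Y"
    by (simp add: sum.insert[OF fin(1)])
  moreover have "dist (sum h (insert m0 Y)) 0 < \<epsilon> / 4"
    by (rule X(2)) (use fin in \<open>auto simp: Y_def\<close>)
  \<comment> \<open>The two norms on the right are below \<epsilon>/4 and \<epsilon>/2, which
    contradicts norm \<epsilon> on the left.\<close>
  moreover have "norm (g m0) \<le> norm (g m0 + sum h Y) + norm (sum h Y)"
    using norm_triangle_ineq4[of "g m0 + sum h Y" "sum h Y"] by simp
  ultimately show False using \<epsilon> unfolding \<epsilon>_def dist_norm by simp
qed

section \<open>Expansions with rational exponents\<close>

lemma of_real_of_rat_quotient: "complex_of_real (of_rat (of_int m / of_nat H)) = of_int m / of_nat H"
  by (simp add: of_rat_divide)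

text \<open>The exponents share the denominator H; extending the coefficients by zero off X reduces
  this to integer indices.\<close>

lemma rat_fourier_coefficient_zero:
  fixes c :: "rat \<Rightarrow> complex"
  assumes H: "H > 0" and X: "X \<subseteq> range (\<lambda>m::int. of_int m / of_nat H)"
    and hs: "\<And>\<tau>. Im \<tau> = t \<Longrightarrow> ((\<lambda>n. c n * e (of_real (of_rat n) * \<tau>)) has_sum 0) X"
    and n: "n \<in> X"
  shows "c n = 0"
proof -
  define \<phi> where "\<phi> m = (of_int m / of_nat H :: rat)" for m :: int
  have inj: "inj \<phi>" using H by (auto simp: inj_def \<phi>_def)
  define c' where "c' m = (if \<phi> m \<in> X then c (\<phi> m) else 0)" for m
  have "c' m = 0" for m
  proof (rule fourier_coefficient_zero[OF H])
    fix \<tau> assume "Im \<tau> = t"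
    from hs[OF this] have "((\<lambda>n. (if n \<in> X then c n else 0) * e (of_real (of_rat n) * \<tau>)) has_sum 0) (range \<phi>)"
      by (rule has_sum_cong_neutral[THEN iffD1, rotated -1]) (use X in \<open>auto simp: \<phi>_def\<close>)
    then show "((\<lambda>m. c' m * e (of_int m / of_nat H * \<tau>)) has_sum 0) UNIV"
      unfolding has_sum_reindex[OF inj] by (simp add: o_def c'_def \<phi>_def of_real_of_rat_quotient cong: if_cong)
  qed
  moreover obtain m where "n = \<phi> m" using X n by (auto simp: \<phi>_def)
  ultimately show ?thesis using n by (metis c'_def)
qed

text \<open>The expansions may hold in different half-planes; a single horizontal line in both is
  enough to compare them.\<close>

lemma rat_expansion_unique:
  fixes c c' :: "rat \<Rightarrow> complex"
  assumes H: "H > 0" and X: "X \<subseteq> range (\<lambda>m::int. of_int m / of_nat H)"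
    and 1: "\<And>\<tau>. Im \<tau> > Y \<Longrightarrow> ((\<lambda>n. c n * e (of_real (of_rat n) * \<tau>)) has_sum F \<tau>) X"
    and 2: "\<And>\<tau>. Im \<tau> > Y' \<Longrightarrow> ((\<lambda>n. c' n * e (of_real (of_rat n) * \<tau>)) has_sum F \<tau>) X"
    and n: "n \<in> X"
  shows "c' n = c n"
proof -
  have "c' n - c n = 0"
  proof (rule rat_fourier_coefficient_zero[OF H X _ n, of "max Y Y' + 1" "\<lambda>n. c' n - c n"])
    fix \<tau> assume "Im \<tau> = max Y Y' + 1"
    then have \<tau>: "Im \<tau> > Y" "Im \<tau> > Y'" by auto
    have "((\<lambda>n. c' n * e (of_real (of_rat n) * \<tau>) + (-1) * (c n * e (of_real (of_rat n) * \<tau>))) has_sum F \<tau> + (-1) * F \<tau>) X"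
      by (intro has_sum_add 2 has_sum_cmult_right 1 \<tau>)
    then show "((\<lambda>n. (c' n - c n) * e (of_real (of_rat n) * \<tau>)) has_sum 0) X"
      by (simp add: left_diff_distrib)
  qed
  then show ?thesis by simp
qed

lemma exps_range: "exps N r \<subseteq> range (\<lambda>m::int. of_int m / of_nat 24)"
proof
  fix q assume "q \<in> exps N r"
  then obtain m where "q = of_int (x_N N r) / 24 + of_int m" by (auto simp: exps_def)
  then have "q = of_int (x_N N r + 24 * m) / of_nat 24" by (simp add: field_simps)
  then show "q \<in> range (\<lambda>m::int. of_int m / of_nat 24)" by blast
qed

lemma in_exps_iff: "q \<in> exps N r \<longleftrightarrow> e (of_real (of_rat (q - of_int (x_N N r) / 24))) = 1"
proof -
  have "q \<in> exps N r \<longleftrightarrow> q - of_int (x_N N r) / 24 \<in> \<int>"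
    by (auto simp: exps_def Ints_def field_simps)
  also have "\<dots> \<longleftrightarrow> real_of_rat (q - of_int (x_N N r) / 24) \<in> \<int>"
    by (auto elim!: Ints_cases) (metis Ints_of_int of_rat_eq_iff of_rat_of_int_eq)
  finally show ?thesis unfolding e_of_real_eq_1_iff .
qed

subsection \<open>The Hecke operator on expansions\<close>

lemma modular_form_period:
  assumes hN: "N \<ge> 1" and hf: "meromorphic_modular_form N k (chi_r N r) f" and \<tau>: "Im \<tau> > 0"
  shows "f (\<tau> + 1) = e (of_real (of_int (x_N N r) / 24)) * f \<tau>"
proof -
  have "in_Gamma0 N (1, 1, 0, 1)" by (simp add: in_Gamma0_def in_SL2Z_def)
  then have "slash k f (1, 1, 0, 1) 1 \<tau> = chi_r N r (1, 1, 0, 1) 1 * f \<tau>"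
    using hf \<tau> unfolding meromorphic_modular_form_def upper_half_def by blast
  moreover have "slash k f (1, 1, 0, 1) 1 \<tau> = f (\<tau> + 1)"
    by (simp add: slash_def mobius_def)
  moreover have "chi_r N r (1, 1, 0, 1) 1 = e (of_real (of_int (x_N N r) / 24))"
    by (simp add: chi_r_def Psi_def x_N_def mult.commute)
  ultimately show ?thesis by simp
qed

text \<open>The condition at the identity matrix gives exponents in (1/h) \<int>. In f(\<tau> + 1) -
  e(x_N/24) f(\<tau>) = 0 the m-th coefficient is c m times e(m/h) - e(x_N/24), so all exponents
  outside x_N/24 + \<int> drop out.\<close>

lemma modular_form_expansion:
  assumes hN: "N \<ge> 1" and hf: "meromorphic_modular_form N k (chi_r N r) f"
  obtains cf Y where "Y \<ge> 0"
    "\<And>\<tau>. Im \<tau> > Y \<Longrightarrow> ((\<lambda>n. cf n * e (of_real (of_rat n) * \<tau>)) has_sum f \<tau>) (exps N r)"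
proof -
  have "in_SL2Z (1, 0, 0, 1)" by (simp add: in_SL2Z_def)
  from hf[unfolded meromorphic_modular_form_def, THEN conjunct2, THEN conjunct2, rule_format, OF this]
  obtain h :: nat and Y c where h: "h > 0"
    and c: "\<And>\<tau>. Im \<tau> > Y \<Longrightarrow> ((\<lambda>m. c m * e (of_int m / of_nat h * \<tau>)) has_sum slash k f (1, 0, 0, 1) 1 \<tau>) UNIV"
    by blast
  have "slash k f (1, 0, 0, 1) 1 \<tau> = f \<tau>" for \<tau>
    by (simp add: slash_def mobius_def)
  with c have c: "\<And>\<tau>. Im \<tau> > Y \<Longrightarrow> ((\<lambda>m. c m * e (of_int m / of_nat h * \<tau>)) has_sum f \<tau>) UNIV" by simp
  let ?x = "of_real (of_int (x_N N r) / 24) :: complex"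
  define \<phi> where "\<phi> m = (of_int m / of_nat h :: rat)" for m :: int
  have inj: "inj \<phi>" using h by (auto simp: inj_def \<phi>_def)
  have "c m * (e (of_int m / of_nat h) - e ?x) = 0" for m
  \<comment> \<open>Y may be negative, while the relation between f(\<tau> + 1) and f(\<tau>) holds
    in the upper half-plane; hence the height \<open>max Y 0 + 1\<close>.\<close>
  proof (rule fourier_coefficient_zero[OF h, of "max Y 0 + 1" "\<lambda>m. c m * (e (of_int m / of_nat h) - e ?x)" m])
    fix \<tau> assume "Im \<tau> = max Y 0 + 1"
    then have \<tau>: "Im \<tau> > Y" "Im (\<tau> + 1) > Y" "Im \<tau> > 0" by auto
    have "((\<lambda>m. c m * e (of_int m / of_nat h * (\<tau> + 1)) + (- e ?x) * (c m * e (of_int m / of_nat h * \<tau>)))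
        has_sum f (\<tau> + 1) + (- e ?x) * f \<tau>) UNIV"
      by (intro has_sum_add has_sum_cmult_right c \<tau>)
    moreover have "f (\<tau> + 1) + (- e ?x) * f \<tau> = 0"
      using modular_form_period[OF hN hf \<tau>(3)] by simp
    moreover have "c m * e (of_int m / of_nat h * (\<tau> + 1)) + (- e ?x) * (c m * e (of_int m / of_nat h * \<tau>))
       = c m * (e (of_int m / of_nat h) - e ?x) * e (of_int m / of_nat h * \<tau>)" for m
    proof -
      have "e (of_int m / of_nat h * (\<tau> + 1)) = e (of_int m / of_nat h * \<tau>) * e (of_int m / of_nat h)"
        unfolding e_add[symmetric] by (simp only: distrib_left mult_1_right)
      then show ?thesis by (simp only: left_diff_distrib right_diff_distrib) simp
    qed
    ultimately show "((\<lambda>m. c m * (e (of_int m / of_nat h) - e ?x) * e (of_int m / of_nat h * \<tau>)) has_sum 0) UNIV"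
      by simp
  qed
  then have vanish: "c m = 0" if "\<phi> m \<notin> exps N r" for m
  proof -
    have "e (of_real (of_rat (\<phi> m - of_int (x_N N r) / 24))) = e (of_int m / of_nat h) * inverse (e ?x)"
      unfolding e_minus[symmetric] e_add[symmetric] \<phi>_def by (simp add: of_rat_diff of_rat_divide)
    then have "e (of_int m / of_nat h) \<noteq> e ?x" using that unfolding in_exps_iff by auto
    then show ?thesis using \<open>c m * (e (of_int m / of_nat h) - e ?x) = 0\<close> by simp
  qed
  define cf where "cf n = (if n \<in> range \<phi> then c (inv_into UNIV \<phi> n) else 0)" for n
  have "((\<lambda>n. cf n * e (of_real (of_rat n) * \<tau>)) has_sum f \<tau>) (exps N r)" if "Im \<tau> > max Y 0" for \<tau>
  proof -
    have "((\<lambda>m. c m * e (of_int m / of_nat h * \<tau>)) has_sum f \<tau>) UNIV" using c that by simp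
    then have "((\<lambda>n. cf n * e (of_real (of_rat n) * \<tau>)) has_sum f \<tau>) (range \<phi>)"
      unfolding has_sum_reindex[OF inj]
      by (simp add: o_def cf_def inv_f_f[OF inj] \<phi>_def[symmetric]) (simp add: \<phi>_def of_real_of_rat_quotient)
    then show ?thesis
      by (rule has_sum_cong_neutral[THEN iffD1, rotated -1]) (auto simp: cf_def inv_f_f[OF inj] vanish)
  qed
  then show ?thesis using that[of "max Y 0" cf] by simp
qed

text \<open>x is the product of the primes of n that do not divide c. A prime of n dividing c
  divides neither a nor x; one not dividing c divides ax.\<close>

lemma exists_coprime_shift:
  fixes a c n :: int
  assumes "n \<noteq> 0" "\<And>p. prime p \<Longrightarrow> p dvd a \<Longrightarrow> p dvd c \<Longrightarrow> \<not> p dvd n"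
  shows "\<exists>x. coprime (a * x + c) n"
proof -
  define P where "P = {p \<in> prime_factors n. \<not> p dvd c}"
  have fin: "finite P" by (simp add: P_def)
  define x where "x = \<Prod>P"
  have "coprime (a * x + c) n"
  proof (rule ccontr)
    assume "\<not> coprime (a * x + c) n"
    then have "\<not> is_unit (gcd (a * x + c) n)" by (simp add: coprime_iff_gcd_eq_1)
    moreover have "gcd (a * x + c) n \<noteq> 0" using assms(1) by simp
    ultimately obtain p where "p dvd gcd (a * x + c) n" and p0: "prime p"
      using prime_divisor_exists by blast
    then have p: "prime p" "p dvd a * x + c" "p dvd n" by auto
    show False
    proof (cases "p dvd c")
      case True
      then have "p dvd a * x" using p(2) by (simp add: dvd_add_left_iff)
      moreover have "\<not> p dvd a" using assms(2) p True by blast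
      ultimately have "p dvd x" using p(1) prime_dvd_mult_iff by blast
      then obtain q where q: "q \<in> P" "p dvd q"
        unfolding x_def using p(1) prime_dvd_prod_iff[OF fin p(1)] by auto
      then have "p = q" using p(1) by (auto simp: P_def primes_dvd_imp_eq in_prime_factors_iff)
      then show False using q True by (simp add: P_def)
    next
      case False
      then have "p \<in> P" using p assms(1) by (simp add: P_def in_prime_factors_iff)
      then have "p dvd x" unfolding x_def using fin by (rule dvd_prodI[rotated, of _ _ "\<lambda>x. x", simplified])
      then show False using p(2) False by (simp add: dvd_add_right_iff)
    qed
  qed
  then show ?thesis ..
qed

text \<open>An x making -Nb + ax prime to Nd yields y and z by Bezout. Such x exist because a prime
  dividing a and Nb divides b, hence neither N nor d.\<close>

lemma exists_det:
  fixes a d N :: nat and b :: int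
  assumes "N > 0" "d > 0" "coprime N a" "gcd (gcd (int a) b) (int d) = 1"
  shows "\<exists>x y z. (- int N * b + int a * x) * y + int N * int d * z = 1"
proof -
  have "\<exists>x. coprime (int a * x + (- int N * b)) (int N * int d)"
  proof (rule exists_coprime_shift)
    show "int N * int d \<noteq> 0" using assms by simp
    fix p :: int assume p: "prime p" "p dvd int a" "p dvd - int N * b"
    have "\<not> p dvd int N"
    proof
      assume "p dvd int N"
      moreover have "coprime (int N) (int a)" using assms(3) by simp
      ultimately have "is_unit p" using p(2) coprime_common_divisor by blast
      then show False using p(1) by auto
    qed
    then have "p dvd b" using p(1,3) prime_dvd_mult_iff[of p "int N" b] by simp
    show "\<not> p dvd int N * int d"
    proof
      assume "p dvd int N * int d"
      then have "p dvd int d" using \<open>\<not> p dvd int N\<close> p(1) prime_dvd_mult_iff by blast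
      then have "p dvd gcd (gcd (int a) b) (int d)" using p(2) \<open>p dvd b\<close> by simp
      then show False using assms(4) p(1) by auto
    qed
  qed
  then obtain x where "coprime (int a * x + (- int N * b)) (int N * int d)" ..
  then obtain y z where "y * (int a * x + (- int N * b)) + z * (int N * int d) = 1"
    using bezout_int[of "int a * x + (- int N * b)" "int N * int d"] by auto
  then have "(- int N * b + int a * x) * y + int N * int d * z = 1" by (simp add: algebra_simps)
  then show ?thesis by blast
qed

text \<open>With g the gcd in the definition of \<open>m_r\<close> one has \<open>m_r\<close> * g =
  24; l - 1 supplies the factor \<open>m_r\<close>, and each of the two sums supplies g. An odd sum
  of the r_n means k' in 1/2 + \<int>.\<close>

lemma eta_hecke_intro:
  assumes hN: "N \<ge> 1" and hl: "l \<in> L_r N r" and l: "l = a * d"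
    and det: "(- int N * b + int a * x) * y + int N * int d * z = 1"
  shows "eta_hecke N r a d b x y z"
proof
  have l1: "l \<ge> 1" and lm: "[int l = 1] (mod m_r N r)"
    and sq: "kprime N r \<in> {x + 1/2 | x. x \<in> \<int>} \<longrightarrow> (\<exists>t::nat. l = t ^ 2)"
    using hl by (auto simp: L_r_def)
  show "N > 0" "a > 0" "d > 0" using hN l1 l by (auto intro: Nat.gr0I)
  show "(- int N * b + int a * x) * y + int N * int d * z = 1" by (rule det)
  define g where "g = gcd (gcd 24 (\<Sum>n\<in>divs N. int (N div n) * r n)) (\<Sum>n\<in>divs N. int n * r n)"
  have "g dvd 24" unfolding g_def by (meson dvd_trans gcd_dvd1)
  then have mg: "m_r N r * g = 24" by (simp add: m_r_def g_def)
  obtain t where "int l - 1 = m_r N r * t" using lm by (auto simp: cong_iff_dvd_diff)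
  then have lt: "int (a * d) - 1 = m_r N r * t" using l by simp
  have *: "24 dvd (int (a * d) - 1) * Q" if gQ: "g dvd Q" for Q
  proof -
    obtain q where q: "Q = g * q" using gQ by blast
    have "(int (a * d) - 1) * Q = (m_r N r * g) * (t * q)" unfolding lt q by (simp only: mult_ac)
    then show ?thesis unfolding mg by simp
  qed
  show "24 dvd (int (a * d) - 1) * (\<Sum>n\<in>divs N. int (N div n) * r n)"
    unfolding g_def by (rule *[unfolded g_def]) (meson dvd_trans gcd_dvd1 gcd_dvd2)
  show "24 dvd (int (a * d) - 1) * x_N N r"
    unfolding x_N_def by (rule *) (simp add: g_def)
  assume "odd (\<Sum>n\<in>divs N. r n)"
  then obtain i where i: "(\<Sum>n\<in>divs N. r n) = 2 * i + 1" by (meson oddE)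
  have "kprime N r = of_int (\<Sum>n\<in>divs N. r n) / 2" by (simp add: kprime_def)
  then have "kprime N r = of_int i + 1/2" unfolding i by (simp add: add_divide_distrib)
  then have "kprime N r \<in> {x + 1/2 | x. x \<in> \<int>}" by auto
  then show "\<exists>t. a * d = t ^ 2" using sq l by simp
qed

section \<open>Dependence of the character product on b\<close>

lemma Psi_shift_left: "c < 0 \<Longrightarrow> Psi (a + j * c, b', c, d) = Psi (a, b, c, d) + of_int j"
  by (simp add: Psi_def field_simps)

text \<open>Relative to the lower left entry N/n, adding N = n (N/n) to x is a translation by n;
  weighted by r_n these translations add up to \<open>x_N\<close>.\<close>

lemma chi_r_shift_right:
  assumes "N \<ge> 1"
  shows "chi_r N r (a, b', int N, x + int N) 1 = chi_r N r (a, b, int N, x) 1 * e (of_real (of_int (x_N N r) / 24))"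
proof -
  have "Psi (a, b' * int n, int N div int n, x + int N) = Psi (a, b * int n, int N div int n, x) + real n" if "n \<in> divs N" for n
  proof -
    have n: "n dvd N" "n > 0" using that assms by (auto simp: divs_def intro: Nat.gr0I)
    then have "int N = int n * (int N div int n)" by simp
    moreover have "int N div int n > 0" using n assms by (simp add: pos_imp_zdiv_pos_iff zdvd_imp_le dvd_imp_le)
    ultimately show ?thesis using Psi_shift[of "int N div int n" a "b' * int n" x "int n" "b * int n"] by simp
  qed
  then have "(\<Sum>n\<in>divs N. of_int (r n) * Psi (a, b' * int n, int N div int n, x + int N))
    = (\<Sum>n\<in>divs N. of_int (r n) * Psi (a, b * int n, int N div int n, x)) + of_int (x_N N r)"
    by (simp add: distrib_left sum.distrib x_N_def mult.commute)
  then show ?thesis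
    unfolding chi_r_def prod.case by (simp only: distrib_left of_real_add e_add) simp
qed

lemma chi_r_shift_left:
  assumes "N \<ge> 1" "d > 0"
  shows "chi_r N r (a - int N * int d, b', - int N * int d, y) 1 = chi_r N r (a, b, - int N * int d, y) 1 * e (of_real (of_int (x_N N r) / 24))"
proof -
  have "Psi (a - int N * int d, b' * int n, (- int N * int d) div int n, y) = Psi (a, b * int n, (- int N * int d) div int n, y) + real n" if "n \<in> divs N" for n
  proof -
    have n: "n dvd N" "n > 0" using that assms by (auto simp: divs_def intro: Nat.gr0I)
    then obtain m where m: "N = n * m" by blast
    then have m0: "m > 0" using assms by (auto intro: Nat.gr0I)
    have c: "(- int N * int d) div int n = - (int m * int d)"
    proof -
      have "- int N * int d = int n * (- (int m * int d))" unfolding m by simp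
      then show ?thesis using n(2) by (metis nonzero_mult_div_cancel_left of_nat_0_less_iff less_irrefl)
    qed
    have neg: "- (int m * int d) < 0" using m0 assms by simp
    have e: "a - int N * int d = a + int n * (- (int m * int d))" unfolding m by simp
    show ?thesis unfolding c e by (rule trans[OF Psi_shift_left[OF neg]]) simp
  qed
  then have "(\<Sum>n\<in>divs N. of_int (r n) * Psi (a - int N * int d, b' * int n, (- int N * int d) div int n, y))
    = (\<Sum>n\<in>divs N. of_int (r n) * Psi (a, b * int n, (- int N * int d) div int n, y)) + of_int (x_N N r)"
    by (simp add: distrib_left sum.distrib x_N_def mult.commute)
  then show ?thesis
    unfolding chi_r_def prod.case by (simp only: distrib_left of_real_add e_add) simp
qed

text \<open>The evaluated character product as a function of all integers b, since b + a and b + d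
  leave the range of the Hecke sum.\<close>

definition hecke_weight :: "nat \<Rightarrow> (nat \<Rightarrow> int) \<Rightarrow> real \<Rightarrow> nat \<Rightarrow> nat \<Rightarrow> int \<Rightarrow> complex" where
  "hecke_weight N r k l a b =
     of_int (kronecker (int a) (int (varpi N r))) *
     of_int (kronecker (- int N * b) (int (gcd a (l div a)))) powr (of_real (2 * k)) *
     e (of_real (- (of_int b * of_nat (l div a) * of_int (x_N N r) / 24))) * psiZ N r k l a b"

locale hecke_setup =
  fixes N :: nat and r :: "nat \<Rightarrow> int" and k :: real and l :: nat
  assumes hN: "N \<ge> 1" and hk: "\<exists>j::int. k = kprime N r + 2 * of_int j" and hl: "l \<in> L_r N r"
begin

lemma l_pos: "l > 0" using hl by (simp add: L_r_def)

lemma weight_eq: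
  assumes l: "l = a * d" and det: "(- int N * b + int a * x) * y + int N * int d * z = 1"
  shows "inverse (chi_r N r (- int N * b + int a * x, z, - int N * int d, y) 1) *
    inverse (chi_r N r (int a * y, b * y - int d * z, int N, x) 1) = hecke_weight N r k l a b"
proof -
  interpret eta_hecke N r a d b x y z by (rule eta_hecke_intro[OF hN hl l det])
  obtain j where j: "k = kprime N r + 2 * of_int j" using hk by blast
  have "l div a = d" using l a0 by simp
  then show ?thesis unfolding chi_product[OF j] hecke_weight_def using l by simp
qed

lemma weight_shift:
  assumes l: "l = a * d" and co: "coprime N a" and g: "gcd (gcd (int a) b) (int d) = 1"
  shows "hecke_weight N r k l a (b + int a) = hecke_weight N r k l a b * e (of_real (- (of_int (x_N N r) / 24)))" (is ?A)
    and "hecke_weight N r k l a (b + int d) = hecke_weight N r k l a b * e (of_real (- (of_int (x_N N r) / 24)))" (is ?B)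
proof -
  have pos: "N > 0" "d > 0" using hN l_pos l by auto
  obtain x y z where det: "(- int N * b + int a * x) * y + int N * int d * z = 1"
    using exists_det[OF pos co g] by blast
  \<comment> \<open>Each choice alters one matrix only: raising x by N with b by a fixes the first
    matrix, raising z by y with b by d fixes the second.\<close>
  have 1: "- int N * (b + int a) + int a * (x + int N) = - int N * b + int a * x" by (simp add: algebra_simps)
  have det1: "(- int N * (b + int a) + int a * (x + int N)) * y + int N * int d * z = 1" unfolding 1 by (rule det)
  have 2: "- int N * (b + int d) + int a * x = (- int N * b + int a * x) - int N * int d" by (simp add: algebra_simps)
  have det2: "(- int N * (b + int d) + int a * x) * y + int N * int d * (z + y) = 1"
    using det by (simp add: algebra_simps)
  have 3: "(b + int d) * y - int d * (z + y) = b * y - int d * z" by (simp add: algebra_simps)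
  have inv: "e (of_real (- (of_int (x_N N r) / 24))) = inverse (e (of_real (of_int (x_N N r) / 24)))"
    by (simp add: e_minus[symmetric])
  show ?A
    unfolding weight_eq[OF l det, symmetric] weight_eq[OF l det1, symmetric] unfolding 1
      chi_r_shift_right[OF hN, of r "int a * y" "(b + int a) * y - int d * z" x "b * y - int d * z"] inv
    by (simp add: mult_ac)
  show ?B
    unfolding weight_eq[OF l det, symmetric] weight_eq[OF l det2, symmetric] unfolding 2 3
      chi_r_shift_left[OF hN pos(2), of r "- int N * b + int a * x" "z + y" y z] inv
    by (simp add: mult_ac)
qed

end

lemma sum_shift_periodic:
  fixes G :: "nat \<Rightarrow> complex"
  assumes "\<And>b. G (b + d) = G b"
  shows "(\<Sum>b<d. G (b + a)) = (\<Sum>b<d. G b)"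
proof (induction a)
  case (Suc a)
  have "(\<Sum>b<Suc d. G (b + a)) = G a + (\<Sum>b<d. G (Suc b + a))"
    using sum.lessThan_Suc_shift[of "\<lambda>b. G (b + a)" d] by simp
  moreover have "(\<Sum>b<Suc d. G (b + a)) = (\<Sum>b<d. G (b + a)) + G (a + d)" by (simp add: add.commute)
  ultimately have "(\<Sum>b<d. G (b + Suc a)) = (\<Sum>b<d. G (b + a))" using assms[of a] by simp
  then show ?case using Suc.IH by simp
qed simp

context hecke_setup begin

text \<open>The summand has period d in b: the factor e(dn/a) of the exponential cancels e(-x_N/24),
  because dn/a lies in \<open>exps N r\<close>. Raising b by a multiplies it by e(n - x_N/24), which
  is not 1, yet merely rearranges the sum over a period.\<close>

lemma weight_sum_zero:
  fixes n :: rat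
  assumes l: "l = a * d" and co: "coprime N a"
    and n': "of_nat d * n / of_nat a \<in> exps N r" and n: "n \<notin> exps N r"
  shows "(\<Sum>b\<in>{b. b < d \<and> gcd (gcd a b) d = 1}. hecke_weight N r k l a (int b) * e (of_real (of_rat (of_nat b * n / of_nat a)))) = 0"
proof -
  have a0: "a > 0" using l_pos l by (auto intro: Nat.gr0I)
  let ?w = "hecke_weight N r k l a" and ?x = "of_real (- (of_int (x_N N r) / 24)) :: complex"
  define G where "G b = (if gcd (gcd a b) d = 1 then ?w (int b) * e (of_real (of_rat (of_nat b * n / of_nat a))) else 0)" for b :: nat
  have sh: "?w (int (b + a)) = ?w (int b) * e ?x" "?w (int (b + d)) = ?w (int b) * e ?x" if "gcd (gcd a b) d = 1" for b
  proof -
    have "gcd (gcd (int a) (int b)) (int d) = int (gcd (gcd a b) d)" by simp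
    then have "gcd (gcd (int a) (int b)) (int d) = 1" using that by (simp only: of_nat_1)
    then show "?w (int (b + a)) = ?w (int b) * e ?x" "?w (int (b + d)) = ?w (int b) * e ?x"
      using weight_shift[OF l co] by (simp_all only: of_nat_add)
  qed
  have gd: "gcd (gcd a (b + d)) d = gcd (gcd a b) d" for b by (simp add: gcd.assoc)
  have ga: "gcd (gcd a (b + a)) d = gcd (gcd a b) d" for b
  proof -
    have "gcd a (b + a) = gcd a b" by (metis add.commute gcd_add2)
    then show ?thesis by simp
  qed
  have split: "e (of_real (of_rat (of_nat (b + c) * n / of_nat a))) * e ?x
      = e (of_real (of_rat (of_nat b * n / of_nat a))) * e (of_real (of_rat (of_nat c * n / of_nat a - of_int (x_N N r) / 24)))" for b c :: nat
    unfolding e_add[symmetric] by (rule arg_cong[of _ _ e])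
      (simp add: of_rat_add of_rat_diff of_rat_divide of_rat_mult add_divide_distrib distrib_right)
  have "G (b + d) = G b" for b
  proof (cases "gcd (gcd a b) d = 1")
    case True
    have "e (of_real (of_rat (of_nat d * n / of_nat a - of_int (x_N N r) / 24))) = 1"
      using n' unfolding in_exps_iff .
    then show ?thesis unfolding G_def gd using True sh(2)[OF True] split[of b d] by (simp add: mult_ac)
  qed (simp add: G_def gd)
  then have "(\<Sum>b<d. G (b + a)) = (\<Sum>b<d. G b)" by (rule sum_shift_periodic)
  moreover define \<omega> where "\<omega> = e (of_real (of_rat (n - of_int (x_N N r) / 24)))"
  have "G (b + a) = \<omega> * G b" for b
  proof (cases "gcd (gcd a b) d = 1")
    case True
    then show ?thesis unfolding G_def ga \<omega>_def using sh(1)[OF True] split[of b a] a0 by (simp add: mult_ac)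
  qed (simp add: G_def ga)
  ultimately have "\<omega> * (\<Sum>b<d. G b) = (\<Sum>b<d. G b)" by (simp add: sum_distrib_left)
  moreover have "\<omega> \<noteq> 1" using n unfolding \<omega>_def in_exps_iff .
  ultimately have "(\<Sum>b<d. G b) = 0" by simp
  moreover have "(\<Sum>b<d. G b) = (\<Sum>b\<in>{b \<in> {..<d}. gcd (gcd a b) d = 1}. ?w (int b) * e (of_real (of_rat (of_nat b * n / of_nat a))))"
    unfolding G_def by (rule sum.inter_filter[symmetric]) simp
  moreover have "{b \<in> {..<d}. gcd (gcd a b) d = 1} = {b. b < d \<and> gcd (gcd a b) d = 1}" by auto
  ultimately show ?thesis by simp
qed

lemma hecke_eq:
  "hecke N k (chi_r N r) l f \<tau> = of_real (real l powr (- k / 2)) *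
     (\<Sum>a\<in>{a. a dvd l \<and> coprime N a}. of_real (real a powr k) *
        (\<Sum>b\<in>{b. b < l div a \<and> gcd (gcd a b) (l div a) = 1}.
           hecke_weight N r k l a (int b) * f ((of_nat a * \<tau> + of_nat b) / of_nat (l div a))))"
  unfolding hecke_def Let_def
proof (intro arg_cong2[of _ _ _ _ "(*)"] sum.cong refl)
  fix a b assume a: "a \<in> {a. a dvd l \<and> coprime N a}" and b: "b \<in> {b. b < l div a \<and> gcd (gcd a b) (l div a) = 1}"
  define d where "d = l div a"
  have l: "l = a * d" using a by (simp add: d_def)
  have pos: "N > 0" "d > 0" using hN l_pos l by auto
  have "gcd (gcd (int a) (int b)) (int d) = int (gcd (gcd a b) d)" by simp
  then have g: "gcd (gcd (int a) (int b)) (int d) = 1" using b by (simp add: d_def)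
  define P where "P = (\<lambda>(x, y, z). (- int N * int b + int a * x) * y + int N * int d * z = (1::int))"
  \<comment> \<open>Whatever triple is selected, it satisfies the determinant equation because
    solutions exist, and \<open>weight_eq\<close> gives the same value for all of them.\<close>
  obtain x y z where xyz: "(SOME t. P t) = (x, y, z)" by (cases "SOME t. P t")
  have "\<exists>t. P t" using exists_det[OF pos _ g] a by (auto simp: P_def)
  then have "P (x, y, z)" unfolding xyz[symmetric] by (rule someI_ex)
  then have det: "(- int N * int b + int a * x) * y + int N * int d * z = 1" by (simp add: P_def)
  show "(case SOME (x, y, z). (- int N * int b + int a * x) * y + int N * int (l div a) * z = 1 of
      (x, y, z) \<Rightarrow> inverse (chi_r N r (- int N * int b + int a * x, z, - int N * int (l div a), y) 1) *
        inverse (chi_r N r (int a * y, int b * y - int (l div a) * z, int N, x) 1) * f ((of_nat a * \<tau> + of_nat b) / of_nat (l div a)))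
    = hecke_weight N r k l a (int b) * f ((of_nat a * \<tau> + of_nat b) / of_nat (l div a))"
    unfolding d_def[symmetric] P_def[symmetric] xyz prod.case weight_eq[OF l det] ..
qed

end

theorem theorem9p15:
  fixes N :: nat and r :: "nat \<Rightarrow> int" and k :: real and l :: nat
    and f :: "complex \<Rightarrow> complex"
  assumes hN: "N \<ge> 1"
    and hk: "\<exists>j::int. k = kprime N r + 2 * of_int j"
    and hf: "meromorphic_modular_form N k (chi_r N r) f"
    and hl: "l \<in> L_r N r"
  shows "\<exists>Y0::real. Y0 \<ge> 0 \<and> (\<exists>cf cT :: rat \<Rightarrow> complex.
     (\<forall>\<tau>. Im \<tau> > Y0 \<longrightarrow>
        ((\<lambda>n. cf n * e (of_real (of_rat n) * \<tau>)) has_sum f \<tau>) (exps N r) \<and>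
        ((\<lambda>n. cT n * e (of_real (of_rat n) * \<tau>)) has_sum hecke N k (chi_r N r) l f \<tau>) (exps N r)) \<and>
     (\<forall>Y1 c'. (\<forall>\<tau>. Im \<tau> > Y1 \<longrightarrow>
        ((\<lambda>n. c' n * e (of_real (of_rat n) * \<tau>)) has_sum f \<tau>) (exps N r)) \<longrightarrow>
        (\<forall>n\<in>exps N r. c' n = cf n)) \<and>
     (\<forall>Y1 c'. (\<forall>\<tau>. Im \<tau> > Y1 \<longrightarrow>
        ((\<lambda>n. c' n * e (of_real (of_rat n) * \<tau>)) has_sum hecke N k (chi_r N r) l f \<tau>) (exps N r)) \<longrightarrow>
        (\<forall>n\<in>exps N r. c' n = cT n)) \<and>
     (\<forall>n\<in>exps N r.
        cT n = of_real (real l powr (- k / 2)) *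
          (\<Sum>a\<in>{a. a dvd l \<and> coprime a N}.
             let d = l div a in
             of_int (kronecker (int a) (int (varpi N r))) * of_real (real a powr k) *
             (if of_nat l * n / of_nat (a ^ 2) \<in> exps N r then cf (of_nat l * n / of_nat (a ^ 2)) else 0) *
             (\<Sum>b\<in>{b. b < d \<and> gcd (gcd a b) d = 1}.
                (of_int (kronecker (- int N * int b) (int (gcd a d)))) powr (of_real (2 * k)) *
                e (of_real (of_rat (of_nat (b * d) * (n / of_nat l - of_int (x_N N r) / 24)))) *
                psi_lr N r k l a b))))"
proof -
  interpret hecke_setup N r k l by unfold_locales (fact hN hk hl)+
  obtain cf Y where Y0: "Y \<ge> 0"
    and cf: "\<And>\<tau>. Im \<tau> > Y \<Longrightarrow> ((\<lambda>n. cf n * e (of_real (of_rat n) * \<tau>)) has_sum f \<tau>) (exps N r)"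
    by (rule modular_form_expansion[OF hN hf]) (rule that)
  define A where "A = {a. a dvd l \<and> coprime N a}"
  define B where "B a = {b. b < l div a \<and> gcd (gcd a b) (l div a) = 1}" for a
  define g where "g a n = (if of_nat l * n / of_nat (a ^ 2) \<in> exps N r then cf (of_nat l * n / of_nat (a ^ 2)) else 0)"
    for a :: nat and n :: rat
  define W where "W a b n = hecke_weight N r k l a (int b) * e (of_real (of_rat (of_nat b * n / of_nat a)))"
    for a b :: nat and n :: rat
  define cT where "cT n = of_real (real l powr (- k / 2)) *
     (\<Sum>a\<in>A. of_real (real a powr k) * (\<Sum>b\<in>B a. W a b n * g a n))" for n
  \<comment> \<open>(a\<tau> + b)/d has imaginary part a/d times that of \<tau>, at least 1/l of it;
    above height lY every argument of f lies where its expansion converges.\<close>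
  define Z where "Z = real l * Y"
  have finA: "finite A" unfolding A_def using l_pos by (auto intro: finite_subset[OF _ finite_divisors_nat])
  have finB: "finite (B a)" for a unfolding B_def by auto
  have Aprops: "a > 0" "l = a * (l div a)" "l div a > 0" "coprime N a" if "a \<in> A" for a
  proof -
    show l: "l = a * (l div a)" "coprime N a" using that by (auto simp: A_def)
    show "a > 0" "l div a > 0" using l(1) l_pos by (metis gr0I mult_0, metis gr0I mult_0_right)
  qed
  have ratio: "of_nat l * n / of_nat (a ^ 2) = of_nat (l div a) * n / (of_nat a :: rat)" if "a \<in> A" for a n
  proof -
    have "(of_nat l :: rat) = of_nat a * of_nat (l div a)" using Aprops(2)[OF that] by (metis of_nat_mult)
    then show ?thesis using Aprops(1)[OF that] by (simp add: power2_eq_square)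
  qed
  have summand: "((\<lambda>n. W a b n * g a n * e (of_real (of_rat n) * \<tau>)) has_sum
      hecke_weight N r k l a (int b) * f ((of_nat a * \<tau> + of_nat b) / of_nat (l div a))) UNIV"
    if a: "a \<in> A" and \<tau>: "Im \<tau> > Z" for a b \<tau>
  proof -
    define d where "d = l div a"
    note ap = Aprops[OF a, folded d_def]
    let ?\<tau> = "(of_nat a * \<tau> + of_nat b) / of_nat d :: complex"
    have "Y < Im ?\<tau>"
    proof -
      have "Y * real d \<le> Y * real l"
        using Y0 ap by (intro mult_left_mono) (auto intro: dvd_imp_le simp: l_pos)
      also have "\<dots> < Im \<tau>" using \<tau> by (simp add: Z_def mult.commute)
      also have "\<dots> \<le> real a * Im \<tau>"
      proof -
        have "Im \<tau> \<ge> 0" using \<tau> Y0 unfolding Z_def by (smt (verit) mult_nonneg_nonneg of_nat_0_le_iff)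
        then show ?thesis using ap(1) mult_right_mono[of 1 "real a" "Im \<tau>"] by simp
      qed
      finally show ?thesis using ap(3) by (simp add: Im_divide_of_nat field_simps)
    qed
    from cf[OF this] have hs: "((\<lambda>n. cf n * e (of_real (of_rat n) * ?\<tau>)) has_sum f ?\<tau>) (exps N r)" .
    \<comment> \<open>The power q^n in f((a\<tau> + b)/d) comes from the exponent dn/a of f. This
      bijection of the rationals need not preserve \<open>exps N r\<close>, so the expansion is
      first extended by zero to all rationals.\<close>
    define \<phi> where "\<phi> n = of_nat d * n / (of_nat a :: rat)" for n
    have bij: "bij \<phi>"
      by (rule bij_betw_byWitness[where f' = "\<lambda>n. of_nat a * n / of_nat d"]) (use ap in \<open>auto simp: \<phi>_def\<close>)
    have "((\<lambda>n. (if n \<in> exps N r then cf n else 0) * e (of_real (of_rat n) * ?\<tau>)) has_sum f ?\<tau>) UNIV"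
      using hs by (rule has_sum_cong_neutral[THEN iffD1, rotated -1]) auto
    then have "((\<lambda>n. (if \<phi> n \<in> exps N r then cf (\<phi> n) else 0) * e (of_real (of_rat (\<phi> n)) * ?\<tau>)) has_sum f ?\<tau>) UNIV"
      using has_sum_reindex_bij_betw[OF bij, of "\<lambda>n. (if n \<in> exps N r then cf n else 0) * e (of_real (of_rat n) * ?\<tau>)" "f ?\<tau>"] by simp
    moreover have "(if \<phi> n \<in> exps N r then cf (\<phi> n) else 0) = g a n" for n
      unfolding g_def ratio[OF a] \<phi>_def d_def ..
    moreover have "e (of_real (of_rat (\<phi> n)) * ?\<tau>) = e (of_real (of_rat (of_nat b * n / of_nat a))) * e (of_real (of_rat n) * \<tau>)" for n
      unfolding e_add[symmetric] by (rule arg_cong[of _ _ e])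
        (use ap in \<open>simp add: \<phi>_def of_rat_mult of_rat_divide field_simps\<close>)
    ultimately have "((\<lambda>n. g a n * (e (of_real (of_rat (of_nat b * n / of_nat a))) * e (of_real (of_rat n) * \<tau>))) has_sum f ?\<tau>) UNIV"
      by simp
    from has_sum_cmult_right[OF this, of "hecke_weight N r k l a (int b)"]
    show ?thesis unfolding W_def d_def by (simp add: mult_ac)
  qed
  have full: "((\<lambda>n. cT n * e (of_real (of_rat n) * \<tau>)) has_sum hecke N k (chi_r N r) l f \<tau>) UNIV" if \<tau>: "Im \<tau> > Z" for \<tau>
  proof -
    have "((\<lambda>n. of_real (real l powr (- k / 2)) * (\<Sum>a\<in>A. of_real (real a powr k) * (\<Sum>b\<in>B a. W a b n * g a n * e (of_real (of_rat n) * \<tau>))))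
      has_sum of_real (real l powr (- k / 2)) * (\<Sum>a\<in>A. of_real (real a powr k) *
        (\<Sum>b\<in>B a. hecke_weight N r k l a (int b) * f ((of_nat a * \<tau> + of_nat b) / of_nat (l div a))))) UNIV"
      by (intro has_sum_cmult_right has_sum_sum_finite finA finB summand \<tau>)
    moreover have "of_real (real l powr (- k / 2)) * (\<Sum>a\<in>A. of_real (real a powr k) * (\<Sum>b\<in>B a. W a b n * g a n * e (of_real (of_rat n) * \<tau>)))
       = cT n * e (of_real (of_rat n) * \<tau>)" for n
      unfolding cT_def by (simp add: sum_distrib_left sum_distrib_right mult_ac)
    ultimately show ?thesis unfolding hecke_eq A_def B_def by simp
  qed
  \<comment> \<open>For each a either dn/a is no exponent of f, or the sum over b cancels; this
    brings the expansion back from all rationals to \<open>exps N r\<close>.\<close>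
  have vanish: "cT n = 0" if n: "n \<notin> exps N r" for n
  proof -
    have "(\<Sum>b\<in>B a. W a b n * g a n) = 0" if a: "a \<in> A" for a
    proof (cases "of_nat (l div a) * n / of_nat a \<in> exps N r")
      case True
      have "(\<Sum>b\<in>B a. W a b n) = 0"
        unfolding W_def B_def by (rule weight_sum_zero[OF Aprops(2,4)[OF a] True n])
      then show ?thesis by (simp add: sum_distrib_right[symmetric])
    next
      case False
      then show ?thesis unfolding g_def ratio[OF a] by simp
    qed
    then show ?thesis by (simp add: cT_def)
  qed
  have cT: "((\<lambda>n. cT n * e (of_real (of_rat n) * \<tau>)) has_sum hecke N k (chi_r N r) l f \<tau>) (exps N r)" if "Im \<tau> > Z" for \<tau>
    using full[OF that] by (rule has_sum_cong_neutral[THEN iffD1, rotated -1]) (auto simp: vanish)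
  have formula: "cT n = of_real (real l powr (- k / 2)) *
          (\<Sum>a\<in>{a. a dvd l \<and> coprime a N}.
             let d = l div a in
             of_int (kronecker (int a) (int (varpi N r))) * of_real (real a powr k) *
             (if of_nat l * n / of_nat (a ^ 2) \<in> exps N r then cf (of_nat l * n / of_nat (a ^ 2)) else 0) *
             (\<Sum>b\<in>{b. b < d \<and> gcd (gcd a b) d = 1}.
                (of_int (kronecker (- int N * int b) (int (gcd a d)))) powr (of_real (2 * k)) *
                e (of_real (of_rat (of_nat (b * d) * (n / of_nat l - of_int (x_N N r) / 24)))) *
                psi_lr N r k l a b))" for n
    unfolding cT_def Let_def
  proof (rule arg_cong2[of _ _ _ _ "(*)", OF refl], rule sum.cong)
    show "A = {a. a dvd l \<and> coprime a N}" by (auto simp: A_def coprime_commute)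
    fix a assume "a \<in> {a. a dvd l \<and> coprime a N}"
    then have a: "a \<in> A" by (auto simp: A_def coprime_commute)
    define d where "d = l div a"
    note ap = Aprops[OF a, folded d_def]
    have Bd: "B a = {b. b < d \<and> gcd (gcd a b) d = 1}" by (simp add: B_def d_def)
    let ?\<sigma> = "\<lambda>b. of_int (kronecker (- int N * int b) (int (gcd a d))) powr (of_real (2 * k)) :: complex"
    let ?K = "of_int (kronecker (int a) (int (varpi N r))) :: complex"
    have "W a b n = ?K * (?\<sigma> b * e (of_real (of_rat (of_nat (b * d) * (n / of_nat l - of_int (x_N N r) / 24)))) * psi_lr N r k l a b)" for b
    proof -
      have "e (of_real (of_rat (of_nat (b * d) * (n / of_nat l - of_int (x_N N r) / 24))))
        = e (of_real (- (of_int (int b) * of_nat d * of_int (x_N N r) / 24))) * e (of_real (of_rat (of_nat b * n / of_nat a)))"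
        unfolding e_add[symmetric]
      proof (rule arg_cong[of _ _ e])
        \<comment> \<open>l = ad turns bdn/l into bn/a, the phase coming from the translation by
          b/d.\<close>
        have "(of_nat l :: real) = of_nat a * of_nat d" using ap(2) by (metis of_nat_mult)
        then have "real_of_rat (of_nat (b * d) * (n / of_nat l - of_int (x_N N r) / 24))
           = - (of_int (int b) * of_nat d * of_int (x_N N r) / 24) + of_rat (of_nat b * n / of_nat a)"
          using ap(1,3) by (simp add: of_rat_mult of_rat_diff of_rat_divide field_simps)
        then show "complex_of_real (of_rat (of_nat (b * d) * (n / of_nat l - of_int (x_N N r) / 24)))
           = of_real (- (of_int (int b) * of_nat d * of_int (x_N N r) / 24)) + of_real (of_rat (of_nat b * n / of_nat a))"
          by (simp only: of_real_add)
      qed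
      then show ?thesis unfolding W_def hecke_weight_def psi_lr_eq d_def[symmetric] by (simp only: mult_ac)
    qed
    then have "(\<Sum>b\<in>B a. W a b n * g a n) = ?K * g a n * (\<Sum>b\<in>B a. ?\<sigma> b *
        e (of_real (of_rat (of_nat (b * d) * (n / of_nat l - of_int (x_N N r) / 24)))) * psi_lr N r k l a b)"
      by (simp only: sum_distrib_left mult_ac)
    then show "of_real (real a powr k) * (\<Sum>b\<in>B a. W a b n * g a n) =
       ?K * of_real (real a powr k) *
       (if of_nat l * n / of_nat (a ^ 2) \<in> exps N r then cf (of_nat l * n / of_nat (a ^ 2)) else 0) *
       (\<Sum>b\<in>{b. b < l div a \<and> gcd (gcd a b) (l div a) = 1}.
          of_int (kronecker (- int N * int b) (int (gcd a (l div a)))) powr (of_real (2 * k)) *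
          e (of_real (of_rat (of_nat (b * (l div a)) * (n / of_nat l - of_int (x_N N r) / 24)))) * psi_lr N r k l a b)"
      unfolding g_def[symmetric] d_def[symmetric] Bd[symmetric] by (simp only: mult_ac)
  qed
  have YZ: "Y \<le> Z" "Z \<ge> 0"
    using Y0 l_pos mult_right_mono[of 1 "real l" Y] by (auto simp: Z_def)
  show ?thesis
  proof (rule exI[of _ Z], rule conjI[OF YZ(2)], rule exI[of _ cf], rule exI[of _ cT], intro conjI allI impI ballI)
    fix \<tau> assume "Im \<tau> > Z"
    then show "((\<lambda>n. cf n * e (of_real (of_rat n) * \<tau>)) has_sum f \<tau>) (exps N r)"
      "((\<lambda>n. cT n * e (of_real (of_rat n) * \<tau>)) has_sum hecke N k (chi_r N r) l f \<tau>) (exps N r)"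
      using YZ by (auto intro: cf cT)
  next
    fix Y1 c' n
    assume *: "\<forall>\<tau>. Im \<tau> > Y1 \<longrightarrow> ((\<lambda>n. c' n * e (of_real (of_rat n) * \<tau>)) has_sum f \<tau>) (exps N r)"
      and n: "n \<in> exps N r"
    show "c' n = cf n"
      by (rule rat_expansion_unique[OF _ exps_range cf *[rule_format] n]) simp_all
  next
    fix Y1 c' n
    assume *: "\<forall>\<tau>. Im \<tau> > Y1 \<longrightarrow> ((\<lambda>n. c' n * e (of_real (of_rat n) * \<tau>)) has_sum hecke N k (chi_r N r) l f \<tau>) (exps N r)"
      and n: "n \<in> exps N r"
    show "c' n = cT n"
      by (rule rat_expansion_unique[OF _ exps_range cT *[rule_format] n]) simp_all
  qed (rule formula)
qed

end
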